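(* Let $s\in\mathbb{R}$. (i) If $f\in S_0(\mathbb{R})$ and $g\in S_0'(\mathbb{R})$, then for all $(x,\omega)\in\mathbb{R}^2$, $$V_{(C_sg)}C_sf(x,\omega)=e^{-\pi i s x^2}\,V_gf(x,\omega-sx).$$ (ii) Let $1\le r<\infty$, let $m$ be a moderate weight of polynomial growth on $\mathbb{R}^2$, and put $\nu_s(x,\omega)=m(x,\omega-sx)$. For $f\in S'(\mathbb{R})$, $f\in M^r_m$ if and only if $C_sf\in M^r_{\nu_s}$.
   Context: $C_s$ is multiplication by the chirp $e^{\pi i s t^2}$: $C_sf(t)=e^{\pi i s t^2}f(t)$, extended to (tempered or $S_0'$) distributions by $(C_s\Lambda)(\phi)=\Lambda(C_s\phi)$. $T_xf(t)=f(t-x)$, $M_\omega f(t)=e^{2\pi i\omega t}f(t)$, extended to distributions in the usual way. The short time Fourier transform is $V_gf(x,\omega)=\langle f,M_\omega T_xg\rangle$, where $\langle\cdot,\cdot\rangle$ is the sesquilinear duality pairing extending $\langle f,g\rangle=\int_{\mathbb{R}}f\overline{g}$; for functions, $V_gf(x,\omega)=\int_{\mathbb{R}}f(t)\overline{g(t-x)}e^{-2\pi i\omega t}\,dt$. A weight is a positive measurable function on $\mathbb{R}^2$. A weight $v$ is submultiplicative if $v(z_1+z_2)\le v(z_1)v(z_2)$ for all $z_1,z_2\in\mathbb{R}^2$; $m$ is moderate if there are a submultiplicative weight $v$ and $C>0$ with $m(z_1+z_2)\le C\,m(z_1)v(z_2)$. A weight has polynomial growth if it is bounded by $C(1+|x|+|\omega|)^k$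 for some $C>0,k\ge0$. All weights considered (including the submultiplicative weight $v$) have polynomial growth. For a fixed nonzero window $g\in S(\mathbb{R})$, $M^r_m$ is the space of $f\in S'(\mathbb{R})$ with $\int_{\mathbb{R}}\int_{\mathbb{R}}|V_gf(x,\omega)|^rm(x,\omega)^r\,dx\,d\omega<\infty$; different nonzero Schwartz windows give the same space with equivalent norms. $S_0(\mathbb{R})=M^1$ (weight $1$), with dual $S_0'(\mathbb{R})$. *)

theory Defs
  imports "HOL-Analysis.Analysis"
begin

section \<open>Schwartz functions and tempered distributions\<close>

definition nth_deriv :: "nat \<Rightarrow> (real \<Rightarrow> complex) \<Rightarrow> real \<Rightarrow> complex" where
  "nth_deriv n \<phi> = ((\<lambda>h t. vector_derivative h (at t)) ^^ n) \<phi>"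

definition schwartz :: "(real \<Rightarrow> complex) set" where
  "schwartz = {\<phi>. (\<forall>n t. nth_deriv n \<phi> differentiable (at t)) \<and>
     (\<forall>j n. bdd_above (range (\<lambda>t. \<bar>t\<bar> ^ j * cmod (nth_deriv n \<phi> t))))}"

definition schwartz_seminorm :: "nat \<Rightarrow> nat \<Rightarrow> (real \<Rightarrow> complex) \<Rightarrow> real" where
  "schwartz_seminorm j n \<phi> = (SUP t. \<bar>t\<bar> ^ j * cmod (nth_deriv n \<phi> t))"

type_synonym distribution = "(real \<Rightarrow> complex) \<Rightarrow> complex"

text \<open>
  Distributions are complex-linear functionals, a function \<open>f\<close> being identified with
  \<open>\<phi> \<mapsto> \<integral> f \<phi>\<close>.  Since HOL functions are total, a functional on the Schwartz space is
  extended by \<open>0\<close>, so that each tempered distribution has exactly one representative.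
\<close>

definition tempered_distributions :: "distribution set" where
  "tempered_distributions = {\<Lambda>.
     (\<forall>\<phi>\<in>schwartz. \<forall>\<psi>\<in>schwartz. \<Lambda> (\<lambda>t. \<phi> t + \<psi> t) = \<Lambda> \<phi> + \<Lambda> \<psi>) \<and>
     (\<forall>c. \<forall>\<phi>\<in>schwartz. \<Lambda> (\<lambda>t. c * \<phi> t) = c * \<Lambda> \<phi>) \<and>
     (\<exists>C N. \<forall>\<phi>\<in>schwartz. cmod (\<Lambda> \<phi>) \<le> C * (\<Sum>j\<le>N. \<Sum>n\<le>N. schwartz_seminorm j n \<phi>)) \<and>
     (\<forall>\<phi>. \<phi> \<notin> schwartz \<longrightarrow> \<Lambda> \<phi> = 0)}"


section \<open>Chirps, translations, modulations\<close>

definition chirp :: "real \<Rightarrow> (real \<Rightarrow> complex) \<Rightarrow> real \<Rightarrow> complex" where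
  "chirp s f = (\<lambda>t. exp (\<i> * of_real (pi * s * t\<^sup>2)) * f t)"

definition translate :: "real \<Rightarrow> (real \<Rightarrow> complex) \<Rightarrow> real \<Rightarrow> complex" where
  "translate x f = (\<lambda>t. f (t - x))"

definition modulate :: "real \<Rightarrow> (real \<Rightarrow> complex) \<Rightarrow> real \<Rightarrow> complex" where
  "modulate \<omega> f = (\<lambda>t. exp (\<i> * of_real (2 * pi * \<omega> * t)) * f t)"

definition chirp_dist :: "real \<Rightarrow> distribution \<Rightarrow> distribution" where
  "chirp_dist s \<Lambda> = (\<lambda>\<phi>. \<Lambda> (chirp s \<phi>))"

definition translate_dist :: "real \<Rightarrow> distribution \<Rightarrow> distribution" where
  "translate_dist x \<Lambda> = (\<lambda>\<phi>. \<Lambda> (translate (- x) \<phi>))"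

definition modulate_dist :: "real \<Rightarrow> distribution \<Rightarrow> distribution" where
  "modulate_dist \<omega> \<Lambda> = (\<lambda>\<phi>. \<Lambda> (modulate \<omega> \<phi>))"

text \<open>Complex conjugation, consistent with the identification of \<open>f\<close> with \<open>\<phi> \<mapsto> \<integral> f \<phi>\<close>.\<close>

definition conj_dist :: "distribution \<Rightarrow> distribution" where
  "conj_dist \<Lambda> = (\<lambda>\<phi>. cnj (\<Lambda> (\<lambda>t. cnj (\<phi> t))))"


section \<open>Short time Fourier transform and modulation spaces\<close>

text \<open>The sesquilinear pairing \<open>\<langle>\<Lambda>, \<phi>\<rangle>\<close>, which for functions is \<open>\<integral> \<Lambda> \<cdot> cnj \<phi>\<close>.\<close>

definition pairing :: "distribution \<Rightarrow> (real \<Rightarrow> complex) \<Rightarrow> complex" where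
  "pairing \<Lambda> \<phi> = \<Lambda> (\<lambda>t. cnj (\<phi> t))"

definition stft :: "(real \<Rightarrow> complex) \<Rightarrow> distribution \<Rightarrow> real \<Rightarrow> real \<Rightarrow> complex" where
  "stft g \<Lambda> x \<omega> = pairing \<Lambda> (modulate \<omega> (translate x g))"

definition weight :: "(real \<times> real \<Rightarrow> real) \<Rightarrow> bool" where
  "weight m \<longleftrightarrow> (\<forall>z. m z > 0) \<and> m \<in> borel_measurable lebesgue"

definition submultiplicative :: "(real \<times> real \<Rightarrow> real) \<Rightarrow> bool" where
  "submultiplicative v \<longleftrightarrow> (\<forall>z1 z2. v (z1 + z2) \<le> v z1 * v z2)"

definition polynomial_growth :: "(real \<times> real \<Rightarrow> real) \<Rightarrow> bool" where
  "polynomial_growth m \<longleftrightarrow>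
     (\<exists>C>0. \<exists>k\<ge>0. \<forall>x \<omega>. m (x, \<omega>) \<le> C * (1 + \<bar>x\<bar> + \<bar>\<omega>\<bar>) powr k)"

definition moderate :: "(real \<times> real \<Rightarrow> real) \<Rightarrow> bool" where
  "moderate m \<longleftrightarrow> (\<exists>v. weight v \<and> submultiplicative v \<and> polynomial_growth v \<and>
     (\<exists>C>0. \<forall>z1 z2. m (z1 + z2) \<le> C * m z1 * v z2))"

text \<open>\<open>M\<^sup>r\<^sub>m\<close> with respect to a fixed window \<open>g\<close>.\<close>

definition modulation_space ::
    "(real \<Rightarrow> complex) \<Rightarrow> real \<Rightarrow> (real \<times> real \<Rightarrow> real) \<Rightarrow> distribution set" where
  "modulation_space g r m = {\<Lambda> \<in> tempered_distributions.
     integrable lebesgue (\<lambda>(x, \<omega>). cmod (stft g \<Lambda> x \<omega>) powr r * m (x, \<omega>) powr r)}"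

definition modulation_norm ::
    "(real \<Rightarrow> complex) \<Rightarrow> real \<Rightarrow> (real \<times> real \<Rightarrow> real) \<Rightarrow> distribution \<Rightarrow> real" where
  "modulation_norm g r m \<Lambda> =
     (LINT (x, \<omega>)|lebesgue. cmod (stft g \<Lambda> x \<omega>) powr r * m (x, \<omega>) powr r) powr (1 / r)"


section \<open>The space S0 and its dual\<close>

abbreviation S0 :: "(real \<Rightarrow> complex) \<Rightarrow> distribution set" where
  "S0 g \<equiv> modulation_space g 1 (\<lambda>_. 1)"

abbreviation S0_norm :: "(real \<Rightarrow> complex) \<Rightarrow> distribution \<Rightarrow> real" where
  "S0_norm g \<equiv> modulation_norm g 1 (\<lambda>_. 1)"

text \<open>
  As a subspace of the tempered distributions, S0 consists of distributions; its dual
  consists of the bounded linear functionals on S0 (their values off S0 are irrelevant).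
\<close>

definition S0_dual :: "(real \<Rightarrow> complex) \<Rightarrow> (distribution \<Rightarrow> complex) set" where
  "S0_dual g = {G.
     (\<forall>f\<in>S0 g. \<forall>h\<in>S0 g. G (\<lambda>\<phi>. f \<phi> + h \<phi>) = G f + G h) \<and>
     (\<forall>c. \<forall>f\<in>S0 g. G (\<lambda>\<phi>. c * f \<phi>) = c * G f) \<and>
     (\<exists>C. \<forall>f\<in>S0 g. cmod (G f) \<le> C * S0_norm g f)}"

definition chirp_S0_dual :: "real \<Rightarrow> (distribution \<Rightarrow> complex) \<Rightarrow> distribution \<Rightarrow> complex" where
  "chirp_S0_dual s G = (\<lambda>f. G (chirp_dist s f))"

definition translate_S0_dual :: "real \<Rightarrow> (distribution \<Rightarrow> complex) \<Rightarrow> distribution \<Rightarrow> complex" where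
  "translate_S0_dual x G = (\<lambda>f. G (translate_dist (- x) f))"

definition modulate_S0_dual :: "real \<Rightarrow> (distribution \<Rightarrow> complex) \<Rightarrow> distribution \<Rightarrow> complex" where
  "modulate_S0_dual \<omega> G = (\<lambda>f. G (modulate_dist \<omega> f))"

text \<open>
  The pairing \<open>\<langle>f, G\<rangle>\<close> for \<open>f\<close> in S0 and \<open>G\<close> in its dual: the complex conjugate of
  \<open>\<langle>G, f\<rangle> = G (cnj f)\<close>.
\<close>

definition pairing_S0 :: "distribution \<Rightarrow> (distribution \<Rightarrow> complex) \<Rightarrow> complex" where
  "pairing_S0 f G = cnj (G (conj_dist f))"

definition stft_S0 :: "(distribution \<Rightarrow> complex) \<Rightarrow> distribution \<Rightarrow> real \<Rightarrow> real \<Rightarrow> complex" where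
  "stft_S0 G f x \<omega> = pairing_S0 f (modulate_S0_dual \<omega> (translate_S0_dual x G))"

end

theory Submission
  imports Defs "HOL-Probability.Probability" "HOL-Real_Asymp.Real_Asymp"
begin

text \<open>
  Commuting a chirp through translations and modulations gives
  \<open>C_s M_\<omega> T_x C_{-s} = e^{-\<pi>isx^2} M_{\<omega>+sx} T_x\<close>.  Hence
  \<open>|V_w (C_s f)(x, \<omega>)| = |V_{C_{-s} w} f (x, \<omega> - s x)|\<close>, and since shears preserve Lebesgue
  measure the second claim says that the windows \<open>w\<close> and \<open>C_{-s} w\<close> define the same modulation
  space.  The first claim is the same commutation relation, but bringing the phase out of a
  functional that is linear only on S0 requires S0 to be invariant under complex conjugation,
  i.e. the windows \<open>w\<close> and its conjugate to define the same S0.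

  Window independence rests on the expansion
  \<open>\<parallel>h\<parallel>^2 \<phi> = \<integral>\<integral> V_h \<phi>(x, \<omega>) M_\<omega> T_x h dx d\<omega>\<close> of a Schwartz function \<open>\<phi>\<close>: by rapid decay of
  \<open>V_h \<phi>\<close> a tempered distribution may be applied under the integral (Riemann sums converge in
  every Schwartz seminorm).  This bounds \<open>|V_\<gamma> f|\<close> by the convolution of \<open>|V_g f|\<close> with a rapidly
  decaying function, and Young's inequality for moderate weights applies.
\<close>

text \<open>A tempered distribution enters only as a linear functional with a seminorm estimate, and
  such a functional commutes with finite sums. Integrals of Schwartz families are therefore replaced
  by Riemann sums whose error is measured in the very seminorm that controls the functional. The
  expansion itself is Fourier inversion in \<omega> of u -> \<phi>(u) cnj(h(u - x)), followed by
  integration over x, which produces the squared norm of h. To obtain a convolution rather than a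
  general kernel, the distribution is first shifted so that the point z becomes the origin; the same
  Schwartz function is then expanded for every z. The decay order of the kernel is a free parameter,
  so it can be chosen after the exponent r and the growth of the weight are known. Weights are
  merely Lebesgue measurable, while Tonelli's theorem is applied to Borel functions; each weight is
  therefore compared with one that is constant on unit squares. In the second claim the shear is
  undone before the windows are exchanged, so the convolution bound is applied with the weight m
  itself.\<close>

section \<open>Schwartz functions and continuity of tempered distributions\<close>

text \<open>An explicit tower of derivatives. \<open>nth_deriv\<close> iterates
  \<open>vector_derivative\<close>, which has a value even where no derivative exists; with a tower
  in hand, derivatives of products and translates are written down directly and identified with
  \<open>nth_deriv\<close> by \<open>derivs_nth_deriv\<close>.\<close>

definition derivs :: "(real \<Rightarrow> complex) \<Rightarrow> (nat \<Rightarrow> real \<Rightarrow> complex) \<Rightarrow> bool" where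
  "derivs \<phi> d \<longleftrightarrow> d 0 = \<phi> \<and> (\<forall>n t. (d n has_vector_derivative d (Suc n) t) (at t))"

lemma nth_deriv_0 [simp]: "nth_deriv 0 \<phi> = \<phi>"
  by (simp add: nth_deriv_def)

lemma nth_deriv_Suc: "nth_deriv (Suc n) \<phi> t = vector_derivative (nth_deriv n \<phi>) (at t)"
  by (simp add: nth_deriv_def)

lemma derivs_nth_deriv:
  assumes "derivs \<phi> d" shows "nth_deriv n \<phi> = d n"
proof (induction n)
  case 0 then show ?case using assms by (simp add: derivs_def)
next
  case (Suc n)
  show ?case
    using assms by (intro ext) (simp add: nth_deriv_Suc Suc derivs_def vector_derivative_at)
qed

lemma derivs_iff_smooth:
  "(\<exists>d. derivs \<phi> d) \<longleftrightarrow> (\<forall>n t. nth_deriv n \<phi> differentiable (at t))"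
proof
  assume "\<exists>d. derivs \<phi> d"
  then obtain d where d: "derivs \<phi> d" by blast
  then show "\<forall>n t. nth_deriv n \<phi> differentiable (at t)"
    unfolding derivs_nth_deriv[OF d] derivs_def by (meson differentiableI_vector)
next
  assume "\<forall>n t. nth_deriv n \<phi> differentiable (at t)"
  then have "derivs \<phi> (\<lambda>n. nth_deriv n \<phi>)"
    by (auto simp: derivs_def nth_deriv_Suc vector_derivative_works)
  then show "\<exists>d. derivs \<phi> d" by blast
qed

section \<open>Derivative towers under algebraic operations; the Leibniz rule\<close>

lemma derivs_translate:
  "derivs \<phi> d \<Longrightarrow> derivs (translate x \<phi>) (\<lambda>n. translate x (d n))"
  unfolding derivs_def translate_def
proof (intro conjI allI; elim conjE)
  fix n t
  assume "\<forall>n t. (d n has_vector_derivative d (Suc n) t) (at t)"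
  then have "(d n has_vector_derivative d (Suc n) (t - x)) (at (t - x))" by blast
  then have "((d n \<circ> (\<lambda>t. t - x)) has_vector_derivative 1 *\<^sub>R d (Suc n) (t - x)) (at t)"
    by (intro vector_diff_chain_at) (auto intro!: derivative_eq_intros)
  then show "((\<lambda>t. d n (t - x)) has_vector_derivative d (Suc n) (t - x)) (at t)"
    by (simp add: o_def)
qed simp

lemma derivs_cnj: "derivs \<phi> d \<Longrightarrow> derivs (\<lambda>t. cnj (\<phi> t)) (\<lambda>n t. cnj (d n t))"
  unfolding derivs_def by (auto intro: has_vector_derivative_cnj)

lemma derivs_cmult: "derivs \<phi> d \<Longrightarrow> derivs (\<lambda>t. c * \<phi> t) (\<lambda>n t. c * d n t)"
  unfolding derivs_def by (auto intro: has_vector_derivative_mult_right)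

lemma derivs_add:
  "derivs \<phi> d \<Longrightarrow> derivs \<psi> e \<Longrightarrow> derivs (\<lambda>t. \<phi> t + \<psi> t) (\<lambda>n t. d n t + e n t)"
  unfolding derivs_def by (auto intro: has_vector_derivative_add)

definition leibniz ::
    "(nat \<Rightarrow> real \<Rightarrow> complex) \<Rightarrow> (nat \<Rightarrow> real \<Rightarrow> complex) \<Rightarrow> nat \<Rightarrow> real \<Rightarrow> complex" where
  "leibniz d e n t = (\<Sum>k\<le>n. of_nat (n choose k) * d k t * e (n - k) t)"

lemma derivs_mult:
  assumes d: "derivs \<phi> d" and e: "derivs \<psi> e"
  shows "derivs (\<lambda>t. \<phi> t * \<psi> t) (leibniz d e)"
  unfolding derivs_def
proof (intro conjI allI)
  show "leibniz d e 0 = (\<lambda>t. \<phi> t * \<psi> t)"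
    using d e by (auto simp: leibniz_def derivs_def)
  fix n t
  have de: "\<And>n. (d n has_vector_derivative d (Suc n) t) (at t)"
    "\<And>n. (e n has_vector_derivative e (Suc n) t) (at t)"
    using d e by (auto simp: derivs_def)
  have "(leibniz d e n has_vector_derivative
     (\<Sum>k\<le>n. of_nat (n choose k) * (d k t * e (Suc (n - k)) t + d (Suc k) t * e (n - k) t))) (at t)"
    unfolding leibniz_def mult.assoc
    by (intro has_vector_derivative_sum has_vector_derivative_mult_right has_vector_derivative_mult de)
  moreover have "(\<Sum>k\<le>n. of_nat (n choose k) * (d k t * e (Suc (n - k)) t + d (Suc k) t * e (n - k) t))
    = leibniz d e (Suc n) t"
  proof -
    define F where "F k = d k t * e (Suc n - k) t" for k
    have "(\<Sum>k\<le>n. of_nat (n choose k) * (d k t * e (Suc (n - k)) t + d (Suc k) t * e (n - k) t))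
      = (\<Sum>k\<le>n. of_nat (n choose k) * F k) + (\<Sum>k\<le>n. of_nat (n choose k) * F (Suc k))"
      by (simp add: F_def sum.distrib[symmetric] algebra_simps Suc_diff_le)
    \<comment> \<open>The added term with k = Suc n vanishes because
      \<open>n choose Suc n = 0\<close>; splitting off k = 0 then aligns the two sums for Pascal's
      rule.\<close>
    also have "(\<Sum>k\<le>n. of_nat (n choose k) * F k) = (\<Sum>k\<le>Suc n. of_nat (n choose k) * F k)"
      by simp
    also have "\<dots> = F 0 + (\<Sum>k\<le>n. of_nat (n choose Suc k) * F (Suc k))"
      by (subst sum.atMost_Suc_shift) simp
    also have "\<dots> + (\<Sum>k\<le>n. of_nat (n choose k) * F (Suc k))
      = F 0 + (\<Sum>k\<le>n. of_nat (Suc n choose Suc k) * F (Suc k))"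
      by (simp add: sum.distrib[symmetric] algebra_simps)
    also have "\<dots> = (\<Sum>k\<le>Suc n. of_nat (Suc n choose k) * F k)"
      by (simp only: sum.atMost_Suc_shift binomial_n_0 of_nat_1 mult_1)
    finally show ?thesis by (simp add: leibniz_def F_def mult.assoc)
  qed
  ultimately show "(leibniz d e n has_vector_derivative leibniz d e (Suc n) t) (at t)" by simp
qed

text \<open>Constants depending on the order of the derivative are kept apart from the factors
  \<alpha> and \<beta>, which in the applications carry the growth or decay in t, x and \<omega>;
  these factors come out of the sum unchanged.\<close>

lemma leibniz_bound:
  assumes "\<And>k. k \<le> n \<Longrightarrow> cmod (d k t) \<le> a k * \<alpha>" "\<And>k. k \<le> n \<Longrightarrow> cmod (e k t) \<le> b k * \<beta>"
  shows "cmod (leibniz d e n t) \<le> (\<Sum>k\<le>n. of_nat (n choose k) * a k * b (n - k)) * (\<alpha> * \<beta>)"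
proof -
  have "cmod (leibniz d e n t) \<le> (\<Sum>k\<le>n. of_nat (n choose k) * cmod (d k t) * cmod (e (n - k) t))"
    unfolding leibniz_def by (rule order.trans[OF norm_sum]) (simp add: norm_mult)
  also have "\<dots> \<le> (\<Sum>k\<le>n. of_nat (n choose k) * ((a k * \<alpha>) * (b (n - k) * \<beta>)))"
    unfolding mult.assoc
  proof (intro sum_mono mult_left_mono)
    fix k assume "k \<in> {..n}"
    then have "cmod (d k t) \<le> a k * \<alpha>" "cmod (e (n - k) t) \<le> b (n - k) * \<beta>"
      using assms by auto
    then have "cmod (d k t) * cmod (e (n - k) t) \<le> (a k * \<alpha>) * (b (n - k) * \<beta>)"
      by (meson mult_mono norm_ge_zero order.trans)
    then show "cmod (d k t) * cmod (e (n - k) t) \<le> a k * (\<alpha> * (b (n - k) * \<beta>))"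
      by (simp add: mult.assoc)
  qed auto
  also have "\<dots> = (\<Sum>k\<le>n. of_nat (n choose k) * a k * b (n - k)) * (\<alpha> * \<beta>)"
    unfolding sum_distrib_right by (intro sum.cong) auto
  finally show ?thesis .
qed

text \<open>Passes from the powers of |t| in the seminorms to powers of 1 + |t|, which never vanish
  and are submultiplicative under translation.\<close>

lemma one_plus_power_le:
  fixes y :: real assumes "0 \<le> y" shows "(1 + y) ^ N \<le> 2 ^ N * (1 + y ^ N)"
proof -
  have "(1 + y) ^ N \<le> (2 * max 1 y) ^ N"
    using assms by (intro power_mono) auto
  also have "\<dots> = 2 ^ N * max 1 (y ^ N)"
    using assms one_le_power[of y N] power_le_one[of y N]
    by (cases "1 \<le> y") (auto simp: power_mult_distrib max_def)
  also have "\<dots> \<le> 2 ^ N * (1 + y ^ N)"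
    using assms by (intro mult_left_mono) auto
  finally show ?thesis .
qed

section \<open>Decay and closure properties of Schwartz functions\<close>

lemma schwartzI:
  assumes d: "derivs \<phi> d" and b: "\<And>n N. \<exists>D. \<forall>t. (1 + \<bar>t\<bar>) ^ N * cmod (d n t) \<le> D"
  shows "\<phi> \<in> schwartz"
proof -
  have "bdd_above (range (\<lambda>t. \<bar>t\<bar> ^ j * cmod (nth_deriv n \<phi> t)))" for j n
  proof -
    obtain D where D: "\<And>t. (1 + \<bar>t\<bar>) ^ j * cmod (d n t) \<le> D" using b by blast
    have "\<bar>t\<bar> ^ j * cmod (d n t) \<le> D" for t
      by (rule order.trans[OF _ D[of t]]) (intro mult_right_mono power_mono, auto)
    then show ?thesis unfolding derivs_nth_deriv[OF d] by (intro bdd_aboveI2)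
  qed
  then show ?thesis using d derivs_iff_smooth[of \<phi>] unfolding schwartz_def by blast
qed

lemma schwartz_derivs: "\<phi> \<in> schwartz \<Longrightarrow> derivs \<phi> (\<lambda>n. nth_deriv n \<phi>)"
  using derivs_iff_smooth[of \<phi>] derivs_nth_deriv[of \<phi>] unfolding schwartz_def
  by (metis (no_types, lifting) ext mem_Collect_eq)

lemma seminorm_ge:
  "\<phi> \<in> schwartz \<Longrightarrow> \<bar>t\<bar> ^ j * cmod (nth_deriv n \<phi> t) \<le> schwartz_seminorm j n \<phi>"
  unfolding schwartz_seminorm_def schwartz_def by (auto intro!: cSUP_upper)

lemma seminorm_nonneg: "\<phi> \<in> schwartz \<Longrightarrow> 0 \<le> schwartz_seminorm j n \<phi>"
  by (rule order.trans[OF _ seminorm_ge[of \<phi> 0]]) auto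

lemma weighted_le_seminorm:
  assumes "\<phi> \<in> schwartz"
  shows "(1 + \<bar>t\<bar>) ^ N * cmod (nth_deriv n \<phi> t)
    \<le> 2 ^ N * (schwartz_seminorm 0 n \<phi> + schwartz_seminorm N n \<phi>)"
proof -
  have "(1 + \<bar>t\<bar>) ^ N * cmod (nth_deriv n \<phi> t) \<le> 2 ^ N * (1 + \<bar>t\<bar> ^ N) * cmod (nth_deriv n \<phi> t)"
    by (intro mult_right_mono one_plus_power_le) auto
  also have "\<dots> = 2 ^ N * (\<bar>t\<bar> ^ 0 * cmod (nth_deriv n \<phi> t) + \<bar>t\<bar> ^ N * cmod (nth_deriv n \<phi> t))"
    by (simp add: algebra_simps)
  also have "\<dots> \<le> 2 ^ N * (schwartz_seminorm 0 n \<phi> + schwartz_seminorm N n \<phi>)"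
    by (intro mult_left_mono add_mono seminorm_ge assms) auto
  finally show ?thesis .
qed

lemma schwartz_bound:
  assumes "\<phi> \<in> schwartz"
  obtains D where "D > 0" "\<And>t. (1 + \<bar>t\<bar>) ^ N * cmod (nth_deriv n \<phi> t) \<le> D"
proof -
  define D where "D = 2 ^ N * (schwartz_seminorm 0 n \<phi> + schwartz_seminorm N n \<phi>) + 1"
  have "D > 0" unfolding D_def using seminorm_nonneg[OF assms]
    by (intro add_nonneg_pos mult_nonneg_nonneg add_nonneg_nonneg) auto
  moreover have "(1 + \<bar>t\<bar>) ^ N * cmod (nth_deriv n \<phi> t) \<le> D" for t
    using weighted_le_seminorm[OF assms, of t N n] by (simp add: D_def)
  ultimately show ?thesis using that by blast
qed

lemma schwartz_decay:
  assumes "\<phi> \<in> schwartz"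
  obtains D where "\<And>n. D n > 0"
    "\<And>n t. cmod (nth_deriv n \<phi> t) \<le> D n * inverse ((1 + \<bar>t\<bar>) ^ N)"
proof -
  have "\<exists>D. D > 0 \<and> (\<forall>t. cmod (nth_deriv n \<phi> t) \<le> D * inverse ((1 + \<bar>t\<bar>) ^ N))" for n
  proof -
    obtain D where "D > 0" and D: "\<And>t. (1 + \<bar>t\<bar>) ^ N * cmod (nth_deriv n \<phi> t) \<le> D"
      using schwartz_bound[OF assms] by blast
    moreover have "cmod (nth_deriv n \<phi> t) \<le> D * inverse ((1 + \<bar>t\<bar>) ^ N)" for t
      using D[of t] by (simp add: field_simps add_pos_nonneg)
    ultimately show ?thesis by blast
  qed
  then show ?thesis using that by metis
qed

lemma schwartz_continuous: "\<phi> \<in> schwartz \<Longrightarrow> continuous_on S (nth_deriv n \<phi>)"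
  using schwartz_derivs[of \<phi>] unfolding derivs_def
  by (intro continuous_at_imp_continuous_on ballI has_vector_derivative_continuous) auto

lemma schwartz_cmult: assumes "\<phi> \<in> schwartz" shows "(\<lambda>t. c * \<phi> t) \<in> schwartz"
proof (rule schwartzI[OF derivs_cmult[OF schwartz_derivs[OF assms]]])
  fix n N
  obtain D where D: "\<And>t. (1 + \<bar>t\<bar>) ^ N * cmod (nth_deriv n \<phi> t) \<le> D"
    using schwartz_bound[OF assms] by blast
  have "(1 + \<bar>t\<bar>) ^ N * cmod (c * nth_deriv n \<phi> t) \<le> cmod c * D" for t
    using mult_left_mono[OF D[of t], of "cmod c"] by (simp add: norm_mult mult_ac)
  then show "\<exists>D. \<forall>t. (1 + \<bar>t\<bar>) ^ N * cmod (c * nth_deriv n \<phi> t) \<le> D" by blast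
qed

lemma schwartz_cmult_iff: "c \<noteq> 0 \<Longrightarrow> (\<lambda>t. c * \<phi> t) \<in> schwartz \<longleftrightarrow> \<phi> \<in> schwartz"
  using schwartz_cmult[of \<phi> c] schwartz_cmult[of "\<lambda>t. c * \<phi> t" "inverse c"]
  by (auto simp: mult.assoc[symmetric])

lemma schwartz_cnj: assumes "\<phi> \<in> schwartz" shows "(\<lambda>t. cnj (\<phi> t)) \<in> schwartz"
proof (rule schwartzI[OF derivs_cnj[OF schwartz_derivs[OF assms]]])
  fix n N
  obtain D where "\<And>t. (1 + \<bar>t\<bar>) ^ N * cmod (nth_deriv n \<phi> t) \<le> D"
    using schwartz_bound[OF assms, of N n] by metis
  then show "\<exists>D. \<forall>t. (1 + \<bar>t\<bar>) ^ N * cmod (cnj (nth_deriv n \<phi> t)) \<le> D" by auto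
qed

lemma schwartz_cnj_iff: "(\<lambda>t. cnj (\<phi> t)) \<in> schwartz \<longleftrightarrow> \<phi> \<in> schwartz"
  using schwartz_cnj[of \<phi>] schwartz_cnj[of "\<lambda>t. cnj (\<phi> t)"] by (metis complex_cnj_cnj ext)

lemma schwartz_add:
  assumes "\<phi> \<in> schwartz" "\<psi> \<in> schwartz" shows "(\<lambda>t. \<phi> t + \<psi> t) \<in> schwartz"
proof (rule schwartzI[OF derivs_add[OF schwartz_derivs[OF assms(1)] schwartz_derivs[OF assms(2)]]])
  fix n N
  obtain D where D: "\<And>t. (1 + \<bar>t\<bar>) ^ N * cmod (nth_deriv n \<phi> t) \<le> D"
    using schwartz_bound[OF assms(1)] by blast
  obtain E where E: "\<And>t. (1 + \<bar>t\<bar>) ^ N * cmod (nth_deriv n \<psi> t) \<le> E"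
    using schwartz_bound[OF assms(2)] by blast
  have "(1 + \<bar>t\<bar>) ^ N * cmod (nth_deriv n \<phi> t + nth_deriv n \<psi> t) \<le> D + E" for t
    by (rule order.trans[OF mult_left_mono[OF norm_triangle_ineq]])
      (use D[of t] E[of t] in \<open>auto simp: distrib_left\<close>)
  then show "\<exists>D. \<forall>t. (1 + \<bar>t\<bar>) ^ N * cmod (nth_deriv n \<phi> t + nth_deriv n \<psi> t) \<le> D" by blast
qed

section \<open>Continuity estimates for tempered distributions\<close>

text \<open>One index N governs both the weight and the order of differentiation, and E is an upper
  bound instead of a supremum, so the condition is checked pointwise in t.
  \<open>tempered_bound\<close> and \<open>temperedI\<close> show that these bounds describe the
  same continuity as the double sums of seminorms.\<close>

definition schwartz_size_le :: "nat \<Rightarrow> (real \<Rightarrow> complex) \<Rightarrow> real \<Rightarrow> bool" where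
  "schwartz_size_le N \<phi> E \<longleftrightarrow> (\<forall>n\<le>N. \<forall>t. (1 + \<bar>t\<bar>) ^ N * cmod (nth_deriv n \<phi> t) \<le> E)"

lemma tempered_bound:
  assumes "\<Lambda> \<in> tempered_distributions"
  obtains C N where "C \<ge> 0" "\<And>\<phi> E. \<phi> \<in> schwartz \<Longrightarrow> schwartz_size_le N \<phi> E \<Longrightarrow> cmod (\<Lambda> \<phi>) \<le> C * E"
proof -
  obtain C N where C: "\<And>\<phi>. \<phi> \<in> schwartz \<Longrightarrow>
      cmod (\<Lambda> \<phi>) \<le> C * (\<Sum>j\<le>N. \<Sum>n\<le>N. schwartz_seminorm j n \<phi>)"
    using assms unfolding tempered_distributions_def by blast
  \<comment> \<open>The double sum has \<open>Suc N * Suc N\<close> terms, each at most E. The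
    absolute value is taken because the constant in the definition may be negative.\<close>
  have "cmod (\<Lambda> \<phi>) \<le> (\<bar>C\<bar> * (real (Suc N) * real (Suc N))) * E"
    if \<phi>: "\<phi> \<in> schwartz" and E: "schwartz_size_le N \<phi> E" for \<phi> E
  proof -
    have "schwartz_seminorm j n \<phi> \<le> E" if "j \<le> N" "n \<le> N" for j n
      unfolding schwartz_seminorm_def
    proof (rule cSUP_least)
      fix t :: real
      have "\<bar>t\<bar> ^ j \<le> (1 + \<bar>t\<bar>) ^ j" by (intro power_mono) auto
      also have "\<dots> \<le> (1 + \<bar>t\<bar>) ^ N" using that by (intro power_increasing) auto
      finally have "\<bar>t\<bar> ^ j * cmod (nth_deriv n \<phi> t) \<le> (1 + \<bar>t\<bar>) ^ N * cmod (nth_deriv n \<phi> t)"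
        by (rule mult_right_mono) simp
      then show "\<bar>t\<bar> ^ j * cmod (nth_deriv n \<phi> t) \<le> E"
        using E \<open>n \<le> N\<close> unfolding schwartz_size_le_def by (meson order.trans)
    qed simp
    then have "(\<Sum>j\<le>N. \<Sum>n\<le>N. schwartz_seminorm j n \<phi>) \<le> (\<Sum>j\<le>N. \<Sum>n\<le>N. E)"
      by (intro sum_mono) auto
    also have "\<dots> = real (Suc N) * real (Suc N) * E" by simp
    finally have "\<bar>C\<bar> * (\<Sum>j\<le>N. \<Sum>n\<le>N. schwartz_seminorm j n \<phi>)
        \<le> \<bar>C\<bar> * (real (Suc N) * real (Suc N) * E)"
      by (rule mult_left_mono) simp
    moreover have "C * (\<Sum>j\<le>N. \<Sum>n\<le>N. schwartz_seminorm j n \<phi>)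
        \<le> \<bar>C\<bar> * (\<Sum>j\<le>N. \<Sum>n\<le>N. schwartz_seminorm j n \<phi>)"
      by (intro mult_right_mono sum_nonneg seminorm_nonneg \<phi>) auto
    ultimately show ?thesis using C[OF \<phi>] by (simp add: mult.assoc)
  qed
  then show ?thesis by (intro that[of "\<bar>C\<bar> * (real (Suc N) * real (Suc N))" N]) auto
qed

text \<open>The factor \<open>2 ^ N\<close> comes from \<open>one_plus_power_le\<close>; the factor
  2 comes from the two seminorms, of weights 0 and N, in \<open>weighted_le_seminorm\<close>, each
  of which is at most the double sum.\<close>

lemma schwartz_size_exists:
  assumes "\<phi> \<in> schwartz"
  shows "schwartz_size_le N \<phi> (2 ^ N * 2 * (\<Sum>j\<le>N. \<Sum>n\<le>N. schwartz_seminorm j n \<phi>))"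
  unfolding schwartz_size_le_def
proof (intro allI impI)
  fix n t assume n: "n \<le> N"
  define S where "S = (\<Sum>j\<le>N. \<Sum>n\<le>N. schwartz_seminorm j n \<phi>)"
  have "schwartz_seminorm j n \<phi> \<le> S" if "j \<le> N" for j
  proof -
    have "schwartz_seminorm j n \<phi> \<le> (\<Sum>n\<le>N. schwartz_seminorm j n \<phi>)"
      using n by (intro member_le_sum seminorm_nonneg assms) auto
    also have "\<dots> \<le> S" unfolding S_def
      using that by (intro member_le_sum[of j] sum_nonneg seminorm_nonneg assms) auto
    finally show ?thesis .
  qed
  from this[of 0] this[of N] have "schwartz_seminorm 0 n \<phi> + schwartz_seminorm N n \<phi> \<le> 2 * S"
    by simp
  then have "2 ^ N * (schwartz_seminorm 0 n \<phi> + schwartz_seminorm N n \<phi>) \<le> 2 ^ N * (2 * S)"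
    by (intro mult_left_mono) auto
  then show "(1 + \<bar>t\<bar>) ^ N * cmod (nth_deriv n \<phi> t) \<le> 2 ^ N * 2 * S"
    using weighted_le_seminorm[OF assms, of t N n] by linarith
qed

lemma temperedI:
  assumes "\<And>\<phi> \<psi>. \<phi> \<in> schwartz \<Longrightarrow> \<psi> \<in> schwartz \<Longrightarrow> \<Lambda> (\<lambda>t. \<phi> t + \<psi> t) = \<Lambda> \<phi> + \<Lambda> \<psi>"
    "\<And>c \<phi>. \<phi> \<in> schwartz \<Longrightarrow> \<Lambda> (\<lambda>t. c * \<phi> t) = c * \<Lambda> \<phi>"
    "\<And>\<phi>. \<phi> \<notin> schwartz \<Longrightarrow> \<Lambda> \<phi> = 0"
    "\<And>\<phi> E. \<phi> \<in> schwartz \<Longrightarrow> schwartz_size_le N \<phi> E \<Longrightarrow> cmod (\<Lambda> \<phi>) \<le> C * E"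
  shows "\<Lambda> \<in> tempered_distributions"
  unfolding tempered_distributions_def
proof (intro CollectI conjI ballI allI impI)
  show "\<exists>C N. \<forall>\<phi>\<in>schwartz. cmod (\<Lambda> \<phi>) \<le> C * (\<Sum>j\<le>N. \<Sum>n\<le>N. schwartz_seminorm j n \<phi>)"
  proof (intro exI ballI)
    fix \<phi> assume "\<phi> \<in> schwartz"
    from assms(4)[OF this schwartz_size_exists[OF this]]
    show "cmod (\<Lambda> \<phi>) \<le> (C * 2 ^ N * 2) * (\<Sum>j\<le>N. \<Sum>n\<le>N. schwartz_seminorm j n \<phi>)"
      by (simp add: mult.assoc)
  qed
qed (use assms in auto)

text \<open>\<open>tempered_cmult\<close> has no membership premise: for \<phi> outside the Schwartz
  space both sides vanish, since c \<phi> is outside as well when c is nonzero and is the zero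
  function when c = 0. Phases can thus be pulled out of a distribution without checking
  membership.\<close>

lemma
  assumes "\<Lambda> \<in> tempered_distributions"
  shows tempered_add: "\<phi> \<in> schwartz \<Longrightarrow> \<psi> \<in> schwartz \<Longrightarrow> \<Lambda> (\<lambda>t. \<phi> t + \<psi> t) = \<Lambda> \<phi> + \<Lambda> \<psi>"
    and tempered_off: "\<phi> \<notin> schwartz \<Longrightarrow> \<Lambda> \<phi> = 0"
    and tempered_cmult: "\<Lambda> (\<lambda>t. c * \<phi> t) = c * \<Lambda> \<phi>"
proof -
  have *: "\<phi> \<in> schwartz \<Longrightarrow> \<Lambda> (\<lambda>t. c * \<phi> t) = c * \<Lambda> \<phi>" for c \<phi>
    using assms by (auto simp: tempered_distributions_def)
  show "\<phi> \<in> schwartz \<Longrightarrow> \<psi> \<in> schwartz \<Longrightarrow> \<Lambda> (\<lambda>t. \<phi> t + \<psi> t) = \<Lambda> \<phi> + \<Lambda> \<psi>"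
    and off: "\<phi> \<notin> schwartz \<Longrightarrow> \<Lambda> \<phi> = 0" for \<phi>
    using assms by (auto simp: tempered_distributions_def)
  have zero: "(\<lambda>t. 0) \<in> schwartz"
    by (rule schwartzI[of _ "\<lambda>n t. 0"]) (auto simp: derivs_def)
  show "\<Lambda> (\<lambda>t. c * \<phi> t) = c * \<Lambda> \<phi>"
  proof (cases "\<phi> \<in> schwartz")
    case False
    show ?thesis
    proof (cases "c = 0")
      case True
      then show ?thesis using *[OF zero, of 0] by simp
    next
      case c: False
      then show ?thesis using False off schwartz_cmult_iff[of c \<phi>] by simp
    qed
  qed (rule *)
qed

lemma schwartz_sum:
  assumes "finite A" "\<And>i. i \<in> A \<Longrightarrow> \<phi> i \<in> schwartz"
  shows "(\<lambda>t. \<Sum>i\<in>A. c i * \<phi> i t) \<in> schwartz"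
  using assms
proof (induction A rule: finite_induct)
  case empty
  show ?case by (rule schwartzI[of _ "\<lambda>n t. 0"]) (auto simp: derivs_def)
next
  case (insert a A)
  then show ?case by (simp add: schwartz_add schwartz_cmult)
qed

lemma tempered_sum:
  assumes "\<Lambda> \<in> tempered_distributions" "finite A" "\<And>i. i \<in> A \<Longrightarrow> \<phi> i \<in> schwartz"
  shows "\<Lambda> (\<lambda>t. \<Sum>i\<in>A. c i * \<phi> i t) = (\<Sum>i\<in>A. c i * \<Lambda> (\<phi> i))"
  using assms(2,3)
proof (induction A rule: finite_induct)
  case empty
  then show ?case using tempered_cmult[OF assms(1), of 0 "\<lambda>t. 0"] by simp
next
  case (insert a A)
  have "\<Lambda> (\<lambda>t. c a * \<phi> a t + (\<Sum>i\<in>A. c i * \<phi> i t)) = c a * \<Lambda> (\<phi> a) + (\<Sum>i\<in>A. c i * \<Lambda> (\<phi> i))"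
    using insert by (subst tempered_add[OF assms(1)])
      (auto simp: schwartz_cmult schwartz_sum tempered_cmult[OF assms(1)])
  then show ?case using insert by simp
qed

section \<open>Tempered distributions and integrals of Schwartz families\<close>

lemma derivs_sum:
  assumes "finite A" "\<And>i. i \<in> A \<Longrightarrow> derivs (d i 0) (d i)"
  shows "derivs (\<lambda>t. \<Sum>i\<in>A. c i * d i 0 t) (\<lambda>n t. \<Sum>i\<in>A. c i * d i n t)"
  using assms unfolding derivs_def
  by (auto intro!: has_vector_derivative_sum has_vector_derivative_mult_right)

lemma schwartz_from_size:
  assumes d: "derivs \<phi> d" and "\<And>N. \<exists>E. schwartz_size_le N \<phi> E"
  shows "\<phi> \<in> schwartz"
proof (rule schwartzI[OF d])
  fix n N
  obtain E where E: "schwartz_size_le (max n N) \<phi> E" using assms(2) by blast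
  have "(1 + \<bar>t\<bar>) ^ N * cmod (d n t) \<le> E" for t
  proof -
    have "(1 + \<bar>t\<bar>) ^ N * cmod (d n t) \<le> (1 + \<bar>t\<bar>) ^ max n N * cmod (d n t)"
      by (intro mult_right_mono power_increasing) auto
    also have "\<dots> \<le> E" using E unfolding schwartz_size_le_def derivs_nth_deriv[OF d] by simp
    finally show ?thesis .
  qed
  then show "\<exists>D. \<forall>t. (1 + \<bar>t\<bar>) ^ N * cmod (d n t) \<le> D" by blast
qed

text \<open>The mean value inequality is applied twice: to \<open>g1\<close>, and then on the
  segment from s to t to g minus its linear part at s. What matters is that the bound is uniform in
  s and t: it survives integration over a parameter, and together with
  \<open>has_vector_derivative_quadratic\<close> it gives differentiation under the integral sign in
  \<open>total_derivs\<close>.\<close>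

lemma quadratic_remainder:
  fixes g g1 g2 :: "real \<Rightarrow> complex"
  assumes "\<And>t. (g has_vector_derivative g1 t) (at t)" "\<And>t. (g1 has_vector_derivative g2 t) (at t)"
    and B: "\<And>t. cmod (g2 t) \<le> B"
  shows "cmod (g t - g s - (t - s) *\<^sub>R g1 s) \<le> B * \<bar>t - s\<bar>\<^sup>2"
proof -
  have on: "onorm (\<lambda>x. x *\<^sub>R (c :: complex)) = cmod c" for c
    using onorm_scaleR_left[OF bounded_linear_ident, of c] by (simp add: onorm_id)
  have lip: "cmod (g1 u - g1 s) \<le> B * \<bar>u - s\<bar>" for u
    using differentiable_bound[of UNIV g1 "\<lambda>u x. x *\<^sub>R g2 u" B u s] assms(2) B
    by (auto simp: has_vector_derivative_def on)
  define S where "S = closed_segment s t"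
  have "cmod ((g t - t *\<^sub>R g1 s) - (g s - s *\<^sub>R g1 s)) \<le> (B * \<bar>t - s\<bar>) * norm (t - s)"
  proof (rule differentiable_bound[of S "\<lambda>u. g u - u *\<^sub>R g1 s" "\<lambda>u x. x *\<^sub>R (g1 u - g1 s)"])
    fix u assume u: "u \<in> S"
    have "((\<lambda>u. g u - u *\<^sub>R g1 s) has_vector_derivative (g1 u - g1 s)) (at u)"
      by (auto intro!: derivative_eq_intros assms(1))
    then show "((\<lambda>u. g u - u *\<^sub>R g1 s) has_derivative (\<lambda>x. x *\<^sub>R (g1 u - g1 s))) (at u within S)"
      using has_derivative_at_withinI unfolding has_vector_derivative_def by blast
    have "0 \<le> B" using B[of 0] norm_ge_zero order.trans by blast
    moreover have "\<bar>u - s\<bar> \<le> \<bar>t - s\<bar>"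
      using u unfolding S_def by (auto simp: closed_segment_eq_real_ivl split: if_splits)
    ultimately show "onorm (\<lambda>x. x *\<^sub>R (g1 u - g1 s)) \<le> B * \<bar>t - s\<bar>"
      using lip[of u] mult_left_mono[of "\<bar>u - s\<bar>" "\<bar>t - s\<bar>" B] by (simp add: on)
  qed (auto simp: S_def)
  moreover have "(g t - t *\<^sub>R g1 s) - (g s - s *\<^sub>R g1 s) = g t - g s - (t - s) *\<^sub>R g1 s"
    by (simp add: algebra_simps)
  ultimately show ?thesis by (simp add: power2_eq_square mult.assoc)
qed

lemma has_vector_derivative_quadratic:
  fixes g :: "real \<Rightarrow> complex"
  assumes "\<And>t. cmod (g t - g s - (t - s) *\<^sub>R L) \<le> B * \<bar>t - s\<bar>\<^sup>2"
  shows "(g has_vector_derivative L) (at s)"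
  unfolding has_vector_derivative_def has_derivative_at_alt
proof (intro conjI allI impI)
  fix e :: real assume "e > 0"
  define \<delta> where "\<delta> = e / (\<bar>B\<bar> + 1)"
  have "cmod (g t - g s - (t - s) *\<^sub>R L) \<le> e * norm (t - s)" if "norm (t - s) < \<delta>" for t
  proof -
    have "B * \<bar>t - s\<bar>\<^sup>2 \<le> (\<bar>B\<bar> + 1) * \<bar>t - s\<bar>\<^sup>2" by (intro mult_right_mono) auto
    also have "\<dots> = ((\<bar>B\<bar> + 1) * \<bar>t - s\<bar>) * \<bar>t - s\<bar>" by (simp add: power2_eq_square)
    also have "\<dots> \<le> e * \<bar>t - s\<bar>"
      using that by (intro mult_right_mono) (auto simp: \<delta>_def field_simps)
    finally show ?thesis using assms[of t] by simp
  qed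
  moreover have "\<delta> > 0" using \<open>e > 0\<close> by (simp add: \<delta>_def)
  ultimately show "\<exists>d>0. \<forall>t. norm (t - s) < d \<longrightarrow> cmod (g t - g s - (t - s) *\<^sub>R L) \<le> e * norm (t - s)"
    by blast
qed (rule bounded_linear_scaleR_left)

text \<open>Here \<open>d n z\<close> is the n-th derivative of the member \<open>d 0 z\<close>.
  Joint continuity and bounds locally uniform in z together make z -> \<open>d 0 z\<close>
  continuous for every Schwartz seminorm, which is the content of
  \<open>family_uniform\<close>.\<close>

locale schwartz_family =
  fixes d :: "nat \<Rightarrow> 'p::euclidean_space \<Rightarrow> real \<Rightarrow> complex"
  assumes family_derivs: "\<And>z. derivs (d 0 z) (\<lambda>n. d n z)"
    and family_continuous: "\<And>n. continuous_on UNIV (\<lambda>(z, t). d n z t)"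
    and family_bounded: "\<And>Q n N. compact Q \<Longrightarrow> \<exists>D. \<forall>z\<in>Q. \<forall>t. (1 + \<bar>t\<bar>) ^ N * cmod (d n z t) \<le> D"
begin

lemma family_schwartz: "d 0 z \<in> schwartz"
  by (rule schwartzI[OF family_derivs]) (use family_bounded[of "{z}"] in auto)

text \<open>For |t| <= T the joint continuity is uniform by compactness. For |t| > T the bound with
  one more power of 1 + |t| leaves a spare factor exceeding T = 2 D / \<epsilon>, which absorbs the
  trivial estimate 2 D of the difference.\<close>

lemma family_uniform1:
  assumes Q: "compact Q" and "\<epsilon> > 0"
  shows "\<exists>\<delta>>0. \<forall>z\<in>Q. \<forall>z'\<in>Q. dist z z' < \<delta> \<longrightarrow>
    (\<forall>t. (1 + \<bar>t\<bar>) ^ N * cmod (d n z t - d n z' t) \<le> \<epsilon>)"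
proof -
  obtain D0 where D0: "\<And>z t. z \<in> Q \<Longrightarrow> (1 + \<bar>t\<bar>) ^ Suc N * cmod (d n z t) \<le> D0"
    using family_bounded[OF Q, of "Suc N" n] by blast
  define D where "D = max D0 1"
  have D: "(1 + \<bar>t\<bar>) ^ Suc N * cmod (d n z t) \<le> D" if "z \<in> Q" for z t
    using D0[OF that, of t] by (simp add: D_def)
  have "D > 0" by (simp add: D_def)
  define T where "T = 2 * D / \<epsilon>"
  have "T > 0" using \<open>D > 0\<close> \<open>\<epsilon> > 0\<close> by (simp add: T_def)
  define \<eta> where "\<eta> = \<epsilon> / (1 + T) ^ N"
  have "\<eta> > 0" using \<open>\<epsilon> > 0\<close> \<open>T > 0\<close> by (simp add: \<eta>_def)
  have "uniformly_continuous_on (Q \<times> {-T..T}) (\<lambda>(z, t). d n z t)"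
    by (intro compact_uniformly_continuous continuous_on_subset[OF family_continuous] compact_Times Q) auto
  then obtain \<delta> where "\<delta> > 0"
    and \<delta>: "\<And>p q. p \<in> Q \<times> {-T..T} \<Longrightarrow> q \<in> Q \<times> {-T..T} \<Longrightarrow> dist q p < \<delta> \<Longrightarrow>
      dist (case q of (z, t) \<Rightarrow> d n z t) (case p of (z, t) \<Rightarrow> d n z t) < \<eta>"
    unfolding uniformly_continuous_on_def using \<open>\<eta> > 0\<close> by meson
  have "(1 + \<bar>t\<bar>) ^ N * cmod (d n z t - d n z' t) \<le> \<epsilon>"
    if z: "z \<in> Q" "z' \<in> Q" "dist z z' < \<delta>" for z z' t
  proof (cases "\<bar>t\<bar> \<le> T")
    case True
    have "cmod (d n z t - d n z' t) \<le> \<eta>"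
      using \<delta>[of "(z', t)" "(z, t)"] z True by (auto simp: dist_Pair_Pair dist_norm abs_le_iff)
    then have "(1 + \<bar>t\<bar>) ^ N * cmod (d n z t - d n z' t) \<le> (1 + T) ^ N * \<eta>"
      using True \<open>T > 0\<close> by (intro mult_mono power_mono) auto
    also have "\<dots> = \<epsilon>" using \<open>T > 0\<close> by (simp add: \<eta>_def)
    finally show ?thesis .
  next
    case False
    define A where "A = (1 + \<bar>t\<bar>) ^ N * cmod (d n z t - d n z' t)"
    have "(1 + \<bar>t\<bar>) * A = (1 + \<bar>t\<bar>) ^ Suc N * cmod (d n z t - d n z' t)" by (simp add: A_def)
    also have "\<dots> \<le> (1 + \<bar>t\<bar>) ^ Suc N * (cmod (d n z t) + cmod (d n z' t))"
      by (intro mult_left_mono norm_triangle_ineq4) auto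
    also have "\<dots> \<le> 2 * D" using D[OF z(1), of t] D[OF z(2), of t] by (simp add: distrib_left)
    finally have "(1 + \<bar>t\<bar>) * A \<le> 2 * D" .
    moreover have "T * A \<le> (1 + \<bar>t\<bar>) * A"
      using False by (intro mult_right_mono) (auto simp: A_def)
    ultimately have "T * A \<le> T * \<epsilon>" using \<open>\<epsilon> > 0\<close> by (simp add: T_def)
    then show ?thesis using \<open>T > 0\<close> by (simp add: A_def)
  qed
  then show ?thesis using \<open>\<delta> > 0\<close> by blast
qed

lemma family_uniform:
  assumes Q: "compact Q" and "\<epsilon> > 0"
  obtains \<delta> where "\<delta> > 0" "\<And>z z' n t. z \<in> Q \<Longrightarrow> z' \<in> Q \<Longrightarrow> dist z z' < \<delta> \<Longrightarrow> n \<le> N \<Longrightarrow>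
    (1 + \<bar>t\<bar>) ^ N * cmod (d n z t - d n z' t) \<le> \<epsilon>"
proof -
  obtain \<delta> where \<delta>: "\<And>n. \<delta> n > 0" "\<And>n z z' t. z \<in> Q \<Longrightarrow> z' \<in> Q \<Longrightarrow> dist z z' < \<delta> n \<Longrightarrow>
      (1 + \<bar>t\<bar>) ^ N * cmod (d n z t - d n z' t) \<le> \<epsilon>"
    using family_uniform1[OF assms, of N] by metis
  define \<delta>0 where "\<delta>0 = Min (\<delta> ` {..N})"
  have "\<delta>0 > 0" using \<delta>(1) by (auto simp: \<delta>0_def)
  moreover have "\<delta>0 \<le> \<delta> n" if "n \<le> N" for n using that by (auto simp: \<delta>0_def)
  ultimately show ?thesis using \<delta>(2) that by (meson less_le_trans)
qed

text \<open>Differences are written with a factor -1 because the closure lemmas and the linearity of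
  distributions are phrased for sums and scalar multiples.\<close>

lemma family_diff:
  "derivs (\<lambda>t. d 0 z t + (-1) * d 0 z' t) (\<lambda>n t. d n z t + (-1) * d n z' t)"
  by (rule derivs_add[OF family_derivs derivs_cmult[OF family_derivs]])

lemma tempered_family_diff:
  assumes \<Lambda>: "\<Lambda> \<in> tempered_distributions"
    and bound: "\<And>\<phi> E. \<phi> \<in> schwartz \<Longrightarrow> schwartz_size_le N \<phi> E \<Longrightarrow> cmod (\<Lambda> \<phi>) \<le> C * E"
    and "\<And>n t. n \<le> N \<Longrightarrow> (1 + \<bar>t\<bar>) ^ N * cmod (d n z t - d n z' t) \<le> \<epsilon>"
  shows "cmod (\<Lambda> (d 0 z) - \<Lambda> (d 0 z')) \<le> C * \<epsilon>"
proof -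
  have "cmod (\<Lambda> (\<lambda>t. d 0 z t + (-1) * d 0 z' t)) \<le> C * \<epsilon>"
  proof (rule bound)
    show "(\<lambda>t. d 0 z t + (-1) * d 0 z' t) \<in> schwartz"
      by (intro schwartz_add schwartz_cmult family_schwartz)
    show "schwartz_size_le N (\<lambda>t. d 0 z t + (-1) * d 0 z' t) \<epsilon>"
      unfolding schwartz_size_le_def derivs_nth_deriv[OF family_diff] using assms(3) by simp
  qed
  moreover have "\<Lambda> (\<lambda>t. d 0 z t + (-1) * d 0 z' t) = \<Lambda> (d 0 z) + (-1) * \<Lambda> (d 0 z')"
    by (simp only: tempered_add[OF \<Lambda> family_schwartz schwartz_cmult[OF family_schwartz]] tempered_cmult[OF \<Lambda>])
  ultimately show ?thesis by simp
qed

lemma tempered_family_continuous: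
  assumes \<Lambda>: "\<Lambda> \<in> tempered_distributions"
  shows "continuous_on UNIV (\<lambda>z. \<Lambda> (d 0 z))"
proof -
  obtain C N where C: "C \<ge> 0" "\<And>\<phi> E. \<phi> \<in> schwartz \<Longrightarrow> schwartz_size_le N \<phi> E \<Longrightarrow> cmod (\<Lambda> \<phi>) \<le> C * E"
    using tempered_bound[OF \<Lambda>] by metis
  show ?thesis
    unfolding continuous_on_iff
  proof (intro ballI allI impI)
    fix z and e :: real assume "e > 0"
    define \<epsilon> where "\<epsilon> = e / (2 * (C + 1))"
    have "\<epsilon> > 0" using \<open>e > 0\<close> C(1) by (simp add: \<epsilon>_def)
    obtain \<delta> where "\<delta> > 0" and \<delta>: "\<And>y y' n t. y \<in> cball z 1 \<Longrightarrow> y' \<in> cball z 1 \<Longrightarrow> dist y y' < \<delta> \<Longrightarrow> n \<le> N \<Longrightarrow>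
      (1 + \<bar>t\<bar>) ^ N * cmod (d n y t - d n y' t) \<le> \<epsilon>"
      using family_uniform[OF compact_cball \<open>\<epsilon> > 0\<close>, of z 1 N] by blast
    have "dist (\<Lambda> (d 0 y)) (\<Lambda> (d 0 z)) < e" if "dist y z < min 1 \<delta>" for y
    proof -
      have "cmod (\<Lambda> (d 0 y) - \<Lambda> (d 0 z)) \<le> C * \<epsilon>"
        using that by (intro tempered_family_diff[OF \<Lambda> C(2)]) (auto intro!: \<delta> simp: dist_commute)
      also have "\<dots> \<le> (C + 1) * \<epsilon>" using \<open>\<epsilon> > 0\<close> by (intro mult_right_mono) auto
      also have "(C + 1) * \<epsilon> = e / 2" using C(1) by (simp add: \<epsilon>_def field_simps)
      also have "\<dots> < e" using \<open>e > 0\<close> by simp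
      finally show ?thesis by (simp add: dist_norm)
    qed
    then show "\<exists>\<delta>>0. \<forall>y\<in>UNIV. dist y z < \<delta> \<longrightarrow> dist (\<Lambda> (d 0 y)) (\<Lambda> (d 0 z)) < e"
      using \<open>\<delta> > 0\<close> by (intro exI[of _ "min 1 \<delta>"]) auto
  qed
qed

end

section \<open>Riemann sums for integrals over the parameter space\<close>

lemma integral_outside_box_small:
  fixes \<rho> :: "'p::euclidean_space \<Rightarrow> real"
  assumes \<rho>: "integrable lborel \<rho>" and "\<epsilon> > 0"
  obtains a b where "\<bar>LINT z|lborel. indicator (- cbox a b) z * \<rho> z\<bar> \<le> \<epsilon>"
proof -
  define Q :: "nat \<Rightarrow> 'p set" where "Q k = cbox (- real k *\<^sub>R One) (real k *\<^sub>R One)" for k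
  have "(\<lambda>k. LINT z|lborel. indicator (- Q k) z * \<rho> z) \<longlonglongrightarrow> (LINT z::'p|lborel. (0::real))"
  proof (rule Bochner_Integration.integral_dominated_convergence[where w="\<lambda>z. \<bar>\<rho> z\<bar>"])
    show "AE z in lborel. (\<lambda>k. indicator (- Q k) z * \<rho> z) \<longlonglongrightarrow> 0"
    proof (intro always_eventually allI)
      fix z :: 'p
      obtain k0 :: nat where k0: "norm z \<le> real k0" using real_arch_simple by blast
      have "z \<in> Q k" if "k \<ge> k0" for k
        unfolding Q_def mem_box
      proof
        fix i :: 'p assume i: "i \<in> Basis"
        have "\<bar>z \<bullet> i\<bar> \<le> real k"
          using Basis_le_norm[OF i, of z] k0 that by simp
        then show "- real k *\<^sub>R One \<bullet> i \<le> z \<bullet> i \<and> z \<bullet> i \<le> real k *\<^sub>R One \<bullet> i"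
          using i by (simp add: abs_le_iff)
      qed
      then show "(\<lambda>k. indicator (- Q k) z * \<rho> z) \<longlonglongrightarrow> 0"
        by (intro tendsto_eventually eventually_sequentiallyI[of k0]) (auto simp: indicator_def)
    qed
  qed (use \<rho> in \<open>auto simp: Q_def indicator_def\<close>)
  then have "\<forall>\<^sub>F k in sequentially. \<bar>LINT z|lborel. indicator (- Q k) z * \<rho> z\<bar> < \<epsilon>"
    using \<open>\<epsilon> > 0\<close> by (auto simp: tendsto_iff dist_real_def)
  then show ?thesis using that unfolding Q_def
    by (meson eventually_sequentially less_imp_le order_refl)
qed

text \<open>The first error term comes from the complement of the box, the second from the
  oscillation of h on the cells. The estimate is quantitative in a given tagged division because one
  and the same division must later serve the functions z -> \<open>d n z t\<close> for all t and n
  <= N, and also z -> \<open>\<Lambda> (d 0 z)\<close>.\<close>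

lemma riemann_sum_error:
  fixes h :: "'p::euclidean_space \<Rightarrow> complex"
  assumes h: "continuous_on UNIV h" and \<rho>: "integrable lborel \<rho>" and hb: "\<And>z. cmod (h z) \<le> A * \<rho> z"
    and \<eta>: "\<And>z z'. z \<in> cbox a b \<Longrightarrow> z' \<in> cbox a b \<Longrightarrow> dist z z' < \<delta> \<Longrightarrow> cmod (h z - h z') \<le> \<eta>" "0 \<le> \<eta>"
    and p: "p tagged_division_of cbox a b" and fine: "(\<lambda>z. ball z \<delta>) fine p"
    and out: "\<bar>LINT z|lborel. indicator (- cbox a b) z * \<rho> z\<bar> \<le> \<epsilon>" and A: "0 \<le> A"
  shows "cmod ((LINT z|lborel. h z) - (\<Sum>(x, K)\<in>p. of_real (measure lborel K) * h x))
    \<le> A * \<epsilon> + \<eta> * measure lborel (cbox a b)"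
proof -
  let ?Q = "cbox a b"
  have [measurable]: "h \<in> borel_measurable lborel" using borel_measurable_continuous_onI[OF h] by simp
  have int: "integrable lborel h"
    by (rule Bochner_Integration.integrable_bound[of lborel "\<lambda>z. A * \<rho> z"])
      (use \<rho> hb in \<open>auto intro!: AE_I2 intro: order.trans[OF _ abs_ge_self]\<close>)
  have setint: "set_integrable lborel S h" if "S \<in> sets lborel" for S
    using integrable_mult_indicator[OF that int] unfolding set_integrable_def .
  have "(LINT z|lborel. h z) = (LINT z:?Q|lborel. h z) + (LINT z:-?Q|lborel. h z)"
    unfolding set_lebesgue_integral_def
    by (subst Bochner_Integration.integral_add[symmetric])
      (use setint[of ?Q] setint[of "-?Q"] in \<open>auto simp: set_integrable_def indicator_def simp del: Bochner_Integration.integral_add intro!: Bochner_Integration.integral_cong\<close>)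
  moreover have "cmod (LINT z:-?Q|lborel. h z) \<le> A * \<epsilon>"
  proof -
    have "cmod (LINT z:-?Q|lborel. h z) \<le> (LINT z|lborel. A * (indicator (- cbox a b) z * \<rho> z))"
      unfolding set_lebesgue_integral_def
    proof (rule Bochner_Integration.integral_norm_bound_integral)
      show "integrable lborel (\<lambda>z. indicator (- ?Q) z *\<^sub>R h z)"
        using setint[of "-?Q"] by (simp add: set_integrable_def)
      show "integrable lborel (\<lambda>z. A * (indicator (- ?Q) z * \<rho> z))"
        using integrable_mult_indicator[OF _ \<rho>, of "-?Q"] by simp
    qed (use hb in \<open>auto simp: indicator_def\<close>)
    also have "\<dots> = A * (LINT z|lborel. indicator (- cbox a b) z * \<rho> z)" by simp
    also have "\<dots> \<le> A * \<epsilon>" using out A by (intro mult_left_mono) auto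
    finally show ?thesis .
  qed
  moreover have "cmod ((LINT z:?Q|lborel. h z) - (\<Sum>(x, K)\<in>p. of_real (measure lborel K) * h x))
    \<le> \<eta> * measure lborel ?Q"
  proof -
    have fin: "finite p" using p by blast
    have eq: "(LINT z:?Q|lborel. h z) = (\<Sum>(x, K)\<in>p. integral K h)"
      using set_borel_integral_eq_integral[OF setint[of ?Q]] integral_combine_tagged_division_topdown[OF _ p]
      by simp
    have "cmod ((\<Sum>(x, K)\<in>p. integral K h) - (\<Sum>(x, K)\<in>p. of_real (measure lborel K) * h x))
      = cmod (\<Sum>(x, K)\<in>p. integral K h - of_real (measure lborel K) * h x)"
      by (simp add: sum_subtractf split_def)
    also have "\<dots> \<le> (\<Sum>(x, K)\<in>p. \<eta> * measure lborel K)"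
      unfolding split_def
    proof (rule sum_norm_le)
      fix xK assume "xK \<in> p"
      then obtain x K where xK: "xK = (x, K)" "(x, K) \<in> p" by (cases xK) auto
      obtain u v where uv: "K = cbox u v" using tagged_division_ofD(4)[OF p xK(2)] by blast
      have sub: "K \<subseteq> ?Q" "x \<in> K" using tagged_division_ofD(2,3)[OF p xK(2)] by auto
      have "((\<lambda>z. h z - h x) has_integral (integral K h - measure lborel K *\<^sub>R h x)) (cbox u v)"
        unfolding uv
        by (intro has_integral_diff integrable_integral integrable_continuous
            continuous_on_subset[OF h] has_integral_const) auto
      moreover have "cmod (h z - h x) \<le> \<eta>" if "z \<in> cbox u v" for z
      proof (rule \<eta>(1))
        show "dist z x < \<delta>" using fine xK(2) that unfolding fine_def uv by (force simp: dist_commute)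
      qed (use sub that uv in auto)
      ultimately show "cmod (integral (snd xK) h - of_real (measure lborel (snd xK)) * h (fst xK))
          \<le> \<eta> * measure lborel (snd xK)"
        using has_integral_bound[OF \<eta>(2), of "\<lambda>z. h z - h x" _ u v]
        by (simp add: xK(1) uv scaleR_conv_of_real)
    qed
    also have "\<dots> = \<eta> * (\<Sum>(x, K)\<in>p. measure lborel K)" by (simp add: sum_distrib_left split_def)
    also have "\<dots> = \<eta> * measure lborel ?Q" using additive_content_tagged_division[OF p] by simp
    finally show ?thesis unfolding eq .
  qed
  ultimately show ?thesis
    using norm_triangle_ineq[of "(LINT z:?Q|lborel. h z) - (\<Sum>(x, K)\<in>p. of_real (measure lborel K) * h x)" "LINT z:-?Q|lborel. h z"]
    by (simp add: algebra_simps)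
qed

text \<open>A single integrable majorant \<rho> serves all weights and derivatives, only the
  constant changing. The integral over z then converges absolutely in every Schwartz
  seminorm.\<close>

locale integrable_schwartz_family = schwartz_family d
  for d :: "nat \<Rightarrow> 'p::euclidean_space \<Rightarrow> real \<Rightarrow> complex" +
  fixes \<rho> :: "'p \<Rightarrow> real"
  assumes rho_nonneg: "\<And>z. 0 \<le> \<rho> z" and rho_integrable: "integrable lborel \<rho>"
    and rho_bound: "\<And>n N. \<exists>D. \<forall>z t. (1 + \<bar>t\<bar>) ^ N * cmod (d n z t) \<le> D * \<rho> z"
begin

lemma rho_bound_pos:
  obtains D where "D \<ge> 0" "\<And>n z t. n \<le> M \<Longrightarrow> (1 + \<bar>t\<bar>) ^ N * cmod (d n z t) \<le> D * \<rho> z"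
proof -
  obtain D where D: "\<And>n z t. (1 + \<bar>t\<bar>) ^ N * cmod (d n z t) \<le> D n * \<rho> z"
    using rho_bound[of N] by metis
  have "(1 + \<bar>t\<bar>) ^ N * cmod (d n z t) \<le> (\<Sum>n\<le>M. \<bar>D n\<bar>) * \<rho> z" if "n \<le> M" for n z t
  proof -
    have "D n \<le> \<bar>D n\<bar>" by simp
    also have "\<dots> \<le> (\<Sum>n\<le>M. \<bar>D n\<bar>)" using that by (intro member_le_sum) auto
    finally show ?thesis using D[of t n z] mult_right_mono[OF _ rho_nonneg] by (meson order.trans)
  qed
  then show ?thesis by (intro that[of "\<Sum>n\<le>M. \<bar>D n\<bar>"]) (auto intro: sum_nonneg)
qed

lemma family_section_continuous: "continuous_on UNIV (\<lambda>z. d n z t)"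
proof -
  have "continuous_on UNIV (\<lambda>z::'p. (z, t))" by (intro continuous_intros)
  from continuous_on_compose2[OF family_continuous[of n] this] show ?thesis by simp
qed

lemma family_section_integrable: "integrable lborel (\<lambda>z. d n z t)"
proof -
  obtain D where D: "D \<ge> 0" "\<And>z t. (1 + \<bar>t\<bar>) ^ 0 * cmod (d n z t) \<le> D * \<rho> z"
    using rho_bound_pos[of n 0] by (metis order_refl)
  show ?thesis
    by (rule Bochner_Integration.integrable_bound[of lborel "\<lambda>z. D * \<rho> z"])
      (use rho_integrable D(2) borel_measurable_continuous_onI[OF family_section_continuous[of n t]]
       in \<open>auto intro!: AE_I2 intro: order.trans[OF _ abs_ge_self]\<close>)
qed

definition total :: "nat \<Rightarrow> real \<Rightarrow> complex" where
  "total n t = (LINT z|lborel. d n z t)"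

lemma total_derivs: "derivs (total 0) total"
  unfolding derivs_def
proof (intro conjI allI refl)
  fix n s
  obtain D where D: "D \<ge> 0" "\<And>z t. (1 + \<bar>t\<bar>) ^ 0 * cmod (d (Suc (Suc n)) z t) \<le> D * \<rho> z"
    using rho_bound_pos[of "Suc (Suc n)" 0] by (metis order_refl)
  show "(total n has_vector_derivative total (Suc n) s) (at s)"
  proof (rule has_vector_derivative_quadratic[of _ _ _ "D * (LINT z|lborel. \<rho> z)"])
    fix t
    have "total n t - total n s - (t - s) *\<^sub>R total (Suc n) s
      = (LINT z|lborel. d n z t - d n z s - (t - s) *\<^sub>R d (Suc n) z s)"
      unfolding total_def by (simp add: family_section_integrable)
    also have "cmod \<dots> \<le> (LINT z|lborel. (D * \<bar>t - s\<bar>\<^sup>2) * \<rho> z)"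
    proof (rule Bochner_Integration.integral_norm_bound_integral)
      fix z
      have "cmod (d n z t - d n z s - (t - s) *\<^sub>R d (Suc n) z s) \<le> D * \<rho> z * \<bar>t - s\<bar>\<^sup>2"
        by (rule quadratic_remainder[of _ _ "d (Suc (Suc n)) z"])
          (use family_derivs[of z] D(2) in \<open>auto simp: derivs_def\<close>)
      then show "cmod (d n z t - d n z s - (t - s) *\<^sub>R d (Suc n) z s) \<le> (D * \<bar>t - s\<bar>\<^sup>2) * \<rho> z"
        by (simp add: mult_ac)
    qed (auto simp: family_section_integrable rho_integrable)
    finally show "cmod (total n t - total n s - (t - s) *\<^sub>R total (Suc n) s)
        \<le> D * (LINT z|lborel. \<rho> z) * \<bar>t - s\<bar>\<^sup>2"
      by (simp add: mult_ac)
  qed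
qed

lemma total_schwartz: "total 0 \<in> schwartz"
proof (rule schwartzI[OF total_derivs])
  fix n N
  obtain D where D: "D \<ge> 0" "\<And>z t. (1 + \<bar>t\<bar>) ^ N * cmod (d n z t) \<le> D * \<rho> z"
    using rho_bound_pos[of n N] by (metis order_refl)
  have "(1 + \<bar>t\<bar>) ^ N * cmod (total n t) \<le> D * (LINT z|lborel. \<rho> z)" for t
  proof -
    have "(1 + \<bar>t\<bar>) ^ N * cmod (total n t) = cmod (LINT z|lborel. of_real ((1 + \<bar>t\<bar>) ^ N) * d n z t)"
      unfolding total_def integral_mult_right_zero norm_mult norm_of_real by simp
    also have "\<dots> \<le> (LINT z|lborel. D * \<rho> z)"
    proof (rule Bochner_Integration.integral_norm_bound_integral)
      show "cmod (of_real ((1 + \<bar>t\<bar>) ^ N) * d n z t) \<le> D * \<rho> z" for z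
        unfolding norm_mult norm_of_real using D(2)[of t z] by simp
    qed (auto simp: family_section_integrable rho_integrable simp del: of_real_power of_real_add)
    finally show ?thesis by simp
  qed
  then show "\<exists>D. \<forall>t. (1 + \<bar>t\<bar>) ^ N * cmod (total n t) \<le> D" by blast
qed

text \<open>\<Lambda> carries the Riemann sum of the family to the Riemann sum of its values. For a
  fine division the first sum is close to \<open>total 0\<close> in the size that controls
  \<Lambda>, and the second is close to the integral of the values, so the two limits agree.\<close>

theorem
  assumes \<Lambda>: "\<Lambda> \<in> tempered_distributions"
  shows tempered_family_integrable: "integrable lborel (\<lambda>z. \<Lambda> (d 0 z))" (is ?int)
    and tempered_integral: "\<Lambda> (total 0) = (LINT z|lborel. \<Lambda> (d 0 z))"
proof -
  obtain C N where C: "C \<ge> 0" "\<And>\<phi> E. \<phi> \<in> schwartz \<Longrightarrow> schwartz_size_le N \<phi> E \<Longrightarrow> cmod (\<Lambda> \<phi>) \<le> C * E"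
    using tempered_bound[OF \<Lambda>] by metis
  obtain D where D: "D \<ge> 0" "\<And>n z t. n \<le> N \<Longrightarrow> (1 + \<bar>t\<bar>) ^ N * cmod (d n z t) \<le> D * \<rho> z"
    using rho_bound_pos by metis
  have \<Lambda>b: "cmod (\<Lambda> (d 0 z)) \<le> (C * D) * \<rho> z" for z
  proof -
    have "cmod (\<Lambda> (d 0 z)) \<le> C * (D * \<rho> z)"
      by (rule C(2)[OF family_schwartz])
        (auto simp: schwartz_size_le_def derivs_nth_deriv[OF family_derivs] D(2))
    then show ?thesis by simp
  qed
  have \<Lambda>c: "continuous_on UNIV (\<lambda>z. \<Lambda> (d 0 z))" by (rule tempered_family_continuous[OF \<Lambda>])
  show ?int
    by (rule Bochner_Integration.integrable_bound[of lborel "\<lambda>z. (C * D) * \<rho> z"])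
      (use rho_integrable \<Lambda>b borel_measurable_continuous_onI[OF \<Lambda>c]
       in \<open>auto intro!: AE_I2 intro: order.trans[OF _ abs_ge_self]\<close>)
  have "cmod (\<Lambda> (total 0) - (LINT z|lborel. \<Lambda> (d 0 z))) \<le> (2 * C * (D + 1)) * \<epsilon>" if "\<epsilon> > 0" for \<epsilon>
  proof -
    obtain a b :: 'p where ab: "\<bar>LINT z|lborel. indicator (- cbox a b) z * \<rho> z\<bar> \<le> \<epsilon>"
      using integral_outside_box_small[OF rho_integrable \<open>\<epsilon> > 0\<close>] by blast
    define V where "V = measure lborel (cbox a b)"
    have V: "V \<ge> 0" by (simp add: V_def)
    \<comment> \<open>The order of choices matters: the box is fixed by \<epsilon>, then \<eta> by
      its volume, then \<delta> by uniform continuity on the box, and the division last.\<close>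
    define \<eta> where "\<eta> = \<epsilon> / (1 + V)"
    have \<eta>: "\<eta> > 0" "\<eta> * V \<le> \<epsilon>"
      using V \<open>\<epsilon> > 0\<close> by (auto simp: \<eta>_def field_simps)
    obtain \<delta> where "\<delta> > 0" and \<delta>: "\<And>z z' n t. z \<in> cbox a b \<Longrightarrow> z' \<in> cbox a b \<Longrightarrow> dist z z' < \<delta> \<Longrightarrow> n \<le> N \<Longrightarrow>
        (1 + \<bar>t\<bar>) ^ N * cmod (d n z t - d n z' t) \<le> \<eta>"
      using family_uniform[OF compact_cbox \<eta>(1), of a b N] by blast
    obtain p where p: "p tagged_division_of cbox a b" "(\<lambda>z. ball z \<delta>) fine p"
      using fine_division_exists[of "\<lambda>z. ball z \<delta>" a b] \<open>\<delta> > 0\<close> by (auto simp: gauge_def)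
    have fin: "finite p" using p(1) by blast
    define c :: "'p \<times> 'p set \<Rightarrow> complex" where "c = (\<lambda>(x, K). of_real (measure lborel K))"
    define \<psi> where "\<psi> = (\<lambda>t. total 0 t + (-1) * (\<Sum>i\<in>p. c i * d 0 (fst i) t))"
    have \<psi>d: "derivs \<psi> (\<lambda>n t. total n t + (-1) * (\<Sum>i\<in>p. c i * d n (fst i) t))"
      unfolding \<psi>_def
      by (intro derivs_add total_derivs derivs_cmult derivs_sum[of p "\<lambda>i n. d n (fst i)"] fin family_derivs)
    have sumS: "(\<lambda>t. \<Sum>i\<in>p. c i * d 0 (fst i) t) \<in> schwartz"
      by (intro schwartz_sum fin family_schwartz)
    have \<psi>S: "\<psi> \<in> schwartz" unfolding \<psi>_def by (intro schwartz_add total_schwartz schwartz_cmult sumS)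
    have \<psi>\<Lambda>: "\<Lambda> \<psi> = \<Lambda> (total 0) - (\<Sum>i\<in>p. c i * \<Lambda> (d 0 (fst i)))"
      unfolding \<psi>_def tempered_add[OF \<Lambda> total_schwartz schwartz_cmult[OF sumS]] tempered_cmult[OF \<Lambda>]
        tempered_sum[OF \<Lambda> fin family_schwartz] by simp
    have "schwartz_size_le N \<psi> (D * \<epsilon> + \<epsilon>)"
      unfolding schwartz_size_le_def derivs_nth_deriv[OF \<psi>d]
    proof (intro allI impI)
      fix n and t :: real assume n: "n \<le> N"
      \<comment> \<open>For fixed t the weight is a constant, so it is divided into the bounds,
        which become D / \<alpha> and \<eta> / \<alpha>. Neither \<delta> nor the division depends
        on t, so the final estimate is uniform in t.\<close>
      define \<alpha> :: real where "\<alpha> = (1 + \<bar>t\<bar>) ^ N"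
      have \<alpha>: "\<alpha> > 0" by (simp add: \<alpha>_def add_pos_nonneg)
      have "cmod ((LINT z|lborel. d n z t) - (\<Sum>(x, K)\<in>p. of_real (measure lborel K) * d n x t))
        \<le> (D / \<alpha>) * \<epsilon> + (\<eta> / \<alpha>) * measure lborel (cbox a b)"
        using D(1) D(2)[OF n, of t] \<alpha> \<eta>(1) \<delta>[OF _ _ _ n, of _ _ t]
        by (intro riemann_sum_error[OF family_section_continuous rho_integrable _ _ _ p ab])
          (auto simp: pos_le_divide_eq mult.commute simp flip: \<alpha>_def)
      then have "\<alpha> * cmod (total n t - (\<Sum>i\<in>p. c i * d n (fst i) t)) \<le> D * \<epsilon> + \<eta> * V"
        using \<alpha> by (simp add: field_simps total_def c_def V_def split_def)
      then show "(1 + \<bar>t\<bar>) ^ N * cmod (total n t + (-1) * (\<Sum>i\<in>p. c i * d n (fst i) t)) \<le> D * \<epsilon> + \<epsilon>"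
        using \<eta>(2) by (simp add: \<alpha>_def)
    qed
    then have 1: "cmod (\<Lambda> (total 0) - (\<Sum>i\<in>p. c i * \<Lambda> (d 0 (fst i)))) \<le> C * (D * \<epsilon> + \<epsilon>)"
      using C(2)[OF \<psi>S] \<psi>\<Lambda> by simp
    have "cmod ((LINT z|lborel. \<Lambda> (d 0 z)) - (\<Sum>(x, K)\<in>p. of_real (measure lborel K) * \<Lambda> (d 0 x)))
      \<le> (C * D) * \<epsilon> + (C * \<eta>) * measure lborel (cbox a b)"
      by (intro riemann_sum_error[OF \<Lambda>c rho_integrable _ _ _ p ab] \<Lambda>b tempered_family_diff[OF \<Lambda> C(2)])
        (use C(1) D(1) \<eta>(1) in \<open>auto intro: \<delta>\<close>)
    moreover have "C * \<eta> * V \<le> C * \<epsilon>" using C(1) \<eta>(2) by (simp add: mult.assoc mult_left_mono)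
    ultimately have 2: "cmod ((LINT z|lborel. \<Lambda> (d 0 z)) - (\<Sum>i\<in>p. c i * \<Lambda> (d 0 (fst i)))) \<le> C * (D * \<epsilon> + \<epsilon>)"
      by (simp add: c_def split_def V_def algebra_simps)
    show ?thesis
      using norm_triangle_ineq4[of "\<Lambda> (total 0) - (\<Sum>i\<in>p. c i * \<Lambda> (d 0 (fst i)))"
          "(LINT z|lborel. \<Lambda> (d 0 z)) - (\<Sum>i\<in>p. c i * \<Lambda> (d 0 (fst i)))"] 1 2
      by (simp add: algebra_simps)
  qed
  note small = this
  define K where "K = 2 * C * (D + 1)"
  have K: "K \<ge> 0" using C D by (simp add: K_def)
  have "cmod (\<Lambda> (total 0) - (LINT z|lborel. \<Lambda> (d 0 z))) \<le> 0 + e" if "e > 0" for e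
  proof -
    have "K * (e / (K + 1)) \<le> e" using K that by (simp add: field_simps)
    moreover have "cmod (\<Lambda> (total 0) - (LINT z|lborel. \<Lambda> (d 0 z))) \<le> K * (e / (K + 1))"
      unfolding K_def[symmetric] using small[of "e / (K + 1)"] K that by (simp add: K_def)
    ultimately show ?thesis by simp
  qed
  then have "cmod (\<Lambda> (total 0) - (LINT z|lborel. \<Lambda> (d 0 z))) \<le> 0" by (rule field_le_epsilon)
  then show "\<Lambda> (total 0) = (LINT z|lborel. \<Lambda> (d 0 z))" by simp
qed

end

section \<open>Chirps, translations and modulations as operators on Schwartz space\<close>

text \<open>The continuous linear maps of Schwartz space, whose transposes act on tempered
  distributions.\<close>

definition schwartz_operator :: "((real \<Rightarrow> complex) \<Rightarrow> real \<Rightarrow> complex) \<Rightarrow> bool" where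
  "schwartz_operator A \<longleftrightarrow>
     (\<forall>\<phi> \<psi>. A (\<lambda>t. \<phi> t + \<psi> t) = (\<lambda>t. A \<phi> t + A \<psi> t)) \<and>
     (\<forall>c \<phi>. A (\<lambda>t. c * \<phi> t) = (\<lambda>t. c * A \<phi> t)) \<and>
     (\<forall>\<phi>\<in>schwartz. A \<phi> \<in> schwartz) \<and>
     (\<forall>N. \<exists>C M. \<forall>\<phi>\<in>schwartz. \<forall>E. schwartz_size_le M \<phi> E \<longrightarrow> schwartz_size_le N (A \<phi>) (C * E))"

text \<open>The premise \<open>inv\<close> preserves the convention that distributions vanish off
  the Schwartz space: otherwise A could send a function outside that space into it, where \<Lambda>
  may be nonzero.\<close>

lemma tempered_compose:
  assumes \<Lambda>: "\<Lambda> \<in> tempered_distributions" and A: "schwartz_operator A"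
    and inv: "\<And>\<phi>. A \<phi> \<in> schwartz \<Longrightarrow> \<phi> \<in> schwartz"
  shows "(\<lambda>\<phi>. \<Lambda> (A \<phi>)) \<in> tempered_distributions"
proof -
  obtain C N where C: "C \<ge> 0" "\<And>\<phi> E. \<phi> \<in> schwartz \<Longrightarrow> schwartz_size_le N \<phi> E \<Longrightarrow> cmod (\<Lambda> \<phi>) \<le> C * E"
    using tempered_bound[OF \<Lambda>] by metis
  obtain D M where D: "\<And>\<phi> E. \<phi> \<in> schwartz \<Longrightarrow> schwartz_size_le M \<phi> E \<Longrightarrow> schwartz_size_le N (A \<phi>) (D * E)"
    using A unfolding schwartz_operator_def by meson
  have AS: "A \<phi> \<in> schwartz" if "\<phi> \<in> schwartz" for \<phi> using A that unfolding schwartz_operator_def by blast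
  show ?thesis
  proof (rule temperedI)
    fix \<phi> E assume "\<phi> \<in> schwartz" "schwartz_size_le M \<phi> E"
    then show "cmod (\<Lambda> (A \<phi>)) \<le> (C * D) * E"
      using C(2)[OF AS D] by (simp add: mult.assoc)
  next
    show "\<Lambda> (A \<phi>) = 0" if "\<phi> \<notin> schwartz" for \<phi>
      using inv that tempered_off[OF \<Lambda>] by blast
  qed (use A AS in \<open>auto simp: schwartz_operator_def tempered_add[OF \<Lambda>] tempered_cmult[OF \<Lambda>]\<close>)
qed

text \<open>A function all of whose derivatives grow at most polynomially is a multiplier: extra
  powers of the weight on \<phi> pay for the growth of u.\<close>

lemma schwartz_operator_multiplier:
  assumes u: "derivs u e" and B: "\<And>n t. cmod (e n t) \<le> B n * (1 + \<bar>t\<bar>) ^ P n"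
  shows "schwartz_operator (\<lambda>\<phi> t. u t * \<phi> t)"
proof -
  have size: "\<exists>C M. \<forall>\<phi>\<in>schwartz. \<forall>E. schwartz_size_le M \<phi> E \<longrightarrow>
    schwartz_size_le N (\<lambda>t. u t * \<phi> t) (C * E)" for N
  proof (intro exI ballI allI impI)
    \<comment> \<open>Q dominates every exponent \<open>P k\<close> with k <= N. Of the weight N + Q
      required of \<phi>, the part Q is spent on the growth of u. The factor 1 in the constant below
      is the bound taken for b in \<open>leibniz_bound\<close>.\<close>
    define Q where "Q = (\<Sum>k\<le>N. P k)"
    define C where "C n = (\<Sum>k\<le>n. of_nat (n choose k) * \<bar>B k\<bar> * 1)" for n
    fix \<phi> E assume \<phi>: "\<phi> \<in> schwartz" and E: "schwartz_size_le (N + Q) \<phi> E"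
    have E0: "E \<ge> 0"
      using E[unfolded schwartz_size_le_def, rule_format, of 0 0] by (smt (verit) le0 norm_ge_zero mult_nonneg_nonneg zero_le_power abs_ge_zero)
    show "schwartz_size_le N (\<lambda>t. u t * \<phi> t) ((\<Sum>n\<le>N. C n) * E)"
      unfolding schwartz_size_le_def derivs_nth_deriv[OF derivs_mult[OF u schwartz_derivs[OF \<phi>]]]
    proof (intro allI impI)
      fix n and t :: real assume n: "n \<le> N"
      define \<alpha> :: real where "\<alpha> = 1 + \<bar>t\<bar>"
      have \<alpha>: "\<alpha> \<ge> 1" by (simp add: \<alpha>_def)
      have "cmod (leibniz e (\<lambda>n. nth_deriv n \<phi>) n t) \<le> C n * (\<alpha> ^ Q * (E / \<alpha> ^ (N + Q)))"
        unfolding C_def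
      proof (rule leibniz_bound)
        fix k assume k: "k \<le> n"
        have "P k \<le> Q" unfolding Q_def using k n by (intro member_le_sum) auto
        then have "\<bar>B k\<bar> * \<alpha> ^ P k \<le> \<bar>B k\<bar> * \<alpha> ^ Q"
          using \<alpha> by (intro mult_left_mono power_increasing) auto
        moreover have "B k * \<alpha> ^ P k \<le> \<bar>B k\<bar> * \<alpha> ^ P k" using \<alpha> by (intro mult_right_mono) auto
        ultimately show "cmod (e k t) \<le> \<bar>B k\<bar> * \<alpha> ^ Q" using B[of k t] unfolding \<alpha>_def by linarith
        have "\<alpha> ^ (N + Q) * cmod (nth_deriv k \<phi> t) \<le> E"
          using E k n unfolding schwartz_size_le_def \<alpha>_def by simp
        then show "cmod (nth_deriv k \<phi> t) \<le> 1 * (E / \<alpha> ^ (N + Q))"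
          using \<alpha> by (simp add: field_simps)
      qed
      also have "C n * (\<alpha> ^ Q * (E / \<alpha> ^ (N + Q))) = C n * E / \<alpha> ^ N"
        using \<alpha> by (simp add: power_add field_simps)
      finally have "\<alpha> ^ N * cmod (leibniz e (\<lambda>n. nth_deriv n \<phi>) n t) \<le> C n * E"
        using \<alpha> by (simp add: field_simps)
      also have "C n * E \<le> (\<Sum>n\<le>N. C n) * E"
        using n E0 by (intro mult_right_mono member_le_sum) (auto simp: C_def intro!: sum_nonneg)
      finally show "(1 + \<bar>t\<bar>) ^ N * cmod (leibniz e (\<lambda>n. nth_deriv n \<phi>) n t) \<le> (\<Sum>n\<le>N. C n) * E"
        by (simp add: \<alpha>_def)
    qed
  qed
  show ?thesis
    unfolding schwartz_operator_def
  proof (intro conjI ballI)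
    fix \<phi> assume \<phi>: "\<phi> \<in> schwartz"
    show "(\<lambda>t. u t * \<phi> t) \<in> schwartz"
    proof (rule schwartz_from_size[OF derivs_mult[OF u schwartz_derivs[OF \<phi>]]])
      show "\<exists>E. schwartz_size_le N (\<lambda>t. u t * \<phi> t) E" for N
        using size[of N] \<phi> schwartz_size_exists by blast
    qed
  qed (use size in \<open>auto simp: algebra_simps\<close>)
qed

text \<open>An elementary Peetre inequality, used throughout to trade weights between t, x and t -
  x.\<close>

lemma one_plus_abs_le_mult: "1 + \<bar>t :: real\<bar> \<le> (1 + \<bar>x\<bar>) * (1 + \<bar>t - x\<bar>)"
proof -
  have "1 + \<bar>t\<bar> \<le> 1 + \<bar>x\<bar> + \<bar>t - x\<bar> + \<bar>x\<bar> * \<bar>t - x\<bar>"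
    using abs_triangle_ineq[of x "t - x"] mult_nonneg_nonneg[OF abs_ge_zero[of x] abs_ge_zero[of "t - x"]] by linarith
  then show ?thesis by (simp add: algebra_simps)
qed

lemma schwartz_operator_translate: "schwartz_operator (translate x)"
proof -
  have size: "schwartz_size_le N (translate x \<phi>) ((1 + \<bar>x\<bar>) ^ N * E)"
    if \<phi>: "\<phi> \<in> schwartz" and E: "schwartz_size_le N \<phi> E" for N \<phi> E
    unfolding schwartz_size_le_def derivs_nth_deriv[OF derivs_translate[OF schwartz_derivs[OF \<phi>]]]
  proof (intro allI impI)
    fix n t assume "n \<le> N"
    have "(1 + \<bar>t\<bar>) ^ N * cmod (translate x (nth_deriv n \<phi>) t)
      \<le> ((1 + \<bar>x\<bar>) * (1 + \<bar>t - x\<bar>)) ^ N * cmod (nth_deriv n \<phi> (t - x))"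
      unfolding translate_def by (intro mult_right_mono power_mono one_plus_abs_le_mult) auto
    also have "\<dots> = (1 + \<bar>x\<bar>) ^ N * ((1 + \<bar>t - x\<bar>) ^ N * cmod (nth_deriv n \<phi> (t - x)))"
      by (simp add: power_mult_distrib)
    also have "\<dots> \<le> (1 + \<bar>x\<bar>) ^ N * E"
      using E \<open>n \<le> N\<close> unfolding schwartz_size_le_def by (intro mult_left_mono) auto
    finally show "(1 + \<bar>t\<bar>) ^ N * cmod (translate x (nth_deriv n \<phi>) t) \<le> (1 + \<bar>x\<bar>) ^ N * E" .
  qed
  show ?thesis
    unfolding schwartz_operator_def
  proof (intro conjI ballI)
    fix \<phi> assume \<phi>: "\<phi> \<in> schwartz"
    show "translate x \<phi> \<in> schwartz"
      using schwartz_from_size[OF derivs_translate[OF schwartz_derivs[OF \<phi>]], of x]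
        size[OF \<phi> schwartz_size_exists[OF \<phi>]] by blast
  next
    show "\<forall>N. \<exists>C M. \<forall>\<phi>\<in>schwartz. \<forall>E. schwartz_size_le M \<phi> E \<longrightarrow>
        schwartz_size_le N (translate x \<phi>) (C * E)"
      using size by blast
  qed (auto simp: translate_def)
qed

lemma derivs_modulation:
  "derivs (\<lambda>t. exp (\<i> * of_real (2 * pi * \<omega> * t)))
    (\<lambda>n t. (\<i> * of_real (2 * pi * \<omega>)) ^ n * exp (\<i> * of_real (2 * pi * \<omega> * t)))"
proof -
  have "((\<lambda>t. exp (\<i> * of_real (2 * pi * \<omega> * t))) has_vector_derivative
      \<i> * of_real (2 * pi * \<omega>) * exp (\<i> * of_real (2 * pi * \<omega> * t))) (at t)" for t
  proof -
    have "((\<lambda>t. exp (\<i> * of_real (2 * pi * \<omega>) * of_real t)) has_vector_derivative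
      \<i> * of_real (2 * pi * \<omega>) * exp (\<i> * of_real (2 * pi * \<omega>) * of_real t)) (at t)"
      by (rule has_vector_derivative_real_field[of "\<lambda>z. exp (\<i> * of_real (2 * pi * \<omega>) * z)"])
        (auto intro!: derivative_eq_intros)
    then show ?thesis by (simp add: mult.assoc)
  qed
  then show ?thesis unfolding derivs_def
    by (auto simp del: power_Suc simp: power_Suc2 mult.assoc intro!: has_vector_derivative_mult_right)
qed

lemma schwartz_operator_modulate: "schwartz_operator (modulate \<omega>)"
proof -
  have "modulate \<omega> = (\<lambda>\<phi> t. exp (\<i> * of_real (2 * pi * \<omega> * t)) * \<phi> t)"
    by (simp add: modulate_def fun_eq_iff)
  then show ?thesis
    using schwartz_operator_multiplier[OF derivs_modulation, of \<omega> "\<lambda>n. cmod (\<i> * of_real (2 * pi * \<omega>)) ^ n" "\<lambda>n. 0"]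
    by (simp add: norm_mult norm_power)
qed

lemma poly_growth: "\<exists>B N. \<forall>z. cmod (poly p z) \<le> B * (1 + cmod z) ^ N"
proof (induction p)
  case 0 then show ?case by (intro exI[of _ 0]) simp
next
  case (pCons a p)
  then obtain B N where B: "\<And>z. cmod (poly p z) \<le> B * (1 + cmod z) ^ N" by blast
  have "cmod (poly (pCons a p) z) \<le> (cmod a + \<bar>B\<bar>) * (1 + cmod z) ^ Suc N" for z
  proof -
    have "cmod (poly (pCons a p) z) \<le> cmod a + cmod z * cmod (poly p z)"
      using norm_triangle_ineq[of a "z * poly p z"] by (simp add: norm_mult)
    also have "cmod a \<le> cmod a * (1 + cmod z) ^ Suc N"
      using mult_left_mono[OF one_le_power[of "1 + cmod z" "Suc N"], of "cmod a"] by simp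
    also have "cmod z * cmod (poly p z) \<le> (1 + cmod z) * (\<bar>B\<bar> * (1 + cmod z) ^ N)"
    proof (rule mult_mono)
      have "B * (1 + cmod z) ^ N \<le> \<bar>B\<bar> * (1 + cmod z) ^ N" by (intro mult_right_mono) auto
      then show "cmod (poly p z) \<le> \<bar>B\<bar> * (1 + cmod z) ^ N" using B[of z] by simp
    qed auto
    finally show ?thesis by (simp add: algebra_simps)
  qed
  then show ?case by blast
qed

text \<open>Every derivative of the chirp is a polynomial times the chirp, which has modulus 1, so
  the multiplier criterion applies.\<close>

lemma schwartz_operator_chirp: "schwartz_operator (chirp s)"
proof -
  define a where "a = \<i> * of_real (2 * pi * s)"
  \<comment> \<open>The polynomial factor of the n-th derivative. The product rule gives the
    recursion p -> p' + a t p, where a t is the derivative of the exponent.\<close>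
  define q where "q n = ((\<lambda>p. pderiv p + [:0, a:] * p) ^^ n) 1" for n
  define u where "u t = exp (\<i> * of_real (pi * s * t\<^sup>2))" for t :: real
  define e where "e n t = poly (q n) (of_real t) * u t" for n and t :: real
  have e: "derivs u e"
    unfolding derivs_def
  proof (intro conjI allI)
    show "e 0 = u" by (simp add: e_def q_def fun_eq_iff)
    fix n t
    have "((\<lambda>t. poly (q n) (of_real t) * exp (\<i> * of_real (pi * s) * (of_real t)\<^sup>2)) has_vector_derivative
       (poly (pderiv (q n)) (of_real t) + a * of_real t * poly (q n) (of_real t)) * exp (\<i> * of_real (pi * s) * (of_real t)\<^sup>2)) (at t)"
      by (rule has_vector_derivative_real_field[of "\<lambda>z. poly (q n) z * exp (\<i> * of_real (pi * s) * z\<^sup>2)"])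
        (auto intro!: derivative_eq_intros simp: a_def algebra_simps)
    moreover have "e n = (\<lambda>t. poly (q n) (of_real t) * exp (\<i> * of_real (pi * s) * (of_real t)\<^sup>2))"
      by (simp add: e_def u_def fun_eq_iff mult.assoc)
    moreover have "e (Suc n) t = (poly (pderiv (q n)) (of_real t) + a * of_real t * poly (q n) (of_real t)) * exp (\<i> * of_real (pi * s) * (of_real t)\<^sup>2)"
      by (simp add: e_def u_def q_def algebra_simps)
    ultimately show "(e n has_vector_derivative e (Suc n) t) (at t)" by simp
  qed
  obtain B P where BP: "\<And>n z. cmod (poly (q n) z) \<le> B n * (1 + cmod z) ^ P n"
    using poly_growth[of "q _"] by metis
  have "cmod (e n t) \<le> B n * (1 + \<bar>t\<bar>) ^ P n" for n t
    using BP[of n "of_real t"] by (simp add: e_def u_def norm_mult)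
  from schwartz_operator_multiplier[OF e this] show ?thesis
    unfolding chirp_def[abs_def] u_def .
qed

lemma chirp_chirp: "chirp s (chirp s' \<phi>) = chirp (s + s') \<phi>"
  by (simp add: chirp_def fun_eq_iff exp_add[symmetric] mult.assoc[symmetric]) (simp add: algebra_simps)

lemma chirp_schwartz_iff: "chirp s \<phi> \<in> schwartz \<longleftrightarrow> \<phi> \<in> schwartz"
proof -
  have "chirp (-s) (chirp s \<phi>) = \<phi>" unfolding chirp_chirp by (simp add: chirp_def)
  then show ?thesis using schwartz_operator_chirp unfolding schwartz_operator_def by metis
qed

lemma modulate_schwartz_iff: "modulate \<omega> \<phi> \<in> schwartz \<longleftrightarrow> \<phi> \<in> schwartz"
proof -
  have "modulate (-\<omega>) (modulate \<omega> \<phi>) = \<phi>"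
    by (simp add: modulate_def fun_eq_iff mult.assoc[symmetric] exp_add[symmetric])
  then show ?thesis using schwartz_operator_modulate unfolding schwartz_operator_def by metis
qed

lemma translate_schwartz_iff: "translate x \<phi> \<in> schwartz \<longleftrightarrow> \<phi> \<in> schwartz"
proof -
  have "translate (-x) (translate x \<phi>) = \<phi>" by (simp add: translate_def)
  then show ?thesis using schwartz_operator_translate unfolding schwartz_operator_def by metis
qed

lemma tempered_chirp: "\<Lambda> \<in> tempered_distributions \<Longrightarrow> chirp_dist s \<Lambda> \<in> tempered_distributions"
  unfolding chirp_dist_def by (rule tempered_compose[OF _ schwartz_operator_chirp]) (auto simp: chirp_schwartz_iff)

lemma tempered_modulate: "\<Lambda> \<in> tempered_distributions \<Longrightarrow> modulate_dist \<omega> \<Lambda> \<in> tempered_distributions"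
  unfolding modulate_dist_def by (rule tempered_compose[OF _ schwartz_operator_modulate]) (auto simp: modulate_schwartz_iff)

lemma tempered_translate: "\<Lambda> \<in> tempered_distributions \<Longrightarrow> translate_dist x \<Lambda> \<in> tempered_distributions"
  unfolding translate_dist_def by (rule tempered_compose[OF _ schwartz_operator_translate]) (auto simp: translate_schwartz_iff)

lemma tempered_conj:
  assumes \<Lambda>: "\<Lambda> \<in> tempered_distributions" shows "conj_dist \<Lambda> \<in> tempered_distributions"
proof -
  obtain C N where C: "C \<ge> 0" "\<And>\<phi> E. \<phi> \<in> schwartz \<Longrightarrow> schwartz_size_le N \<phi> E \<Longrightarrow> cmod (\<Lambda> \<phi>) \<le> C * E"
    using tempered_bound[OF \<Lambda>] by metis
  show ?thesis
    unfolding conj_dist_def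
  proof (rule temperedI)
    fix \<phi> E assume \<phi>: "\<phi> \<in> schwartz" and E: "schwartz_size_le N \<phi> E"
    have "schwartz_size_le N (\<lambda>t. cnj (\<phi> t)) E"
      using E unfolding schwartz_size_le_def derivs_nth_deriv[OF derivs_cnj[OF schwartz_derivs[OF \<phi>]]] by simp
    then show "cmod (cnj (\<Lambda> (\<lambda>t. cnj (\<phi> t)))) \<le> C * E"
      using C(2)[OF schwartz_cnj[OF \<phi>]] by simp
  qed (auto simp: schwartz_cnj_iff tempered_off[OF \<Lambda>] tempered_cmult[OF \<Lambda>] tempered_add[OF \<Lambda>] schwartz_cnj)
qed

section \<open>Fourier inversion\<close>

definition fourier :: "(real \<Rightarrow> complex) \<Rightarrow> real \<Rightarrow> complex" where
  "fourier \<psi> \<omega> = (LINT u|lborel. \<psi> u * exp (- (\<i> * of_real (2 * pi * \<omega> * u))))"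

lemma gaussian_integrable: "(\<sigma>::real) > 0 \<Longrightarrow> integrable lborel (\<lambda>\<omega>. exp (- (\<sigma> * \<omega>)\<^sup>2 / 2))"
proof -
  assume s: "\<sigma> > 0"
  have "integrable lborel (\<lambda>v. sqrt (2 * pi) * std_normal_density v)"
    by (intro integrable_mult_right) simp
  then have "integrable lborel (\<lambda>v::real. exp (- v\<^sup>2 / 2))"
    by (simp add: std_normal_density_def)
  from lborel_integrable_real_affine[OF this, of \<sigma> 0] s show ?thesis by simp
qed

text \<open>The characteristic function of the standard normal distribution at \<xi> / \<sigma>,
  after the substitution v = \<sigma> \<omega>.\<close>

lemma gaussian_fourier:
  assumes "(\<sigma>::real) > 0"
  shows "(LINT \<omega>|lborel. exp (\<i> * of_real (\<xi> * \<omega>)) * of_real (exp (- (\<sigma> * \<omega>)\<^sup>2 / 2)))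
    = of_real (sqrt (2 * pi) / \<sigma> * exp (- (\<xi> / \<sigma>)\<^sup>2 / 2))"
proof -
  have "of_real (exp (- (\<xi> / \<sigma>)\<^sup>2 / 2)) = char std_normal_distribution (\<xi> / \<sigma>)"
    by (simp add: char_std_normal_distribution)
  also have "\<dots> = (LINT v|lborel. std_normal_density v *\<^sub>R exp (\<i> * of_real (\<xi> / \<sigma> * v)))"
    unfolding char_def by (subst integral_density) (auto simp: normal_density_nonneg)
  also have "\<dots> = \<sigma> *\<^sub>R (LINT \<omega>|lborel. std_normal_density (0 + \<sigma> * \<omega>) *\<^sub>R exp (\<i> * of_real (\<xi> / \<sigma> * (0 + \<sigma> * \<omega>))))"
    using assms by (subst lborel_integral_real_affine[of \<sigma> _ 0]) auto
  also have "\<dots> = \<sigma> *\<^sub>R (LINT \<omega>|lborel. of_real (inverse (sqrt (2 * pi))) * (exp (\<i> * of_real (\<xi> * \<omega>)) * of_real (exp (- (\<sigma> * \<omega>)\<^sup>2 / 2))))"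
    using assms by (intro arg_cong[where f="\<lambda>x. \<sigma> *\<^sub>R x"] Bochner_Integration.integral_cong)
      (auto simp: std_normal_density_def scaleR_conv_of_real field_simps simp del: of_real_exp)
  finally show ?thesis
    using assms by (simp add: scaleR_conv_of_real field_simps)
qed

text \<open>The Gaussian factor makes the double integral absolutely convergent, so Fubini's theorem
  turns the damped inversion integral into an average of \<psi> near t. Letting the damping
  disappear gives the inversion integral on one side, dominated by the modulus of
  \<open>fourier \<psi>\<close>, and \<psi>(t) on the other, by continuity and boundedness of
  \<psi>.\<close>

lemma fourier_inversion:
  assumes cont: "continuous_on UNIV \<psi>" and int: "integrable lborel \<psi>" and bdd: "\<And>u. cmod (\<psi> u) \<le> D"
    and fint: "integrable lborel (fourier \<psi>)"
  shows "\<psi> t = (LINT \<omega>|lborel. fourier \<psi> \<omega> * exp (\<i> * of_real (2 * pi * \<omega> * t)))"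
proof -
  have [measurable]: "\<psi> \<in> borel_measurable borel" "fourier \<psi> \<in> borel_measurable borel"
    using borel_measurable_continuous_onI[OF cont] fint by auto
  \<comment> \<open>Gaussian regularisation of the inversion integral with width \<open>\<sigma> k \<longlonglongrightarrow> 0\<close>\<close>
  define \<sigma> where "\<sigma> k = inverse (real (Suc k))" for k
  have \<sigma>: "\<sigma> k > 0" for k by (simp add: \<sigma>_def)
  have \<sigma>0: "\<sigma> \<longlonglongrightarrow> 0" unfolding \<sigma>_def by (rule LIMSEQ_inverse_real_of_nat)
  define G where "G k \<omega> = exp (- (\<sigma> k * \<omega>)\<^sup>2 / 2)" for k \<omega>
  have G: "integrable lborel (G k)" "0 < G k \<omega>" "G k \<omega> \<le> 1" for k \<omega>
    using gaussian_integrable[OF \<sigma>[of k]] by (auto simp: G_def[abs_def])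
  have [measurable]: "G k \<in> borel_measurable borel" for k using G(1)[of k] by auto
  define L where "L k = (LINT \<omega>|lborel. fourier \<psi> \<omega> * exp (\<i> * of_real (2 * pi * \<omega> * t)) * of_real (G k \<omega>))" for k
  have 1: "L \<longlonglongrightarrow> (LINT \<omega>|lborel. fourier \<psi> \<omega> * exp (\<i> * of_real (2 * pi * \<omega> * t)))"
    unfolding L_def
  proof (rule Bochner_Integration.integral_dominated_convergence[where w="\<lambda>\<omega>. cmod (fourier \<psi> \<omega>)"])
    show "AE \<omega> in lborel. (\<lambda>k. fourier \<psi> \<omega> * exp (\<i> * of_real (2 * pi * \<omega> * t)) * of_real (G k \<omega>))
      \<longlonglongrightarrow> fourier \<psi> \<omega> * exp (\<i> * of_real (2 * pi * \<omega> * t))"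
    proof (intro AE_I2)
      fix \<omega> :: real
      have "(\<lambda>k. G k \<omega>) \<longlonglongrightarrow> exp (- (0 * \<omega>)\<^sup>2 / 2)"
        unfolding G_def by (intro tendsto_intros \<sigma>0) auto
      then have "(\<lambda>k. G k \<omega>) \<longlonglongrightarrow> 1" by simp
      from tendsto_mult[OF tendsto_const tendsto_of_real[OF this],
          of "fourier \<psi> \<omega> * exp (\<i> * of_real (2 * pi * \<omega> * t))"]
      show "(\<lambda>k. fourier \<psi> \<omega> * exp (\<i> * of_real (2 * pi * \<omega> * t)) * of_real (G k \<omega>))
        \<longlonglongrightarrow> fourier \<psi> \<omega> * exp (\<i> * of_real (2 * pi * \<omega> * t))"
        by simp
    qed
    show "AE \<omega> in lborel. cmod (fourier \<psi> \<omega> * exp (\<i> * of_real (2 * pi * \<omega> * t)) * of_real (G k \<omega>)) \<le> cmod (fourier \<psi> \<omega>)" for k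
      using G(2,3)[of k] by (intro AE_I2) (auto simp: norm_mult abs_of_pos intro!: mult_left_le)
  qed (use fint in auto)
  have Lk: "L k = (LINT v|lborel. std_normal_density v *\<^sub>R \<psi> (t + \<sigma> k / (2 * pi) * v))" for k
  proof -
    define F where "F \<omega> u = \<psi> u * exp (\<i> * of_real (2 * pi * (t - u) * \<omega>)) * of_real (G k \<omega>)" for \<omega> u
    have [measurable]: "case_prod F \<in> borel_measurable (lborel \<Otimes>\<^sub>M lborel)"
      unfolding F_def split_beta by measurable
    have "integrable (lborel \<Otimes>\<^sub>M lborel) (case_prod F)"
    proof (rule lborel_pair.Fubini_integrable)
      have nF: "cmod (F \<omega> u) = G k \<omega> * cmod (\<psi> u)" for \<omega> u
        using G(2)[of k \<omega>] by (simp add: F_def norm_mult)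
      show "integrable lborel (\<lambda>\<omega>. LINT u|lborel. norm (case (\<omega>, u) of (x, y) \<Rightarrow> F x y))"
        using G(1)[of k] by (simp add: nF)
      show "AE \<omega> in lborel. integrable lborel (\<lambda>u. case (\<omega>, u) of (x, y) \<Rightarrow> F x y)"
      proof (intro AE_I2)
        fix \<omega>
        have "integrable lborel (\<lambda>u. G k \<omega> * cmod (\<psi> u))" using int by auto
        then show "integrable lborel (\<lambda>u. case (\<omega>, u) of (x, y) \<Rightarrow> F x y)"
          by (rule Bochner_Integration.integrable_bound) (use nF G(2) in \<open>auto simp: F_def\<close>)
      qed
    qed simp
    note fub = lborel_pair.Fubini_integral[OF this]
    have "L k = (LINT \<omega>|lborel. LINT u|lborel. F \<omega> u)"
      unfolding L_def fourier_def
    proof (intro Bochner_Integration.integral_cong refl)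
      fix \<omega>
      have "(LINT u|lborel. \<psi> u * exp (- (\<i> * of_real (2 * pi * \<omega> * u)))) * exp (\<i> * of_real (2 * pi * \<omega> * t)) * of_real (G k \<omega>)
        = (LINT u|lborel. \<psi> u * exp (- (\<i> * of_real (2 * pi * \<omega> * u))) * exp (\<i> * of_real (2 * pi * \<omega> * t)) * of_real (G k \<omega>))"
        by (simp only: integral_mult_left_zero)
      also have "\<dots> = (LINT u|lborel. F \<omega> u)"
        unfolding F_def
        by (intro Bochner_Integration.integral_cong refl) (simp add: mult.assoc exp_add[symmetric], simp add: algebra_simps)
      finally show "(LINT u|lborel. \<psi> u * exp (- (\<i> * of_real (2 * pi * \<omega> * u)))) * exp (\<i> * of_real (2 * pi * \<omega> * t)) * of_real (G k \<omega>)
        = (LINT u|lborel. F \<omega> u)" .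
    qed
    also have "\<dots> = (LINT u|lborel. LINT \<omega>|lborel. F \<omega> u)" using fub by simp
    also have "\<dots> = (LINT u|lborel. \<psi> u * of_real (sqrt (2 * pi) / \<sigma> k * exp (- ((2 * pi * (t - u)) / \<sigma> k)\<^sup>2 / 2)))"
      unfolding F_def mult.assoc integral_mult_right_zero
    proof (intro Bochner_Integration.integral_cong refl arg_cong2[where f="(*)"])
      fix u
      show "(LINT \<omega>|lborel. exp (\<i> * of_real (2 * (pi * ((t - u) * \<omega>)))) * of_real (G k \<omega>))
        = of_real (sqrt (2 * pi) / \<sigma> k * exp (- (2 * (pi * (t - u)) / \<sigma> k)\<^sup>2 / 2))"
        using gaussian_fourier[OF \<sigma>[of k], of "2 * pi * (t - u)"] unfolding G_def mult.assoc .
    qed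
    \<comment> \<open>The substitution u = t + (\<sigma> k / (2 pi)) v turns the Gaussian kernel
      into the standard normal density, leaving \<sigma> k in the argument of \<psi> only.\<close>
    also have "\<dots> = \<bar>\<sigma> k / (2 * pi)\<bar> *\<^sub>R (LINT v|lborel. \<psi> (t + \<sigma> k / (2 * pi) * v) *
        of_real (sqrt (2 * pi) / \<sigma> k * exp (- ((2 * pi * (t - (t + \<sigma> k / (2 * pi) * v))) / \<sigma> k)\<^sup>2 / 2)))"
      using \<sigma>[of k] by (intro lborel_integral_real_affine) auto
    also have "\<dots> = (LINT v|lborel. std_normal_density v *\<^sub>R \<psi> (t + \<sigma> k / (2 * pi) * v))"
    proof -
      have pull: "a *\<^sub>R (z * of_real b) = (a * b) *\<^sub>R z" for a b and z :: complex
        by (simp add: scaleR_conv_of_real)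
      have "\<bar>\<sigma> k / (2 * pi)\<bar> * (sqrt (2 * pi) / \<sigma> k * exp (- ((2 * pi * (t - (t + \<sigma> k / (2 * pi) * v))) / \<sigma> k)\<^sup>2 / 2))
        = std_normal_density v" for v
      proof -
        have "2 * pi * (t - (t + \<sigma> k / (2 * pi) * v)) / \<sigma> k = - v"
          using \<sigma>[of k] by simp
        moreover have "\<bar>\<sigma> k / (2 * pi)\<bar> * (sqrt (2 * pi) / \<sigma> k) = 1 / sqrt (2 * pi)"
          using \<sigma>[of k] by (simp add: field_simps)
        ultimately show ?thesis
          unfolding std_normal_density_def mult.assoc[symmetric] by (simp only: power2_minus minus_divide_left)
      qed
      then have "\<bar>\<sigma> k / (2 * pi)\<bar> *\<^sub>R (\<psi> (t + \<sigma> k / (2 * pi) * v) *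
        of_real (sqrt (2 * pi) / \<sigma> k * exp (- ((2 * pi * (t - (t + \<sigma> k / (2 * pi) * v))) / \<sigma> k)\<^sup>2 / 2)))
        = std_normal_density v *\<^sub>R \<psi> (t + \<sigma> k / (2 * pi) * v)" for v
        using pull by metis
      then show ?thesis unfolding integral_scaleR_right[symmetric] by simp
    qed
    finally show ?thesis .
  qed
  have 2: "L \<longlonglongrightarrow> (LINT v|lborel. std_normal_density v *\<^sub>R \<psi> t)"
    unfolding Lk
  proof (rule Bochner_Integration.integral_dominated_convergence[where w="\<lambda>v. std_normal_density v * D"])
    show "AE v in lborel. (\<lambda>k. std_normal_density v *\<^sub>R \<psi> (t + \<sigma> k / (2 * pi) * v))
      \<longlonglongrightarrow> std_normal_density v *\<^sub>R \<psi> t"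
    proof (intro AE_I2 tendsto_intros)
      fix v
      have "(\<lambda>k. t + \<sigma> k / (2 * pi) * v) \<longlonglongrightarrow> t + 0 / (2 * pi) * v" by (intro tendsto_intros \<sigma>0) auto
      then show "(\<lambda>k. \<psi> (t + \<sigma> k / (2 * pi) * v)) \<longlonglongrightarrow> \<psi> t"
        using continuous_on_tendsto_compose[OF cont] by simp
    qed
    show "AE v in lborel. cmod (std_normal_density v *\<^sub>R \<psi> (t + \<sigma> k / (2 * pi) * v)) \<le> std_normal_density v * D" for k
      using bdd by (intro AE_I2) (auto simp: normal_density_nonneg intro!: mult_left_mono)
  qed (auto)
  have "(LINT v|lborel. std_normal_density v *\<^sub>R \<psi> t) = \<psi> t" by simp
  with LIMSEQ_unique[OF 1 2] show ?thesis by simp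
qed

section \<open>Gabor expansion of tempered distributions\<close>

lemma integrable_inverse_one_plus_square: "integrable lborel (\<lambda>t::real. inverse (1 + t\<^sup>2))"
  using integrable_inverse_1_plus_square by (simp add: set_integrable_def einterval_def)

lemma inverse_power2_le: "inverse ((1 + \<bar>t\<bar>)\<^sup>2) \<le> inverse (1 + (t::real)\<^sup>2)"
  by (rule le_imp_inverse_le) (auto simp: power2_sum add_pos_nonneg)

lemma integrable_inverse_power2: "integrable lborel (\<lambda>t::real. inverse ((1 + \<bar>t\<bar>)\<^sup>2))"
  by (rule Bochner_Integration.integrable_bound[OF integrable_inverse_one_plus_square])
    (use inverse_power2_le in \<open>auto intro!: AE_I2 intro: order.trans[OF _ abs_ge_self]\<close>)

lemma inverse_power_mult_le:
  "inverse ((1 + \<bar>t::real\<bar>) ^ L) * inverse ((1 + \<bar>t - x\<bar>) ^ L) \<le> inverse ((1 + \<bar>x\<bar>) ^ L)"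
proof -
  have "(1 + \<bar>x\<bar>) ^ L \<le> ((1 + \<bar>t\<bar>) * (1 + \<bar>t - x\<bar>)) ^ L"
    using one_plus_abs_le_mult[of x t] by (intro power_mono) (auto simp: abs_minus_commute)
  then have "inverse (((1 + \<bar>t\<bar>) * (1 + \<bar>t - x\<bar>)) ^ L) \<le> inverse ((1 + \<bar>x\<bar>) ^ L)"
    by (intro le_imp_inverse_le) (auto simp: add_pos_nonneg)
  then show ?thesis by (simp add: power_mult_distrib)
qed

text \<open>The n-th derivative of the time-frequency shift of h by z = (x, \<omega>), spelled out
  by the Leibniz rule so that its growth in x and \<omega> can be read off.\<close>

definition gabor :: "(real \<Rightarrow> complex) \<Rightarrow> nat \<Rightarrow> real \<times> real \<Rightarrow> real \<Rightarrow> complex" where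
  "gabor h n z = leibniz (\<lambda>k t. (\<i> * of_real (2 * pi * snd z)) ^ k * exp (\<i> * of_real (2 * pi * snd z * t)))
     (\<lambda>k. translate (fst z) (nth_deriv k h)) n"

lemma gabor_0: "gabor h 0 z = modulate (snd z) (translate (fst z) h)"
  by (simp add: gabor_def leibniz_def modulate_def fun_eq_iff)

lemma gabor_derivs:
  assumes "h \<in> schwartz" shows "derivs (gabor h 0 z) (\<lambda>n. gabor h n z)"
  using derivs_mult[OF derivs_modulation derivs_translate[OF schwartz_derivs[OF assms]], of "snd z" "fst z"]
  by (simp add: gabor_0 modulate_def) (simp add: gabor_def[abs_def])

lemma gabor_continuous:
  assumes "h \<in> schwartz" shows "continuous_on UNIV (\<lambda>(z, t). gabor h n z t)"
proof -
  have "continuous_on UNIV (\<lambda>p::(real \<times> real) \<times> real. nth_deriv k h (snd p - fst (fst p)))" for k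
    by (rule continuous_on_compose2[OF schwartz_continuous[OF assms, of UNIV k]])
      (auto intro!: continuous_intros)
  then show ?thesis
    unfolding gabor_def leibniz_def translate_def split_beta
    by (auto intro!: continuous_intros)
qed

lemma gabor_bound:
  assumes "h \<in> schwartz"
  obtains D where "D \<ge> 0"
    "\<And>x \<omega> t. cmod (gabor h n (x, \<omega>) t) \<le> D * ((1 + \<bar>\<omega>\<bar>) ^ n * inverse ((1 + \<bar>t - x\<bar>) ^ K))"
proof -
  obtain H where H: "\<And>k. H k > 0" "\<And>k t. cmod (nth_deriv k h t) \<le> H k * inverse ((1 + \<bar>t\<bar>) ^ K)"
    using schwartz_decay[OF assms, of K] by metis
  define D where "D = (\<Sum>k\<le>n. of_nat (n choose k) * (2 * pi) ^ k * H (n - k))"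
  have "cmod (gabor h n (x, \<omega>) t) \<le> D * ((1 + \<bar>\<omega>\<bar>) ^ n * inverse ((1 + \<bar>t - x\<bar>) ^ K))" for x \<omega> t
    unfolding D_def gabor_def
  proof (rule leibniz_bound)
    fix k assume "k \<le> n"
    have "\<bar>\<omega>\<bar> ^ k \<le> (1 + \<bar>\<omega>\<bar>) ^ k" by (intro power_mono) auto
    also have "\<dots> \<le> (1 + \<bar>\<omega>\<bar>) ^ n" using \<open>k \<le> n\<close> by (intro power_increasing) auto
    finally have "(2 * pi) ^ k * \<bar>\<omega>\<bar> ^ k \<le> (2 * pi) ^ k * (1 + \<bar>\<omega>\<bar>) ^ n" by (intro mult_left_mono) auto
    then show "cmod ((\<i> * of_real (2 * pi * snd (x, \<omega>))) ^ k * exp (\<i> * of_real (2 * pi * snd (x, \<omega>) * t)))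
        \<le> (2 * pi) ^ k * (1 + \<bar>\<omega>\<bar>) ^ n"
      by (simp add: norm_mult norm_power power_mult_distrib abs_mult)
  next
    fix k
    show "cmod (translate (fst (x, \<omega>)) (nth_deriv k h) t) \<le> H k * inverse ((1 + \<bar>t - x\<bar>) ^ K)"
      using H(2) by (simp add: translate_def)
  qed
  moreover have "D \<ge> 0" unfolding D_def
    using H(1) by (intro sum_nonneg mult_nonneg_nonneg) (auto intro: less_imp_le)
  ultimately show ?thesis using that by blast
qed

lemma gabor_weighted_bound:
  assumes "h \<in> schwartz"
  obtains D where "D \<ge> 0"
    "\<And>x \<omega> t. (1 + \<bar>t\<bar>) ^ K * cmod (gabor h n (x, \<omega>) t) \<le> D * ((1 + \<bar>\<omega>\<bar>) ^ n * (1 + \<bar>x\<bar>) ^ K)"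
proof -
  obtain D where D: "D \<ge> 0"
    "\<And>x \<omega> t. cmod (gabor h n (x, \<omega>) t) \<le> D * ((1 + \<bar>\<omega>\<bar>) ^ n * inverse ((1 + \<bar>t - x\<bar>) ^ K))"
    using gabor_bound[OF assms] by metis
  have "(1 + \<bar>t\<bar>) ^ K * cmod (gabor h n (x, \<omega>) t) \<le> D * ((1 + \<bar>\<omega>\<bar>) ^ n * (1 + \<bar>x\<bar>) ^ K)" for x \<omega> t
  proof -
    have "(1 + \<bar>t\<bar>) ^ K * cmod (gabor h n (x, \<omega>) t)
      \<le> ((1 + \<bar>x\<bar>) * (1 + \<bar>t - x\<bar>)) ^ K * (D * ((1 + \<bar>\<omega>\<bar>) ^ n * inverse ((1 + \<bar>t - x\<bar>) ^ K)))"
      by (intro mult_mono power_mono one_plus_abs_le_mult D(2)) auto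
    also have "\<dots> = (D * ((1 + \<bar>\<omega>\<bar>) ^ n * (1 + \<bar>x\<bar>) ^ K)) * ((1 + \<bar>t - x\<bar>) ^ K * inverse ((1 + \<bar>t - x\<bar>) ^ K))"
      by (simp add: power_mult_distrib)
    also have "(1 + \<bar>t - x\<bar>) ^ K * inverse ((1 + \<bar>t - x\<bar>) ^ K) = 1"
      by (intro right_inverse) (simp add: add_pos_nonneg)
    finally show ?thesis by simp
  qed
  then show ?thesis using that D(1) by blast
qed

lemma gabor_family:
  assumes h: "h \<in> schwartz" shows "schwartz_family (gabor h)"
proof
  fix Q :: "(real \<times> real) set" and n N assume "compact Q"
  then obtain R where R: "\<And>z. z \<in> Q \<Longrightarrow> norm z \<le> R" using compact_imp_bounded bounded_iff by metis
  obtain D where D: "D \<ge> 0"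
    "\<And>x \<omega> t. (1 + \<bar>t\<bar>) ^ N * cmod (gabor h n (x, \<omega>) t) \<le> D * ((1 + \<bar>\<omega>\<bar>) ^ n * (1 + \<bar>x\<bar>) ^ N)"
    using gabor_weighted_bound[OF h] by metis
  have "(1 + \<bar>t\<bar>) ^ N * cmod (gabor h n z t) \<le> D * ((1 + R) ^ n * (1 + R) ^ N)" if "z \<in> Q" for z t
  proof -
    obtain x \<omega> where z: "z = (x, \<omega>)" by (cases z)
    have "\<bar>x\<bar> \<le> R" "\<bar>\<omega>\<bar> \<le> R" using R[OF that] norm_fst_le[of x \<omega>] norm_snd_le[of \<omega> x] by (auto simp: z)
    then show ?thesis
      using D(1) unfolding z by (intro order.trans[OF D(2)] mult_left_mono mult_mono power_mono) auto
  qed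
  then show "\<exists>D. \<forall>z\<in>Q. \<forall>t. (1 + \<bar>t\<bar>) ^ N * cmod (gabor h n z t) \<le> D" by blast
qed (rule gabor_derivs[OF h] gabor_continuous[OF h])+

section \<open>Rapid decay of short time Fourier transforms of Schwartz functions\<close>

text \<open>The short time Fourier transform of the function \<phi> with window h, as an integral.
  It is the coefficient in the expansion, whereas \<open>stft\<close> is defined for
  distributions.\<close>

definition gabor_coeff :: "(real \<Rightarrow> complex) \<Rightarrow> (real \<Rightarrow> complex) \<Rightarrow> real \<times> real \<Rightarrow> complex" where
  "gabor_coeff h \<phi> z = fourier (\<lambda>u. \<phi> u * cnj (h (u - fst z))) (snd z)"

lemma integral_derivative_zero:
  fixes g g' :: "real \<Rightarrow> complex"
  assumes d: "\<And>t. (g has_vector_derivative g' t) (at t)" and c: "continuous_on UNIV g'"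
    and i: "integrable lborel g'" and b: "\<And>t. cmod (g t) \<le> D * inverse ((1 + \<bar>t\<bar>)\<^sup>2)"
  shows "(LINT t|lborel. g' t) = 0"
proof -
  have top: "(g \<longlongrightarrow> 0) at_top"
    by (rule Lim_null_comparison[of _ "\<lambda>t. D * inverse ((1 + \<bar>t\<bar>)\<^sup>2)"]) (use b in simp, real_asymp)
  have bot: "(g \<longlongrightarrow> 0) at_bot"
    by (rule Lim_null_comparison[of _ "\<lambda>t. D * inverse ((1 + \<bar>t\<bar>)\<^sup>2)"]) (use b in simp, real_asymp)
  have "(LBINT t=-\<infinity>..\<infinity>. g' t) = 0 - 0"
  proof (rule interval_integral_FTC_integrable[where F=g])
    show "((g \<circ> real_of_ereal) \<longlongrightarrow> 0) (at_right (-\<infinity>))"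
      using bot by (simp add: ereal_tendsto_simps)
    show "((g \<circ> real_of_ereal) \<longlongrightarrow> 0) (at_left \<infinity>)"
      using top by (simp add: ereal_tendsto_simps)
    show "set_integrable lborel (einterval (-\<infinity>) \<infinity>) g'"
      using i by (simp add: set_integrable_def einterval_def)
  qed (use d c in \<open>auto simp: continuous_on_eq_continuous_at\<close>)
  then show ?thesis by (simp add: interval_integral_to_infinity_eq interval_lebesgue_integral_def set_lebesgue_integral_def einterval_def)
qed

text \<open>Integration by parts: the derivative of \<open>d n t\<close> times the exponential
  integrates to 0 over the line, the boundary terms vanishing by the decay of
  \<open>d n\<close>.\<close>

lemma fourier_derivative:
  assumes d: "derivs \<psi> d" and b: "\<And>n t. cmod (d n t) \<le> D n * inverse ((1 + \<bar>t\<bar>)\<^sup>2)"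
  shows "fourier (d n) \<omega> = (\<i> * of_real (2 * pi * \<omega>)) ^ n * fourier \<psi> \<omega>"
proof (induction n)
  case 0
  then show ?case using d by (simp add: derivs_def)
next
  case (Suc n)
  define e where "e t = exp (- (\<i> * of_real (2 * pi * \<omega> * t)))" for t
  have e': "(e has_vector_derivative - (\<i> * of_real (2 * pi * \<omega>)) * e t) (at t)" for t
    using derivs_modulation[unfolded derivs_def, THEN conjunct2, rule_format, of "- \<omega>" 0 t]
    by (simp add: e_def[abs_def])
  have d': "(d n has_vector_derivative d (Suc n) t) (at t)" for n t using d by (simp add: derivs_def)
  have dc: "continuous_on UNIV (d n)" for n
    by (intro continuous_at_imp_continuous_on ballI has_vector_derivative_continuous[OF d'])
  have ec: "continuous_on UNIV e" unfolding e_def by (intro continuous_intros)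
  have ei: "integrable lborel (\<lambda>t. d n t * e t)" for n
  proof (rule Bochner_Integration.integrable_bound[of lborel "\<lambda>t. D n * inverse ((1 + \<bar>t\<bar>)\<^sup>2)"])
    show "(\<lambda>t. d n t * e t) \<in> borel_measurable lborel"
      using borel_measurable_continuous_onI[OF continuous_on_mult[OF dc ec]] by simp
    show "AE t in lborel. cmod (d n t * e t) \<le> norm (D n * inverse ((1 + \<bar>t\<bar>)\<^sup>2))"
      using b by (intro AE_I2) (auto simp: norm_mult e_def intro: order.trans[OF _ abs_ge_self])
  qed (use integrable_inverse_power2 in auto)
  have "(LINT t|lborel. d n t * (- (\<i> * of_real (2 * pi * \<omega>)) * e t) + d (Suc n) t * e t) = 0"
  proof (rule integral_derivative_zero[where g="\<lambda>t. d n t * e t" and D="D n"])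
    show "((\<lambda>t. d n t * e t) has_vector_derivative d n t * (- (\<i> * of_real (2 * pi * \<omega>)) * e t) + d (Suc n) t * e t) (at t)" for t
      by (rule has_vector_derivative_mult[OF d' e'])
    show "continuous_on UNIV (\<lambda>t. d n t * (- (\<i> * of_real (2 * pi * \<omega>)) * e t) + d (Suc n) t * e t)"
      by (intro continuous_intros dc ec)
    show "integrable lborel (\<lambda>t. d n t * (- (\<i> * of_real (2 * pi * \<omega>)) * e t) + d (Suc n) t * e t)"
      using ei[of n] ei[of "Suc n"] by (intro Bochner_Integration.integrable_add) (simp_all add: mult.left_commute[of "d n _"])
    show "cmod (d n t * e t) \<le> D n * inverse ((1 + \<bar>t\<bar>)\<^sup>2)" for t
      using b by (simp add: norm_mult e_def)
  qed
  also have "(LINT t|lborel. d n t * (- (\<i> * of_real (2 * pi * \<omega>)) * e t) + d (Suc n) t * e t)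
     = (LINT t|lborel. - (\<i> * of_real (2 * pi * \<omega>)) * (d n t * e t) + d (Suc n) t * e t)"
    by (intro Bochner_Integration.integral_cong) (simp_all add: mult_ac)
  also have "\<dots> = - (\<i> * of_real (2 * pi * \<omega>)) * fourier (d n) \<omega> + fourier (d (Suc n)) \<omega>"
    unfolding fourier_def e_def[symmetric]
    by (subst Bochner_Integration.integral_add) (use ei[of n] ei[of "Suc n"] in auto)
  finally show ?case using Suc by (simp add: mult.assoc)
qed

text \<open>\<phi> contributes decay of order 2 + L. Two powers are kept for integrability in u; the
  other L combine with the decay of h at u - x into decay in x, by
  \<open>inverse_power_mult_le\<close>. The constants do not depend on x.\<close>

lemma schwartz_product_decay:
  assumes \<phi>: "\<phi> \<in> schwartz" and h: "h \<in> schwartz"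
  obtains d D where "\<And>x. derivs (\<lambda>u. \<phi> u * cnj (h (u - x))) (d x)" "\<And>n. D n \<ge> 0"
    "\<And>x n u. cmod (d x n u) \<le> D n * (inverse ((1 + \<bar>u\<bar>)\<^sup>2) * inverse ((1 + \<bar>x\<bar>) ^ L))"
proof -
  obtain H where H: "\<And>k. H k > 0" "\<And>k t. cmod (nth_deriv k h t) \<le> H k * inverse ((1 + \<bar>t\<bar>) ^ L)"
    using schwartz_decay[OF h, of L] by metis
  obtain P where P: "\<And>k. P k > 0" "\<And>k t. cmod (nth_deriv k \<phi> t) \<le> P k * inverse ((1 + \<bar>t\<bar>) ^ (2 + L))"
    using schwartz_decay[OF \<phi>, of "2 + L"] by metis
  define d where "d x = leibniz (\<lambda>n. nth_deriv n \<phi>) (\<lambda>n. translate x (\<lambda>t. cnj (nth_deriv n h t)))" for x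
  define D where "D n = (\<Sum>k\<le>n. of_nat (n choose k) * P k * H (n - k))" for n
  show ?thesis
  proof
    show "derivs (\<lambda>u. \<phi> u * cnj (h (u - x))) (d x)" for x
      using derivs_mult[OF schwartz_derivs[OF \<phi>] derivs_translate[OF derivs_cnj[OF schwartz_derivs[OF h]]]]
      unfolding d_def by (simp add: translate_def)
    show "D n \<ge> 0" for n
      unfolding D_def using H(1) P(1) by (intro sum_nonneg mult_nonneg_nonneg) (auto intro: less_imp_le)
    fix x n u
    have "cmod (d x n u) \<le> D n * (inverse ((1 + \<bar>u\<bar>) ^ (2 + L)) * inverse ((1 + \<bar>u - x\<bar>) ^ L))"
      unfolding d_def D_def by (rule leibniz_bound) (use H P in \<open>auto simp: translate_def\<close>)
    also have "inverse ((1 + \<bar>u\<bar>) ^ (2 + L)) * inverse ((1 + \<bar>u - x\<bar>) ^ L)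
      = inverse ((1 + \<bar>u\<bar>)\<^sup>2) * (inverse ((1 + \<bar>u\<bar>) ^ L) * inverse ((1 + \<bar>u - x\<bar>) ^ L))"
      by (simp only: power_add inverse_mult_distrib mult.assoc)
    also have "D n * \<dots> \<le> D n * (inverse ((1 + \<bar>u\<bar>)\<^sup>2) * inverse ((1 + \<bar>x\<bar>) ^ L))"
      using \<open>D n \<ge> 0\<close> by (intro mult_left_mono inverse_power_mult_le) auto
    finally show "cmod (d x n u) \<le> D n * (inverse ((1 + \<bar>u\<bar>)\<^sup>2) * inverse ((1 + \<bar>x\<bar>) ^ L))" .
  qed
qed

text \<open>Decay in \<omega> comes from differentiating the product of \<phi> with the translated
  window, and decay in x from the smallness of that product and its derivatives.\<close>

lemma gabor_coeff_decay:
  assumes \<phi>: "\<phi> \<in> schwartz" and h: "h \<in> schwartz"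
  obtains D where "D \<ge> 0"
    "\<And>x \<omega>. cmod (gabor_coeff h \<phi> (x, \<omega>)) \<le> D * (inverse ((1 + \<bar>x\<bar>) ^ L) * inverse ((1 + \<bar>\<omega>\<bar>) ^ M))"
proof -
  obtain d D where d: "\<And>x. derivs (\<lambda>u. \<phi> u * cnj (h (u - x))) (d x)" and D: "\<And>n. D n \<ge> 0"
    and b: "\<And>x n u. cmod (d x n u) \<le> D n * (inverse ((1 + \<bar>u\<bar>)\<^sup>2) * inverse ((1 + \<bar>x\<bar>) ^ L))"
    by (rule schwartz_product_decay[OF \<phi> h, of L], rule that)
  define c where "c = (LINT u|lborel. inverse ((1 + \<bar>u::real\<bar>)\<^sup>2))"
  have c: "c \<ge> 0" unfolding c_def by (intro Bochner_Integration.integral_nonneg) auto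
  have main: "\<bar>\<omega>\<bar> ^ n * cmod (gabor_coeff h \<phi> (x, \<omega>)) \<le> c * D n * inverse ((1 + \<bar>x\<bar>) ^ L)" for n x \<omega>
  proof -
    have dc: "continuous_on UNIV (d x n)"
      using d[of x] unfolding derivs_def
      by (intro continuous_at_imp_continuous_on ballI has_vector_derivative_continuous) auto
    have [measurable]: "d x n \<in> borel_measurable borel" by (rule borel_measurable_continuous_onI[OF dc])
    have b': "cmod (d x n u) \<le> (D n * inverse ((1 + \<bar>x\<bar>) ^ L)) * inverse ((1 + \<bar>u\<bar>)\<^sup>2)" for n u
      using b[of x n u] by (simp add: mult_ac)
    have "cmod (fourier (d x n) \<omega>) \<le> (LINT u|lborel. (D n * inverse ((1 + \<bar>x\<bar>) ^ L)) * inverse ((1 + \<bar>u\<bar>)\<^sup>2))"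
      unfolding fourier_def
    proof (rule Bochner_Integration.integral_norm_bound_integral)
      show bd: "cmod (d x n u * exp (- (\<i> * of_real (2 * pi * \<omega> * u)))) \<le> (D n * inverse ((1 + \<bar>x\<bar>) ^ L)) * inverse ((1 + \<bar>u\<bar>)\<^sup>2)" for u
        using b'[of n u] by (simp add: norm_mult)
      show i: "integrable lborel (\<lambda>u. (D n * inverse ((1 + \<bar>x\<bar>) ^ L)) * inverse ((1 + \<bar>u\<bar>)\<^sup>2))"
        using integrable_inverse_power2 by simp
      show "integrable lborel (\<lambda>u. d x n u * exp (- (\<i> * of_real (2 * pi * \<omega> * u))))"
        by (rule Bochner_Integration.integrable_bound[OF i])
          (use bd in \<open>auto intro!: AE_I2 intro: order.trans[OF _ abs_ge_self]\<close>)
    qed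
    also have "\<dots> = c * D n * inverse ((1 + \<bar>x\<bar>) ^ L)" by (simp add: c_def mult_ac)
    also have "fourier (d x n) \<omega> = (\<i> * of_real (2 * pi * \<omega>)) ^ n * gabor_coeff h \<phi> (x, \<omega>)"
      unfolding gabor_coeff_def using fourier_derivative[OF d b'] by simp
    finally have 1: "(2 * pi) ^ n * (\<bar>\<omega>\<bar> ^ n * cmod (gabor_coeff h \<phi> (x, \<omega>))) \<le> c * D n * inverse ((1 + \<bar>x\<bar>) ^ L)"
      by (simp add: norm_mult norm_power power_mult_distrib abs_mult mult.assoc)
    have "1 * (\<bar>\<omega>\<bar> ^ n * cmod (gabor_coeff h \<phi> (x, \<omega>))) \<le> (2 * pi) ^ n * (\<bar>\<omega>\<bar> ^ n * cmod (gabor_coeff h \<phi> (x, \<omega>)))"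
      using pi_ge_two by (intro mult_right_mono one_le_power) auto
    then show ?thesis using 1 by simp
  qed
  \<comment> \<open>The estimates for n = 0 and n = M are added, since (1 + |\<omega>|)^M is at most
    2^M times 1 + |\<omega>|^M.\<close>
  define E where "E = 2 ^ M * (c * D 0 + c * D M)"
  have "cmod (gabor_coeff h \<phi> (x, \<omega>)) \<le> E * (inverse ((1 + \<bar>x\<bar>) ^ L) * inverse ((1 + \<bar>\<omega>\<bar>) ^ M))" for x \<omega>
  proof -
    have "(1 + \<bar>\<omega>\<bar>) ^ M * cmod (gabor_coeff h \<phi> (x, \<omega>)) \<le> 2 ^ M * (1 + \<bar>\<omega>\<bar> ^ M) * cmod (gabor_coeff h \<phi> (x, \<omega>))"
      by (intro mult_right_mono one_plus_power_le) auto
    also have "\<dots> = 2 ^ M * (\<bar>\<omega>\<bar> ^ 0 * cmod (gabor_coeff h \<phi> (x, \<omega>)) + \<bar>\<omega>\<bar> ^ M * cmod (gabor_coeff h \<phi> (x, \<omega>)))"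
      by (simp add: algebra_simps)
    also have "\<dots> \<le> 2 ^ M * (c * D 0 * inverse ((1 + \<bar>x\<bar>) ^ L) + c * D M * inverse ((1 + \<bar>x\<bar>) ^ L))"
      by (intro mult_left_mono add_mono main) auto
    also have "\<dots> = E * inverse ((1 + \<bar>x\<bar>) ^ L)" by (simp add: E_def algebra_simps)
    finally have *: "(1 + \<bar>\<omega>\<bar>) ^ M * cmod (gabor_coeff h \<phi> (x, \<omega>)) \<le> E * inverse ((1 + \<bar>x\<bar>) ^ L)" .
    have "(1 + \<bar>\<omega>\<bar>) ^ M > 0" by (simp add: add_pos_nonneg)
    then have "cmod (gabor_coeff h \<phi> (x, \<omega>)) \<le> (E * inverse ((1 + \<bar>x\<bar>) ^ L)) / (1 + \<bar>\<omega>\<bar>) ^ M"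
      using * by (simp only: pos_le_divide_eq mult.commute)
    then show ?thesis by (simp only: divide_inverse mult.assoc)
  qed
  moreover have "E \<ge> 0" unfolding E_def using c D by (auto intro!: mult_nonneg_nonneg add_nonneg_nonneg)
  ultimately show ?thesis using that by blast
qed

lemma gabor_coeff_continuous:
  assumes \<phi>: "\<phi> \<in> schwartz" and h: "h \<in> schwartz"
  shows "continuous_on UNIV (gabor_coeff h \<phi>)"
  unfolding continuous_on_sequentially
proof (intro ballI allI impI, elim conjE)
  fix Z and z :: "real \<times> real" assume Z: "Z \<longlonglongrightarrow> z"
  obtain D where D: "\<And>t. cmod (nth_deriv 0 \<phi> t) \<le> D * inverse ((1 + \<bar>t\<bar>)\<^sup>2)"
    using schwartz_decay[OF \<phi>, of 2] by metis
  obtain H where H: "\<And>t. cmod (nth_deriv 0 h t) \<le> H * inverse ((1 + \<bar>t\<bar>) ^ 0)" "H > 0"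
    using schwartz_decay[OF h, of 0] by metis
  have c: "continuous_on UNIV \<phi>" "continuous_on UNIV h"
    using schwartz_continuous[OF \<phi>, of _ 0] schwartz_continuous[OF h, of _ 0] by auto
  have hc: "continuous_on UNIV (\<lambda>u. h (u - x))" for x
    by (rule continuous_on_compose2[OF c(2), of UNIV "\<lambda>u. u - x"]) (intro continuous_intros, simp)
  have meas: "(\<lambda>u. \<phi> u * cnj (h (u - x)) * exp (- (\<i> * of_real (2 * pi * \<omega> * u)))) \<in> borel_measurable lborel" for x \<omega>
    by (simp, rule borel_measurable_continuous_onI, intro continuous_intros c hc)
  have "(\<lambda>k. gabor_coeff h \<phi> (Z k)) \<longlonglongrightarrow> gabor_coeff h \<phi> z"
    unfolding gabor_coeff_def fourier_def
  proof (rule Bochner_Integration.integral_dominated_convergence[where w="\<lambda>t. D * H * inverse ((1 + \<bar>t\<bar>)\<^sup>2)"])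
    show "AE u in lborel. (\<lambda>k. \<phi> u * cnj (h (u - fst (Z k))) * exp (- (\<i> * of_real (2 * pi * snd (Z k) * u))))
      \<longlonglongrightarrow> \<phi> u * cnj (h (u - fst z)) * exp (- (\<i> * of_real (2 * pi * snd z * u)))"
    proof (intro AE_I2 tendsto_intros Z)
      fix u
      have "(\<lambda>k. u - fst (Z k)) \<longlonglongrightarrow> u - fst z" by (intro tendsto_intros Z)
      then show "(\<lambda>k. h (u - fst (Z k))) \<longlonglongrightarrow> h (u - fst z)"
        using continuous_on_tendsto_compose[OF c(2)] by simp
    qed
    show "AE u in lborel. cmod (\<phi> u * cnj (h (u - fst (Z k))) * exp (- (\<i> * of_real (2 * pi * snd (Z k) * u)))) \<le> D * H * inverse ((1 + \<bar>u\<bar>)\<^sup>2)" for k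
    proof (intro AE_I2)
      fix u
      have "cmod (\<phi> u) * cmod (h (u - fst (Z k))) \<le> (D * inverse ((1 + \<bar>u\<bar>)\<^sup>2)) * H"
        using D[of u] H(1)[of "u - fst (Z k)"]
        by (intro mult_mono) (auto intro: order.trans[OF norm_ge_zero])
      then show "cmod (\<phi> u * cnj (h (u - fst (Z k))) * exp (- (\<i> * of_real (2 * pi * snd (Z k) * u)))) \<le> D * H * inverse ((1 + \<bar>u\<bar>)\<^sup>2)"
        by (simp add: norm_mult mult_ac)
    qed
  qed (use integrable_inverse_power2 meas in simp_all)
  then show "(gabor_coeff h \<phi> \<circ> Z) \<longlonglongrightarrow> gabor_coeff h \<phi> z" by (simp add: o_def)
qed

text \<open>The product form gives integrability by Fubini's theorem. Powers of this function
  measure decay of kernels and powers of its inverse measure growth of weights, so the two can be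
  played off against each other by adding exponents.\<close>

definition plane_decay :: "real \<times> real \<Rightarrow> real" where
  "plane_decay z = inverse (1 + (fst z)\<^sup>2) * inverse (1 + (snd z)\<^sup>2)"

lemma plane_decay_nonneg: "0 \<le> plane_decay z" by (simp add: plane_decay_def)

lemma plane_decay_pos: "0 < plane_decay z"
  by (auto simp: plane_decay_def intro!: mult_pos_pos add_pos_nonneg)

lemma plane_decay_le_1: "plane_decay z \<le> 1"
  unfolding plane_decay_def by (intro mult_le_one) (auto intro!: inverse_le_1_iff[THEN iffD2])

lemma plane_decay_integrable: "integrable lborel plane_decay"
proof -
  let ?f = "\<lambda>(x::real, y::real). inverse (1 + x\<^sup>2) * inverse (1 + y\<^sup>2)"
  have "integrable (lborel \<Otimes>\<^sub>M lborel) ?f"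
  proof (rule lborel_pair.Fubini_integrable)
    show "integrable lborel (\<lambda>x. LINT y|lborel. norm (?f (x, y)))"
      using integrable_inverse_one_plus_square by (simp add: abs_mult)
  qed (use integrable_inverse_one_plus_square in auto)
  then show ?thesis by (simp add: lborel_prod plane_decay_def[abs_def] split_beta')
qed

lemma inverse_powers_le_plane_decay:
  "inverse ((1 + \<bar>x\<bar>)\<^sup>2) * inverse ((1 + \<bar>\<omega>\<bar>)\<^sup>2) \<le> plane_decay (x, \<omega>)"
  unfolding plane_decay_def by (auto intro!: mult_mono inverse_power2_le)

lemma gabor_expansion_family:
  assumes \<phi>: "\<phi> \<in> schwartz" and h: "h \<in> schwartz"
  shows "integrable_schwartz_family (\<lambda>n z t. gabor_coeff h \<phi> z * gabor h n z t) plane_decay"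
proof -
  have bound: "\<exists>D. \<forall>z t. (1 + \<bar>t\<bar>) ^ N * cmod (gabor_coeff h \<phi> z * gabor h n z t) \<le> D * plane_decay z" for n N
  proof -
    obtain D where D: "D \<ge> 0"
      "\<And>x \<omega> t. (1 + \<bar>t\<bar>) ^ N * cmod (gabor h n (x, \<omega>) t) \<le> D * ((1 + \<bar>\<omega>\<bar>) ^ n * (1 + \<bar>x\<bar>) ^ N)"
      using gabor_weighted_bound[OF h] by metis
    \<comment> \<open>The exponents N and n cancel the growth of the shifted window in x and
      \<omega>; the additional 2 in each variable leaves the integrable majorant.\<close>
    obtain E where E: "E \<ge> 0"
      "\<And>x \<omega>. cmod (gabor_coeff h \<phi> (x, \<omega>)) \<le> E * (inverse ((1 + \<bar>x\<bar>) ^ (N + 2)) * inverse ((1 + \<bar>\<omega>\<bar>) ^ (n + 2)))"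
      using gabor_coeff_decay[OF \<phi> h] by metis
    have "(1 + \<bar>t\<bar>) ^ N * cmod (gabor_coeff h \<phi> (x, \<omega>) * gabor h n (x, \<omega>) t) \<le> (E * D) * plane_decay (x, \<omega>)" for x \<omega> t
    proof -
      have "(1 + \<bar>t\<bar>) ^ N * cmod (gabor_coeff h \<phi> (x, \<omega>) * gabor h n (x, \<omega>) t)
        = cmod (gabor_coeff h \<phi> (x, \<omega>)) * ((1 + \<bar>t\<bar>) ^ N * cmod (gabor h n (x, \<omega>) t))"
        by (simp add: norm_mult)
      also have "\<dots> \<le> (E * (inverse ((1 + \<bar>x\<bar>) ^ (N + 2)) * inverse ((1 + \<bar>\<omega>\<bar>) ^ (n + 2)))) * (D * ((1 + \<bar>\<omega>\<bar>) ^ n * (1 + \<bar>x\<bar>) ^ N))"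
        using E(1) D(1) by (intro mult_mono E(2) D(2)) auto
      also have "\<dots> = (E * D) * (inverse ((1 + \<bar>x\<bar>)\<^sup>2) * inverse ((1 + \<bar>\<omega>\<bar>)\<^sup>2)) *
         ((inverse ((1 + \<bar>x\<bar>) ^ N) * (1 + \<bar>x\<bar>) ^ N) * (inverse ((1 + \<bar>\<omega>\<bar>) ^ n) * (1 + \<bar>\<omega>\<bar>) ^ n))"
        by (simp add: power_add power2_eq_square mult_ac)
      also have "inverse ((1 + \<bar>x\<bar>) ^ N) * (1 + \<bar>x\<bar>) ^ N = 1" by (intro left_inverse) (simp add: add_pos_nonneg)
      also have "inverse ((1 + \<bar>\<omega>\<bar>) ^ n) * (1 + \<bar>\<omega>\<bar>) ^ n = 1" by (intro left_inverse) (simp add: add_pos_nonneg)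
      also have "(E * D) * (inverse ((1 + \<bar>x\<bar>)\<^sup>2) * inverse ((1 + \<bar>\<omega>\<bar>)\<^sup>2)) * (1 * 1) \<le> (E * D) * plane_decay (x, \<omega>)"
        using E(1) D(1) inverse_powers_le_plane_decay by (auto intro!: mult_left_mono)
      finally show ?thesis .
    qed
    then show ?thesis by (auto intro!: exI[of _ "E * D"])
  qed
  show ?thesis
  proof
    fix z show "derivs (\<lambda>t. gabor_coeff h \<phi> z * gabor h 0 z t) (\<lambda>n t. gabor_coeff h \<phi> z * gabor h n z t)"
      by (rule derivs_cmult[OF gabor_derivs[OF h]])
  next
    fix n
    have "continuous_on UNIV (\<lambda>p :: (real \<times> real) \<times> real. gabor_coeff h \<phi> (fst p))"
      by (rule continuous_on_compose2[OF gabor_coeff_continuous[OF \<phi> h]]) (auto intro!: continuous_intros)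
    then show "continuous_on UNIV (\<lambda>(z, t). gabor_coeff h \<phi> z * gabor h n z t)"
      using gabor_continuous[OF h, of n] unfolding split_beta' by (rule continuous_on_mult)
  next
    fix Q :: "(real \<times> real) set" and n N
    obtain D where D: "\<And>z t. (1 + \<bar>t\<bar>) ^ N * cmod (gabor_coeff h \<phi> z * gabor h n z t) \<le> D * plane_decay z"
      using bound by blast
    have "(1 + \<bar>t\<bar>) ^ N * cmod (gabor_coeff h \<phi> z * gabor h n z t) \<le> \<bar>D\<bar>" for z t
    proof -
      have "D * plane_decay z \<le> \<bar>D\<bar> * 1"
        using plane_decay_le_1[of z] plane_decay_nonneg[of z] by (intro mult_mono) auto
      then show ?thesis using D[of t z] by linarith
    qed
    then show "\<exists>D. \<forall>z\<in>Q. \<forall>t. (1 + \<bar>t\<bar>) ^ N * cmod (gabor_coeff h \<phi> z * gabor h n z t) \<le> D" by blast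
  qed (use bound plane_decay_nonneg plane_decay_integrable in auto)
qed

section \<open>Inversion of the short time Fourier transform\<close>

definition l2_square :: "(real \<Rightarrow> complex) \<Rightarrow> real" where
  "l2_square h = (LINT t|lborel. (cmod (h t))\<^sup>2)"

lemma schwartz_integrable:
  assumes "h \<in> schwartz" shows "integrable lborel h" "integrable lborel (\<lambda>t. (cmod (h t))\<^sup>2)"
proof -
  have [measurable]: "h \<in> borel_measurable borel"
    using schwartz_continuous[OF assms, of UNIV 0] by (simp add: borel_measurable_continuous_onI)
  obtain D where D: "D > 0" "\<And>t. cmod (h t) \<le> D * inverse ((1 + \<bar>t\<bar>)\<^sup>2)"
    using schwartz_decay[OF assms, of 2] by (metis nth_deriv_0)
  have "integrable lborel (\<lambda>t. D * inverse ((1 + \<bar>t\<bar>)\<^sup>2))" using integrable_inverse_power2 by simp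
  then show "integrable lborel h"
    by (rule Bochner_Integration.integrable_bound) (use D(2) in \<open>auto intro!: AE_I2 intro: order.trans[OF _ abs_ge_self]\<close>)
  have "integrable lborel (\<lambda>t. D * (D * inverse ((1 + \<bar>t\<bar>)\<^sup>2)))" using integrable_inverse_power2 by simp
  then show "integrable lborel (\<lambda>t. (cmod (h t))\<^sup>2)"
  proof (rule Bochner_Integration.integrable_bound)
    have "(cmod (h t))\<^sup>2 \<le> D * (D * inverse ((1 + \<bar>t\<bar>)\<^sup>2))" for t
    proof -
      have "inverse ((1 + \<bar>t\<bar>)\<^sup>2) \<le> 1" by (auto intro!: inverse_le_1_iff[THEN iffD2])
      then have "D * inverse ((1 + \<bar>t\<bar>)\<^sup>2) \<le> D" using D(1) by simp
      from order.trans[OF D(2) this] D(1) show ?thesis unfolding power2_eq_square[of "cmod (h t)"]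
        by (intro mult_mono D(2)) auto
    qed
    then show "AE t in lborel. norm ((cmod (h t))\<^sup>2) \<le> norm (D * (D * inverse ((1 + \<bar>t\<bar>)\<^sup>2)))"
      by (intro AE_I2) (auto intro: order.trans[OF _ abs_ge_self])
  qed simp
qed

text \<open>If the integral vanished, the set where h is nonzero would be null. By continuity it is
  open, so it would contain an interval of positive length.\<close>

lemma l2_square_pos:
  assumes h: "h \<in> schwartz" and "h \<noteq> (\<lambda>_. 0)" shows "l2_square h > 0"
proof (rule ccontr)
  assume "\<not> ?thesis"
  moreover have "l2_square h \<ge> 0" unfolding l2_square_def by (intro Bochner_Integration.integral_nonneg) auto
  ultimately have "l2_square h = 0" by linarith
  then have "(LINT t|lborel. (cmod (h t))\<^sup>2) = 0" by (simp only: l2_square_def)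
  then have ae: "AE t in lborel. (cmod (h t))\<^sup>2 = 0"
    using integral_nonneg_eq_0_iff_AE[OF schwartz_integrable(2)[OF h]] by auto
  have "continuous_on UNIV h" using schwartz_continuous[OF h, of UNIV 0] by simp
  then have "open (h -` (- {0}))" using open_vimage[of "- {0}" h] by (simp add: open_Compl)
  moreover have "h -` (- {0}) \<in> null_sets lborel"
  proof -
    have "AE t in lborel. t \<notin> h -` (- {0})" using ae by eventually_elim simp
    then show ?thesis using \<open>open (h -` (- {0}))\<close> by (simp add: AE_iff_null_sets)
  qed
  moreover obtain t where "t \<in> h -` (- {0})" using assms(2) by (auto simp: fun_eq_iff)
  ultimately obtain e where "e > 0" "cball t e \<subseteq> h -` (- {0})" and null: "h -` (- {0}) \<in> null_sets lborel"
    using open_contains_cball by metis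
  then have "emeasure lborel {t - e..t + e} = 0"
    using null_sets_subset[OF null, of "{t - e..t + e}"] by (auto simp: cball_eq_atLeastAtMost)
  then show False using \<open>e > 0\<close> by simp
qed

text \<open>For fixed x the integral over \<omega> is Fourier inversion at t of u -> \<phi>(u)
  cnj(h(u - x)), multiplied by h(t - x); this equals \<phi>(t) |h(t - x)|^2. Integration over x then
  yields the squared norm of h.\<close>

lemma gabor_expansion:
  assumes \<phi>: "\<phi> \<in> schwartz" and h: "h \<in> schwartz"
  shows "(LINT z|lborel. gabor_coeff h \<phi> z * gabor h 0 z t) = of_real (l2_square h) * \<phi> t"
proof -
  interpret integrable_schwartz_family "\<lambda>n z t. gabor_coeff h \<phi> z * gabor h n z t" plane_decay
    by (rule gabor_expansion_family[OF \<phi> h])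
  have int: "integrable (lborel \<Otimes>\<^sub>M lborel) (\<lambda>(x, \<omega>). gabor_coeff h \<phi> (x, \<omega>) * gabor h 0 (x, \<omega>) t)"
    using family_section_integrable[of 0 t] by (simp add: lborel_prod split_beta')
  have c: "continuous_on UNIV \<phi>" "continuous_on UNIV h"
    using schwartz_continuous[OF \<phi>, of _ 0] schwartz_continuous[OF h, of _ 0] by auto
  have inner: "(LINT \<omega>|lborel. gabor_coeff h \<phi> (x, \<omega>) * gabor h 0 (x, \<omega>) t) = \<phi> t * of_real ((cmod (h (t - x)))\<^sup>2)" for x
  proof -
    define \<psi> where "\<psi> u = \<phi> u * cnj (h (u - x))" for u
    have \<psi>f: "gabor_coeff h \<phi> (x, \<omega>) = fourier \<psi> \<omega>" for \<omega> by (simp add: gabor_coeff_def \<psi>_def[abs_def])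
    obtain d D where d: "\<And>x. derivs (\<lambda>u. \<phi> u * cnj (h (u - x))) (d x)" "\<And>n. D n \<ge> 0"
      and b: "\<And>x n u. cmod (d x n u) \<le> D n * (inverse ((1 + \<bar>u\<bar>)\<^sup>2) * inverse ((1 + \<bar>x\<bar>) ^ 0))"
      by (rule schwartz_product_decay[OF \<phi> h, of 0], rule that)
    have d0: "d x 0 = \<psi>" using d(1)[of x] by (simp add: derivs_def \<psi>_def[abs_def])
    have \<psi>b: "cmod (\<psi> u) \<le> D 0 * inverse ((1 + \<bar>u\<bar>)\<^sup>2)" for u using b[of x 0 u] by (simp add: d0)
    have \<psi>c: "continuous_on UNIV \<psi>"
      unfolding \<psi>_def
      by (intro continuous_intros c continuous_on_compose2[OF c(2)]) simp
    have \<psi>i: "integrable lborel \<psi>"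
      by (rule Bochner_Integration.integrable_bound[of lborel "\<lambda>u. D 0 * inverse ((1 + \<bar>u\<bar>)\<^sup>2)"])
        (use \<psi>b integrable_inverse_power2 borel_measurable_continuous_onI[OF \<psi>c] in \<open>auto intro!: AE_I2 intro: order.trans[OF _ abs_ge_self]\<close>)
    have \<psi>b': "cmod (\<psi> u) \<le> D 0" for u
    proof -
      have "inverse ((1 + \<bar>u\<bar>)\<^sup>2) \<le> 1" by (auto intro!: inverse_le_1_iff[THEN iffD2])
      then have "D 0 * inverse ((1 + \<bar>u\<bar>)\<^sup>2) \<le> D 0" using d(2)[of 0] mult_left_mono by fastforce
      then show ?thesis using \<psi>b[of u] by simp
    qed
    obtain E where E: "E \<ge> 0"
      "\<And>x \<omega>. cmod (gabor_coeff h \<phi> (x, \<omega>)) \<le> E * (inverse ((1 + \<bar>x\<bar>) ^ 0) * inverse ((1 + \<bar>\<omega>\<bar>)\<^sup>2))"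
      using gabor_coeff_decay[OF \<phi> h] by metis
    have fc: "continuous_on UNIV (fourier \<psi>)"
      using continuous_on_compose2[OF gabor_coeff_continuous[OF \<phi> h], of UNIV "\<lambda>\<omega>. (x, \<omega>)"]
      by (simp add: \<psi>f continuous_intros)
    have fi: "integrable lborel (fourier \<psi>)"
      by (rule Bochner_Integration.integrable_bound[of lborel "\<lambda>u. E * inverse ((1 + \<bar>u\<bar>)\<^sup>2)"])
        (use E(2)[of x] integrable_inverse_power2 borel_measurable_continuous_onI[OF fc] in \<open>auto simp: \<psi>f intro!: AE_I2 intro: order.trans[OF _ abs_ge_self]\<close>)
    have "(LINT \<omega>|lborel. gabor_coeff h \<phi> (x, \<omega>) * gabor h 0 (x, \<omega>) t)
      = (LINT \<omega>|lborel. (fourier \<psi> \<omega> * exp (\<i> * of_real (2 * pi * \<omega> * t))) * h (t - x))"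
      by (simp add: \<psi>f gabor_0 modulate_def translate_def mult.assoc)
    also have "\<dots> = \<psi> t * h (t - x)"
      unfolding integral_mult_left_zero using fourier_inversion[OF \<psi>c \<psi>i \<psi>b' fi, of t] by simp
    also have "\<dots> = \<phi> t * of_real ((cmod (h (t - x)))\<^sup>2)"
      unfolding complex_norm_square by (simp add: \<psi>_def mult_ac)
    finally show ?thesis .
  qed
  have "(LINT z|lborel. gabor_coeff h \<phi> z * gabor h 0 z t)
    = (LINT x|lborel. LINT \<omega>|lborel. gabor_coeff h \<phi> (x, \<omega>) * gabor h 0 (x, \<omega>) t)"
    using lborel_pair.integral_fst'[OF int] by (simp add: lborel_prod split_beta')
  also have "\<dots> = \<phi> t * (LINT x|lborel. of_real ((cmod (h (t - x)))\<^sup>2))"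
    unfolding inner by simp
  also have "(LINT x|lborel. of_real ((cmod (h (t - x)))\<^sup>2)) = complex_of_real (LINT x|lborel. (cmod (h (t - x)))\<^sup>2)"
    by (rule integral_complex_of_real)
  also have "(LINT x|lborel. (cmod (h (t - x)))\<^sup>2) = l2_square h"
    unfolding l2_square_def
    by (subst (2) lborel_integral_real_affine[of "-1" _ t]) simp_all
  finally show ?thesis by (simp add: mult.commute)
qed

theorem tempered_gabor_expansion:
  assumes \<Lambda>: "\<Lambda> \<in> tempered_distributions" and \<phi>: "\<phi> \<in> schwartz" and h: "h \<in> schwartz"
  shows "integrable lborel (\<lambda>z. gabor_coeff h \<phi> z * \<Lambda> (gabor h 0 z))"
    and "of_real (l2_square h) * \<Lambda> \<phi> = (LINT z|lborel. gabor_coeff h \<phi> z * \<Lambda> (gabor h 0 z))"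
proof -
  interpret integrable_schwartz_family "\<lambda>n z t. gabor_coeff h \<phi> z * gabor h n z t" plane_decay
    by (rule gabor_expansion_family[OF \<phi> h])
  show "integrable lborel (\<lambda>z. gabor_coeff h \<phi> z * \<Lambda> (gabor h 0 z))"
    using tempered_family_integrable[OF \<Lambda>] by (simp add: tempered_cmult[OF \<Lambda>])
  have "total 0 = (\<lambda>t. of_real (l2_square h) * \<phi> t)"
    unfolding total_def by (simp add: gabor_expansion[OF \<phi> h] fun_eq_iff)
  then show "of_real (l2_square h) * \<Lambda> \<phi> = (LINT z|lborel. gabor_coeff h \<phi> z * \<Lambda> (gabor h 0 z))"
    using tempered_integral[OF \<Lambda>] by (simp add: tempered_cmult[OF \<Lambda>])
qed

section \<open>Weighted convolution bounds on the time-frequency plane\<close>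

text \<open>One family of affine maps containing the translations, the shears caused by chirps and
  the reflection of the frequency axis, so that invariance of the measure is proved once, for |e| =
  1.\<close>

definition plane_map :: "real \<Rightarrow> real \<Rightarrow> real \<Rightarrow> real \<Rightarrow> real \<times> real \<Rightarrow> real \<times> real" where
  "plane_map a b c e z = (a + fst z, b + c * fst z + e * snd z)"

lemma plane_map_measurable [measurable]: "plane_map a b c e \<in> borel \<rightarrow>\<^sub>M borel"
  unfolding plane_map_def[abs_def] by (intro borel_measurable_continuous_onI continuous_intros)

lemma nn_integral_plane_map:
  fixes f :: "real \<times> real \<Rightarrow> ennreal"
  assumes f: "f \<in> borel_measurable borel" and e: "\<bar>e\<bar> = 1"
  shows "(\<integral>\<^sup>+z. f (plane_map a b c e z) \<partial>lborel) = (\<integral>\<^sup>+z. f z \<partial>lborel)"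
proof -
  have "e \<noteq> 0" using e by auto
  have sec: "(\<lambda>y. f (x, y)) \<in> borel_measurable borel" for x
    using f by (rule measurable_compose[rotated]) (intro borel_measurable_continuous_onI continuous_intros)
  have f': "f \<in> borel_measurable (lborel \<Otimes>\<^sub>M lborel)" using f by (simp add: lborel_prod)
  have fT: "(\<lambda>z. f (plane_map a b c e z)) \<in> borel_measurable (lborel \<Otimes>\<^sub>M lborel)"
    using measurable_compose[OF plane_map_measurable f] by (simp add: lborel_prod)
  have G: "(\<lambda>x. \<integral>\<^sup>+y. f (x, y) \<partial>lborel) \<in> borel_measurable borel"
    using lborel.borel_measurable_nn_integral_fst[OF f'] by simp
  have inner: "(\<integral>\<^sup>+y. f (plane_map a b c e (x, y)) \<partial>lborel) = (\<integral>\<^sup>+y. f (a + x, y) \<partial>lborel)" for x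
    using nn_integral_real_affine[OF sec \<open>e \<noteq> 0\<close>, of "a + x" "b + c * x"] e
    by (simp add: plane_map_def)
  have "(\<integral>\<^sup>+z. f (plane_map a b c e z) \<partial>lborel)
    = (\<integral>\<^sup>+x. \<integral>\<^sup>+y. f (plane_map a b c e (x, y)) \<partial>lborel \<partial>lborel)"
    using lborel.nn_integral_fst[OF fT] by (simp add: lborel_prod)
  also have "\<dots> = (\<integral>\<^sup>+x. \<integral>\<^sup>+y. f (a + x, y) \<partial>lborel \<partial>lborel)" by (simp add: inner)
  also have "\<dots> = (\<integral>\<^sup>+x. \<integral>\<^sup>+y. f (x, y) \<partial>lborel \<partial>lborel)"
    using nn_integral_real_affine[OF G, of 1 a] by simp
  also have "\<dots> = (\<integral>\<^sup>+z. f z \<partial>lborel)"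
    using lborel.nn_integral_fst[OF f'] by (simp add: lborel_prod)
  finally show ?thesis .
qed

lemma lborel_plane_map:
  assumes e: "\<bar>e\<bar> = 1" shows "distr lborel lborel (plane_map a b c e) = lborel"
proof (rule measure_eqI)
  fix A assume "A \<in> sets (distr lborel lborel (plane_map a b c e))"
  then have A: "A \<in> sets borel" by simp
  have "emeasure (distr lborel lborel (plane_map a b c e)) A
    = (\<integral>\<^sup>+z. indicator A z \<partial>distr lborel lborel (plane_map a b c e))"
    using A by simp
  also have "\<dots> = (\<integral>\<^sup>+z. indicator A (plane_map a b c e z) \<partial>lborel)"
    using A by (intro nn_integral_distr) auto
  also have "\<dots> = (\<integral>\<^sup>+z. indicator A z \<partial>lborel)"
    using A by (intro nn_integral_plane_map e) auto
  finally show "emeasure (distr lborel lborel (plane_map a b c e)) A = emeasure lborel A"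
    using A by simp
qed simp

text \<open>Integrands with a weight are only Lebesgue measurable, so invariance is carried over to
  the completion. Preimages of null sets are null because the image of the measure is
  \<open>lborel\<close> itself.\<close>

lemma
  assumes e: "\<bar>e\<bar> = 1"
  shows lebesgue_plane_map_measurable: "plane_map a b c e \<in> lebesgue \<rightarrow>\<^sub>M lebesgue"
    and lebesgue_plane_map: "distr lebesgue lebesgue (plane_map a b c e) = lebesgue"
proof -
  have m: "plane_map a b c e \<in> lborel \<rightarrow>\<^sub>M lborel" by simp
  have eq: "distr lebesgue lborel (plane_map a b c e) = lborel"
    using distr_completion[OF m] lborel_plane_map[OF e] by simp
  have m': "plane_map a b c e \<in> lebesgue \<rightarrow>\<^sub>M lborel" by (rule measurable_completion[OF m])
  show "plane_map a b c e \<in> lebesgue \<rightarrow>\<^sub>M lebesgue"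
    by (rule completion.measurable_completion2[OF m']) (simp add: eq)
  show "distr lebesgue lebesgue (plane_map a b c e) = lebesgue"
    using completion.completion_distr_eq[OF m'] eq by simp
qed

lemma integrable_lebesgue_plane_map:
  fixes H :: "real \<times> real \<Rightarrow> real"
  assumes e: "\<bar>e\<bar> = 1" and H: "H \<in> borel_measurable lebesgue"
  shows "integrable lebesgue (\<lambda>z. H (plane_map a b c e z)) \<longleftrightarrow> integrable lebesgue H"
  using integrable_distr_eq[OF lebesgue_plane_map_measurable[OF e, of a b c] H]
  by (simp add: lebesgue_plane_map[OF e])

section \<open>Young's convolution inequality for weighted spaces\<close>

text \<open>By convexity the graph of x -> \<open>x powr r\<close> lies above its tangent at a.
  Unlike Hoelder's inequality, this linear form can be integrated without a conjugate exponent,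
  which would degenerate at r = 1.\<close>

lemma young_powr:
  fixes a x r :: real
  assumes "1 \<le> r" "0 < a" "0 \<le> x"
  shows "r * a powr (r - 1) * x \<le> x powr r + (r - 1) * a powr r"
proof (cases "x = 0")
  case True
  then show ?thesis using assms by simp
next
  case False
  then have x: "x > 0" using assms by simp
  have "(x powr r) powr (1 / r) * (a powr r) powr (1 - 1 / r) \<le> 1 / r * x powr r + (1 - 1 / r) * a powr r"
    using assms x by (intro Youngs_inequality_0) auto
  also have "(x powr r) powr (1 / r) = x" using assms x by (simp add: powr_powr)
  also have "(a powr r) powr (1 - 1 / r) = a powr (r - 1)"
    using assms by (simp add: powr_powr right_diff_distrib)
  finally have "r * (x * a powr (r - 1)) \<le> r * (1 / r * x powr r + (1 - 1 / r) * a powr r)"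
    using assms by (intro mult_left_mono) auto
  also have "\<dots> = x powr r + (r - 1) * a powr r" using assms by (simp add: field_simps)
  finally show ?thesis by (simp add: mult_ac)
qed

text \<open>Jensen's inequality, obtained by integrating Young's inequality at \<open>a\<close> and \<open>L F\<close>.\<close>

lemma nn_integral_powr_bound:
  fixes K F :: "'b \<Rightarrow> real"
  assumes [measurable]: "K \<in> borel_measurable M" "F \<in> borel_measurable M"
    and K: "\<And>y. 0 \<le> K y" and F: "\<And>y. 0 \<le> F y" and L: "(\<integral>\<^sup>+y. K y \<partial>M) \<le> ennreal L" "L > 0"
    and a: "0 \<le> a" "ennreal a \<le> (\<integral>\<^sup>+y. ennreal (K y * F y) \<partial>M)" and r: "1 \<le> r"
  shows "ennreal (a powr r) \<le> ennreal (L powr (r - 1)) * (\<integral>\<^sup>+y. ennreal (K y * F y powr r) \<partial>M)"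
proof (cases "a = 0 \<or> (\<integral>\<^sup>+y. ennreal (K y * F y powr r) \<partial>M) = \<infinity>")
  case True
  then show ?thesis using L by (auto simp: ennreal_mult_top)
next
  case False
  then have a0: "a > 0" using a by simp
  obtain J where J: "J \<ge> 0" "(\<integral>\<^sup>+y. ennreal (K y * F y powr r) \<partial>M) = ennreal J"
    using False by (cases "\<integral>\<^sup>+y. ennreal (K y * F y powr r) \<partial>M") auto
  have "ennreal (r * a powr (r - 1) * L * a) = ennreal (r * a powr (r - 1) * L) * ennreal a"
    using r L a0 by (intro ennreal_mult) auto
  also have "\<dots> \<le> ennreal (r * a powr (r - 1) * L) * (\<integral>\<^sup>+y. ennreal (K y * F y) \<partial>M)"
    by (intro mult_left_mono a) auto
  also have "\<dots> = (\<integral>\<^sup>+y. ennreal (r * a powr (r - 1) * L) * ennreal (K y * F y) \<partial>M)"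
    by (intro nn_integral_cmult[symmetric]) auto
  also have "\<dots> \<le> (\<integral>\<^sup>+y. ennreal (L powr r) * ennreal (K y * F y powr r) + ennreal ((r - 1) * a powr r) * ennreal (K y) \<partial>M)"
  proof (intro nn_integral_mono)
    fix y
    \<comment> \<open>The scaling by L matches the total mass of K, which is at most L: after
      integration the last term is at most (r - 1) L \<open>a powr r\<close> and can be subtracted
      from r L \<open>a powr r\<close> on the left.\<close>
    have "r * a powr (r - 1) * (L * F y) \<le> (L * F y) powr r + (r - 1) * a powr r"
      using F[of y] L r a0 by (intro young_powr) auto
    then have "K y * (r * a powr (r - 1) * (L * F y)) \<le> K y * ((L * F y) powr r + (r - 1) * a powr r)"
      by (intro mult_left_mono K)
    then have "r * a powr (r - 1) * L * (K y * F y) \<le> L powr r * (K y * F y powr r) + (r - 1) * a powr r * K y"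
      using L F[of y] by (simp add: powr_mult algebra_simps)
    then have "ennreal (r * a powr (r - 1) * L * (K y * F y))
      \<le> ennreal (L powr r * (K y * F y powr r) + (r - 1) * a powr r * K y)"
      by (rule ennreal_leI)
    then show "ennreal (r * a powr (r - 1) * L) * ennreal (K y * F y)
      \<le> ennreal (L powr r) * ennreal (K y * F y powr r) + ennreal ((r - 1) * a powr r) * ennreal (K y)"
      using K[of y] F[of y] r L by (simp add: ennreal_mult[symmetric] ennreal_plus[symmetric] del: ennreal_plus)
  qed
  also have "\<dots> = ennreal (L powr r) * ennreal J + ennreal ((r - 1) * a powr r) * (\<integral>\<^sup>+y. K y \<partial>M)"
    by (simp add: nn_integral_add nn_integral_cmult J(2)[symmetric])
  also have "\<dots> \<le> ennreal (L powr r) * ennreal J + ennreal ((r - 1) * a powr r) * ennreal L"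
    by (intro add_left_mono mult_left_mono L) auto
  also have "\<dots> = ennreal (L powr r * J + (r - 1) * a powr r * L)"
    using J(1) L r by (simp add: ennreal_mult[symmetric] ennreal_plus[symmetric] del: ennreal_plus)
  finally have "r * a powr (r - 1) * L * a \<le> L powr r * J + (r - 1) * a powr r * L"
    using J(1) L r by (subst (asm) ennreal_le_iff) auto
  moreover have "r * a powr (r - 1) * L * a = r * L * a powr r" using a0 by (simp add: powr_diff)
  moreover have "L powr r * J = L * (L powr (r - 1) * J)" using L by (simp add: powr_diff)
  ultimately have "r * L * a powr r \<le> L * (L powr (r - 1) * J) + (r - 1) * a powr r * L" by linarith
  then have "L * a powr r \<le> L * (L powr (r - 1) * J)" by (simp add: algebra_simps)
  then have "a powr r \<le> L powr (r - 1) * J" using L by simp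
  then show ?thesis using J by (simp add: ennreal_mult[symmetric] ennreal_leI)
qed

text \<open>Jensen's inequality for the measure with density K is applied for each z. The weight is
  then moved from z to z + y at the cost of \<Omega>(y), and Tonelli's theorem with translation
  invariance separates the double integral into a product of two finite ones.\<close>

lemma weighted_convolution_bound:
  fixes F G W K \<Omega> :: "real \<times> real \<Rightarrow> real"
  assumes [measurable]: "F \<in> borel_measurable borel" "G \<in> borel_measurable borel"
      "W \<in> borel_measurable borel" "K \<in> borel_measurable borel" "\<Omega> \<in> borel_measurable borel"
    and nonneg: "\<And>z. 0 \<le> F z" "\<And>z. 0 \<le> G z" "\<And>z. 0 \<le> W z" "\<And>z. 0 \<le> K z" "\<And>z. 0 \<le> \<Omega> z"
    and conv: "\<And>z. ennreal (G z) \<le> (\<integral>\<^sup>+y. ennreal (K y * F (z + y)) \<partial>lborel)"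
    and W: "\<And>z y. W z \<le> \<Omega> y * W (z + y)" and r: "1 \<le> r"
    and L: "(\<integral>\<^sup>+y. ennreal (K y) \<partial>lborel) < \<infinity>" and KO: "(\<integral>\<^sup>+y. ennreal (K y * \<Omega> y powr r) \<partial>lborel) < \<infinity>"
    and fin: "(\<integral>\<^sup>+z. ennreal (F z powr r * W z powr r) \<partial>lborel) < \<infinity>"
  shows "(\<integral>\<^sup>+z. ennreal (G z powr r * W z powr r) \<partial>lborel) < \<infinity>"
proof -
  have sh[measurable]: "(\<lambda>y. F (z + y)) \<in> borel_measurable borel" for z
    by measurable
  obtain L0 where L0: "(\<integral>\<^sup>+y. ennreal (K y) \<partial>lborel) = ennreal L0" "L0 \<ge> 0"
    using L by (cases "\<integral>\<^sup>+y. ennreal (K y) \<partial>lborel") auto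
  \<comment> \<open>The mass of K may be 0, while the Jensen estimate requires a strictly positive
    bound.\<close>
  define l where "l = L0 + 1"
  have l: "(\<integral>\<^sup>+y. ennreal (K y) \<partial>lborel) \<le> ennreal l" "l > 0"
    using L0 by (auto simp: l_def)
  define c where "c = ennreal (l powr (r - 1))"
  define H where "H z = ennreal (F z powr r * W z powr r)" for z
  have [measurable]: "H \<in> borel_measurable borel" unfolding H_def by measurable
  have point: "ennreal (G z powr r * W z powr r)
    \<le> (\<integral>\<^sup>+y. c * (ennreal (K y * \<Omega> y powr r) * H (z + y)) \<partial>lborel)" for z
  proof -
    have "ennreal (G z powr r * W z powr r) = ennreal (G z powr r) * ennreal (W z powr r)"
      by (intro ennreal_mult) auto
    also have "\<dots> \<le> (c * (\<integral>\<^sup>+y. ennreal (K y * F (z + y) powr r) \<partial>lborel)) * ennreal (W z powr r)"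
      unfolding c_def by (intro mult_right_mono nn_integral_powr_bound l conv r nonneg) auto
    also have "\<dots> = (\<integral>\<^sup>+y. c * (ennreal (K y * F (z + y) powr r) * ennreal (W z powr r)) \<partial>lborel)"
      by (simp add: nn_integral_cmult nn_integral_multc mult.assoc)
    also have "\<dots> \<le> (\<integral>\<^sup>+y. c * (ennreal (K y * \<Omega> y powr r) * H (z + y)) \<partial>lborel)"
    proof (intro nn_integral_mono mult_left_mono)
      fix y
      have "W z powr r \<le> (\<Omega> y * W (z + y)) powr r"
        using W[of z y] nonneg r by (intro powr_mono2) auto
      also have "\<dots> = \<Omega> y powr r * W (z + y) powr r" using nonneg by (simp add: powr_mult)
      finally have "K y * F (z + y) powr r * W z powr r \<le> K y * F (z + y) powr r * (\<Omega> y powr r * W (z + y) powr r)"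
        using nonneg by (intro mult_left_mono) auto
      then have "ennreal (K y * F (z + y) powr r * W z powr r)
        \<le> ennreal ((K y * \<Omega> y powr r) * (F (z + y) powr r * W (z + y) powr r))"
        by (intro ennreal_leI) (simp add: mult_ac)
      then show "ennreal (K y * F (z + y) powr r) * ennreal (W z powr r) \<le> ennreal (K y * \<Omega> y powr r) * H (z + y)"
        using nonneg by (simp add: H_def ennreal_mult)
    qed auto
    finally show ?thesis .
  qed
  have "(\<integral>\<^sup>+z. ennreal (G z powr r * W z powr r) \<partial>lborel)
    \<le> (\<integral>\<^sup>+z. \<integral>\<^sup>+y. c * (ennreal (K y * \<Omega> y powr r) * H (z + y)) \<partial>lborel \<partial>lborel)"
    by (intro nn_integral_mono point)
  also have "\<dots> = (\<integral>\<^sup>+y. \<integral>\<^sup>+z. c * (ennreal (K y * \<Omega> y powr r) * H (z + y)) \<partial>lborel \<partial>lborel)"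
    by (rule lborel_pair.Fubini'[symmetric]) measurable
  also have "\<dots> = (\<integral>\<^sup>+y. c * (ennreal (K y * \<Omega> y powr r) * (\<integral>\<^sup>+z. H z \<partial>lborel)) \<partial>lborel)"
  proof (intro nn_integral_cong)
    fix y :: "real \<times> real"
    have "(\<lambda>z. H (z + y)) = (\<lambda>z. H (plane_map (fst y) (snd y) 0 1 z))"
      by (cases y) (auto simp: plane_map_def fun_eq_iff add.commute)
    then have "(\<integral>\<^sup>+z. H (z + y) \<partial>lborel) = (\<integral>\<^sup>+z. H z \<partial>lborel)"
      using nn_integral_plane_map[of H 1] by simp
    then show "(\<integral>\<^sup>+z. c * (ennreal (K y * \<Omega> y powr r) * H (z + y)) \<partial>lborel)
      = c * (ennreal (K y * \<Omega> y powr r) * (\<integral>\<^sup>+z. H z \<partial>lborel))"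
      by (simp add: nn_integral_cmult)
  qed
  also have "\<dots> = c * ((\<integral>\<^sup>+y. ennreal (K y * \<Omega> y powr r) \<partial>lborel) * (\<integral>\<^sup>+z. H z \<partial>lborel))"
    by (simp add: nn_integral_cmult nn_integral_multc)
  also have "\<dots> < \<infinity>"
    using KO fin unfolding H_def c_def by (auto simp: ennreal_mult_less_top)
  finally show ?thesis .
qed

section \<open>Pointwise comparison of two windows\<close>

text \<open>The pairing conjugates its second argument, which conjugates the window and reverses the
  sign of the frequency. This sign is the source of the frequency reflections further on.\<close>

lemma stft_gabor: "stft g \<Lambda> x \<omega> = \<Lambda> (gabor (\<lambda>t. cnj (g t)) 0 (x, - \<omega>))"
  unfolding stft_def pairing_def gabor_0
  by (intro arg_cong[where f=\<Lambda>]) (auto simp: modulate_def translate_def fun_eq_iff exp_cnj)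

lemma tempered_gabor_continuous:
  assumes "\<Lambda> \<in> tempered_distributions" "h \<in> schwartz"
  shows "continuous_on UNIV (\<lambda>z. \<Lambda> (gabor h 0 z))"
  by (rule schwartz_family.tempered_family_continuous[OF gabor_family assms(1)]) fact

lemma stft_continuous:
  assumes "\<Lambda> \<in> tempered_distributions" "g \<in> schwartz"
  shows "continuous_on UNIV (\<lambda>z. stft g \<Lambda> (fst z) (snd z))"
  unfolding stft_gabor
  by (rule continuous_on_compose2[OF tempered_gabor_continuous[OF assms(1) schwartz_cnj[OF assms(2)]]])
    (auto intro!: continuous_intros)

lemma stft_measurable:
  assumes "\<Lambda> \<in> tempered_distributions" "g \<in> schwartz"
  shows "(\<lambda>z. cmod (stft g \<Lambda> (fst z) (snd z))) \<in> borel_measurable borel"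
  by (intro borel_measurable_continuous_onI continuous_intros stft_continuous assms)

lemma gabor_coeff_plane_decay:
  assumes \<phi>: "\<phi> \<in> schwartz" and h: "h \<in> schwartz"
  obtains D where "D \<ge> 0" "\<And>z. cmod (gabor_coeff h \<phi> z) \<le> D * plane_decay z ^ P"
proof -
  obtain D where D: "D \<ge> 0"
    "\<And>x \<omega>. cmod (gabor_coeff h \<phi> (x, \<omega>)) \<le> D * (inverse ((1 + \<bar>x\<bar>) ^ (2 * P)) * inverse ((1 + \<bar>\<omega>\<bar>) ^ (2 * P)))"
    using gabor_coeff_decay[OF \<phi> h, of "2 * P" "2 * P"] by blast
  have "cmod (gabor_coeff h \<phi> (x, \<omega>)) \<le> D * plane_decay (x, \<omega>) ^ P" for x \<omega>
  proof -
    have "inverse ((1 + \<bar>x\<bar>) ^ (2 * P)) * inverse ((1 + \<bar>\<omega>\<bar>) ^ (2 * P))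
      = (inverse ((1 + \<bar>x\<bar>)\<^sup>2) * inverse ((1 + \<bar>\<omega>\<bar>)\<^sup>2)) ^ P"
      by (simp only: power_mult_distrib power_inverse power_mult)
    also have "\<dots> \<le> plane_decay (x, \<omega>) ^ P"
      by (intro power_mono inverse_powers_le_plane_decay) auto
    finally show ?thesis using D by (meson mult_left_mono order.trans)
  qed
  then show ?thesis using that D(1) by (metis prod.collapse)
qed

text \<open>The value at z is that of a shifted distribution on the fixed function \<phi>, so the
  coefficients of the expansion depend on y alone. This gives a true convolution whose kernel is the
  same for all \<Lambda> and z, and P can be as large as desired.\<close>

lemma stft_convolution_bound:
  assumes g: "g \<in> schwartz" "g \<noteq> (\<lambda>_. 0)" and \<gamma>: "\<gamma> \<in> schwartz"
  obtains D where "D \<ge> 0" "\<And>\<Lambda> z. \<Lambda> \<in> tempered_distributions \<Longrightarrow>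
    ennreal (cmod (stft \<gamma> \<Lambda> (fst z) (snd z)))
      \<le> (\<integral>\<^sup>+y. ennreal ((D * plane_decay y ^ P) * cmod (stft g \<Lambda> (fst (z + y)) (snd (z + y)))) \<partial>lborel)"
proof -
  define h where "h = (\<lambda>t. cnj (g t))"
  define \<phi> where "\<phi> = (\<lambda>t. cnj (\<gamma> t))"
  have h: "h \<in> schwartz" and \<phi>: "\<phi> \<in> schwartz"
    unfolding h_def \<phi>_def by (rule schwartz_cnj, fact)+
  have "h \<noteq> (\<lambda>_. 0)" using g(2) by (auto simp: h_def fun_eq_iff)
  then have l2: "l2_square h > 0" by (rule l2_square_pos[OF h])
  obtain E where E: "E \<ge> 0" "\<And>z. cmod (gabor_coeff h \<phi> z) \<le> E * plane_decay z ^ P"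
    using gabor_coeff_plane_decay[OF \<phi> h] by blast
  define D where "D = E / l2_square h"
  have "ennreal (cmod (stft \<gamma> \<Lambda> (fst z) (snd z)))
      \<le> (\<integral>\<^sup>+y. ennreal ((D * plane_decay y ^ P) * cmod (stft g \<Lambda> (fst (z + y)) (snd (z + y)))) \<partial>lborel)"
    if \<Lambda>: "\<Lambda> \<in> tempered_distributions" for \<Lambda> z
  proof -
    define x0 where "x0 = fst z"
    define \<omega>0 where "\<omega>0 = - snd z"
    \<comment> \<open>Applied to \<phi>, this is \<Lambda> on the time-frequency shift of \<phi> by
      (x0, \<omega>0), hence the transform with window \<gamma> at z.\<close>
    define \<Lambda>' where "\<Lambda>' = translate_dist (- x0) (modulate_dist \<omega>0 \<Lambda>)"
    have \<Lambda>': "\<Lambda>' \<in> tempered_distributions"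
      unfolding \<Lambda>'_def by (intro tempered_translate tempered_modulate \<Lambda>)
    have shift: "cmod (\<Lambda>' (gabor h 0 y)) = cmod (\<Lambda> (gabor h 0 (x0 + fst y, \<omega>0 + snd y)))" for y
    proof -
      \<comment> \<open>The phase from moving the translation by x0 past the modulation by
        \<open>snd y\<close>; its modulus is 1.\<close>
      define a where "a = exp (- (\<i> * of_real (2 * pi * snd y * x0)))"
      have "modulate \<omega>0 (translate x0 (gabor h 0 y)) = (\<lambda>t. a * gabor h 0 (x0 + fst y, \<omega>0 + snd y) t)"
        unfolding gabor_0 modulate_def translate_def a_def
        by (auto simp: fun_eq_iff mult.assoc[symmetric] exp_add[symmetric] diff_diff_eq)
          (simp add: algebra_simps)
      then have "\<Lambda>' (gabor h 0 y) = a * \<Lambda> (gabor h 0 (x0 + fst y, \<omega>0 + snd y))"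
        by (simp add: \<Lambda>'_def translate_dist_def modulate_dist_def tempered_cmult[OF \<Lambda>])
      then show ?thesis by (simp add: norm_mult a_def)
    qed
    note expand = tempered_gabor_expansion[OF \<Lambda>' \<phi> h]
    have "ennreal (l2_square h * cmod (\<Lambda>' \<phi>)) = ennreal (cmod (of_real (l2_square h) * \<Lambda>' \<phi>))"
      using l2 by (simp add: norm_mult)
    also have "\<dots> \<le> (\<integral>\<^sup>+y. ennreal (cmod (gabor_coeff h \<phi> y * \<Lambda>' (gabor h 0 y))) \<partial>lborel)"
      unfolding expand(2) by (rule integral_norm_bound_ennreal[OF expand(1)])
    also have "\<dots> \<le> (\<integral>\<^sup>+y. ennreal ((E * plane_decay y ^ P) * cmod (\<Lambda> (gabor h 0 (x0 + fst y, \<omega>0 + snd y)))) \<partial>lborel)"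
      by (intro nn_integral_mono ennreal_leI) (simp add: norm_mult shift mult_right_mono E(2))
    also have "\<dots> = (\<integral>\<^sup>+y. ennreal ((E * plane_decay y ^ P) * cmod (stft g \<Lambda> (fst (z + plane_map 0 0 0 (-1) y)) (snd (z + plane_map 0 0 0 (-1) y)))) \<partial>lborel)"
      by (simp add: stft_gabor h_def x0_def \<omega>0_def plane_map_def)
    \<comment> \<open>\<open>plane_decay\<close> is even in the frequency, so the reflection may be
      inserted in it too; the whole integrand is then a function of the reflected point.\<close>
    also have "\<dots> = (\<integral>\<^sup>+y. ennreal ((E * plane_decay (plane_map 0 0 0 (-1) y) ^ P) * cmod (stft g \<Lambda> (fst (z + plane_map 0 0 0 (-1) y)) (snd (z + plane_map 0 0 0 (-1) y)))) \<partial>lborel)"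
      by (simp add: plane_decay_def plane_map_def)
    also have "\<dots> = (\<integral>\<^sup>+y. ennreal ((E * plane_decay y ^ P) * cmod (stft g \<Lambda> (fst (z + y)) (snd (z + y)))) \<partial>lborel)"
    proof (rule nn_integral_plane_map)
      have [measurable]: "(\<lambda>y. cmod (stft g \<Lambda> (fst (z + y)) (snd (z + y)))) \<in> borel_measurable borel"
        using measurable_compose[OF _ stft_measurable[OF \<Lambda> g(1)], of "\<lambda>y. z + y"] by simp
      have [measurable]: "plane_decay \<in> borel_measurable borel" using plane_decay_integrable by auto
      show "(\<lambda>y. ennreal ((E * plane_decay y ^ P) * cmod (stft g \<Lambda> (fst (z + y)) (snd (z + y))))) \<in> borel_measurable borel"
        by measurable
    qed simp
    finally have "ennreal (inverse (l2_square h)) * ennreal (l2_square h * cmod (\<Lambda>' \<phi>))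
      \<le> ennreal (inverse (l2_square h)) * (\<integral>\<^sup>+y. ennreal ((E * plane_decay y ^ P) * cmod (stft g \<Lambda> (fst (z + y)) (snd (z + y)))) \<partial>lborel)"
      by (intro mult_left_mono) auto
    also have "\<dots> = (\<integral>\<^sup>+y. ennreal (inverse (l2_square h)) * ennreal ((E * plane_decay y ^ P) * cmod (stft g \<Lambda> (fst (z + y)) (snd (z + y)))) \<partial>lborel)"
    proof (rule nn_integral_cmult[symmetric])
      have [measurable]: "(\<lambda>y. cmod (stft g \<Lambda> (fst (z + y)) (snd (z + y)))) \<in> borel_measurable borel"
        using measurable_compose[OF _ stft_measurable[OF \<Lambda> g(1)], of "\<lambda>y. z + y"] by simp
      have [measurable]: "plane_decay \<in> borel_measurable borel" using plane_decay_integrable by auto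
      show "(\<lambda>y. ennreal ((E * plane_decay y ^ P) * cmod (stft g \<Lambda> (fst (z + y)) (snd (z + y))))) \<in> borel_measurable lborel"
        by measurable
    qed
    also have "\<dots> = (\<integral>\<^sup>+y. ennreal ((D * plane_decay y ^ P) * cmod (stft g \<Lambda> (fst (z + y)) (snd (z + y)))) \<partial>lborel)"
      using l2 E(1) plane_decay_nonneg by (simp add: ennreal_mult[symmetric] D_def field_simps)
    also have "ennreal (inverse (l2_square h)) * ennreal (l2_square h * cmod (\<Lambda>' \<phi>)) = ennreal (cmod (\<Lambda>' \<phi>))"
      using l2 by (simp add: ennreal_mult[symmetric])
    also have "\<Lambda>' \<phi> = stft \<gamma> \<Lambda> (fst z) (snd z)"
      by (simp add: \<Lambda>'_def translate_dist_def modulate_dist_def stft_gabor gabor_0 \<phi>_def x0_def \<omega>0_def)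
    finally show ?thesis .
  qed
  moreover have "D \<ge> 0" using E(1) l2 by (simp add: D_def)
  ultimately show ?thesis using that by blast
qed

section \<open>Window independence and chirps\<close>

lemma inverse_plane_decay: "inverse (plane_decay z) = (1 + (fst z)\<^sup>2) * (1 + (snd z)\<^sup>2)"
  by (simp add: plane_decay_def)

lemma linear_growth_le_plane_decay: "1 + \<bar>x\<bar> + \<bar>\<omega>\<bar> \<le> 4 * inverse (plane_decay (x, \<omega>))"
proof -
  have sq: "1 + \<bar>y\<bar> \<le> 2 * (1 + y\<^sup>2)" for y :: real
  proof (cases "\<bar>y\<bar> \<le> 1")
    case False
    then have "\<bar>y\<bar> * 1 \<le> \<bar>y\<bar> * \<bar>y\<bar>" by (intro mult_left_mono) auto
    then show ?thesis by (simp add: power2_eq_square)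
  next
    case True
    then have "1 + \<bar>y\<bar> \<le> 2 * 1" by simp
    also have "\<dots> \<le> 2 * (1 + y\<^sup>2)" by (intro mult_left_mono) auto
    finally show ?thesis .
  qed
  have "1 + \<bar>x\<bar> + \<bar>\<omega>\<bar> \<le> (1 + \<bar>x\<bar>) * (1 + \<bar>\<omega>\<bar>)" by (simp add: algebra_simps)
  also have "\<dots> \<le> (2 * (1 + x\<^sup>2)) * (2 * (1 + \<omega>\<^sup>2))" by (intro mult_mono sq) auto
  finally show ?thesis by (simp add: inverse_plane_decay algebra_simps)
qed

lemma weight_pos: "weight m \<Longrightarrow> 0 < m z"
  by (simp only: weight_def)

text \<open>Polynomial growth lets the submultiplicative weight be replaced by an explicit Borel and
  even function of y, whose powers combine with those of the convolution kernel.\<close>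

lemma moderate_plane_decay:
  assumes "moderate m" "weight m"
  obtains A q where "A > 0" "\<And>z y. m (z + y) \<le> A * m z * inverse (plane_decay y) ^ q"
proof -
  have m: "m z > 0" for z by (rule weight_pos[OF assms(2)])
  obtain v C where v: "weight v" "polynomial_growth v" and C: "C > 0" "\<And>z1 z2. m (z1 + z2) \<le> C * m z1 * v z2"
    using assms(1) unfolding moderate_def by blast
  obtain B k where B: "B > 0" "k \<ge> 0" "\<And>x \<omega>. v (x, \<omega>) \<le> B * (1 + \<bar>x\<bar> + \<bar>\<omega>\<bar>) powr k"
    using v(2) unfolding polynomial_growth_def by blast
  define q where "q = nat \<lceil>k\<rceil>"
  have q: "k \<le> real q" unfolding q_def by linarith
  have vb: "v y \<le> (B * 4 ^ q) * inverse (plane_decay y) ^ q" for y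
  proof -
    obtain x \<omega> where y: "y = (x, \<omega>)" by (cases y)
    have "(1 + \<bar>x\<bar> + \<bar>\<omega>\<bar>) powr k \<le> (1 + \<bar>x\<bar> + \<bar>\<omega>\<bar>) powr real q"
      using q by (intro powr_mono) auto
    also have "\<dots> = (1 + \<bar>x\<bar> + \<bar>\<omega>\<bar>) ^ q" by (simp add: powr_realpow add_pos_nonneg)
    also have "\<dots> \<le> (4 * inverse (plane_decay y)) ^ q"
      unfolding y by (intro power_mono linear_growth_le_plane_decay) auto
    finally have "B * (1 + \<bar>x\<bar> + \<bar>\<omega>\<bar>) powr k \<le> B * (4 * inverse (plane_decay y)) ^ q"
      using B(1) by (intro mult_left_mono) auto
    then show ?thesis using B(3)[of x \<omega>] by (simp add: y power_mult_distrib mult.assoc)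
  qed
  have "m (z + y) \<le> (C * (B * 4 ^ q)) * m z * inverse (plane_decay y) ^ q" for z y
  proof -
    have "m (z + y) \<le> C * m z * v y" by (rule C(2))
    also have "\<dots> \<le> C * m z * ((B * 4 ^ q) * inverse (plane_decay y) ^ q)"
      using C(1) m[of z] by (intro mult_left_mono vb) auto
    finally show ?thesis by (simp add: mult_ac)
  qed
  moreover have "C * (B * 4 ^ q) > 0" using C B by simp
  ultimately show ?thesis using that by blast
qed

text \<open>
  A Borel replacement for a moderate weight, which is only Lebesgue measurable; the pointwise
  moderateness inequality would not survive an almost everywhere modification.
\<close>

definition grid_weight :: "(real \<times> real \<Rightarrow> real) \<Rightarrow> real \<times> real \<Rightarrow> real" where
  "grid_weight m z = m (of_int \<lfloor>fst z\<rfloor>, of_int \<lfloor>snd z\<rfloor>)"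

lemma grid_weight_measurable [measurable]: "grid_weight m \<in> borel_measurable borel"
proof -
  have f: "(\<lambda>z::real \<times> real. \<lfloor>fst z\<rfloor>) \<in> borel \<rightarrow>\<^sub>M count_space UNIV"
    by (rule measurable_compose[OF _ measurable_real_floor, of fst])
      (intro borel_measurable_continuous_onI continuous_intros)
  have g: "(\<lambda>z::real \<times> real. \<lfloor>snd z\<rfloor>) \<in> borel \<rightarrow>\<^sub>M count_space UNIV"
    by (rule measurable_compose[OF _ measurable_real_floor, of snd])
      (intro borel_measurable_continuous_onI continuous_intros)
  have "(\<lambda>z::real \<times> real. m (of_int i, of_int \<lfloor>snd z\<rfloor>)) \<in> borel_measurable borel" for i
    by (rule measurable_compose[OF g]) simp
  then show ?thesis
    unfolding grid_weight_def[abs_def]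
    by (rule measurable_compose_countable[OF _ f, where f="\<lambda>i z. m (of_int i, of_int \<lfloor>snd z\<rfloor>)"])
qed

text \<open>A point differs from its lower left grid corner by at most 1 in each coordinate. On such
  offsets the inverse of \<open>plane_decay\<close> is at most (1 + 1) (1 + 1) = 4, and moderateness
  is applied in both directions.\<close>

lemma grid_weight_comparable:
  assumes "moderate m" "weight m"
  obtains B where "B > 0" "\<And>z. m z \<le> B * grid_weight m z" "\<And>z. grid_weight m z \<le> B * m z"
proof -
  have m: "m z > 0" for z by (rule weight_pos[OF assms(2)])
  obtain A q where A: "A > 0" "\<And>z y. m (z + y) \<le> A * m z * inverse (plane_decay y) ^ q"
    using moderate_plane_decay[OF assms] by blast
  have near: "m (z + y) \<le> (A * 4 ^ q) * m z" if "\<bar>fst y\<bar> \<le> 1" "\<bar>snd y\<bar> \<le> 1" for z y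
  proof -
    have "inverse (plane_decay y) \<le> (1 + 1) * (1 + 1)"
      unfolding inverse_plane_decay using that by (intro mult_mono add_left_mono) (auto simp: abs_square_le_1)
    then have "inverse (plane_decay y) ^ q \<le> 4 ^ q"
      using plane_decay_nonneg by (intro power_mono) auto
    then have "A * m z * inverse (plane_decay y) ^ q \<le> A * m z * 4 ^ q"
      using A(1) m[of z] by (intro mult_left_mono) auto
    then show ?thesis using A(2)[of z y] by (simp add: mult_ac)
  qed
  have fr: "\<bar>x - of_int \<lfloor>x\<rfloor>\<bar> \<le> 1" for x :: real by linarith
  show ?thesis
  proof
    show "A * 4 ^ q > 0" using A by simp
    fix z :: "real \<times> real"
    obtain x \<omega> where z: "z = (x, \<omega>)" by (cases z)
    show "m z \<le> (A * 4 ^ q) * grid_weight m z"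
      using near[of "(x - of_int \<lfloor>x\<rfloor>, \<omega> - of_int \<lfloor>\<omega>\<rfloor>)" "(of_int \<lfloor>x\<rfloor>, of_int \<lfloor>\<omega>\<rfloor>)"] fr[of x] fr[of \<omega>]
      by (simp add: z grid_weight_def)
    show "grid_weight m z \<le> (A * 4 ^ q) * m z"
      using near[of "(of_int \<lfloor>x\<rfloor> - x, of_int \<lfloor>\<omega>\<rfloor> - \<omega>)" z] fr[of x] fr[of \<omega>]
      by (simp add: z grid_weight_def abs_minus_commute)
  qed
qed

lemma weight_power_measurable:
  assumes "weight m" shows "(\<lambda>z. m z powr r) \<in> borel_measurable lebesgue"
proof -
  have [measurable]: "m \<in> borel_measurable lebesgue" using assms by (simp add: weight_def)
  show ?thesis by measurable
qed

lemma stft_weight_measurable: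
  assumes "\<Lambda> \<in> tempered_distributions" "g \<in> schwartz" "weight m"
  shows "(\<lambda>(x, \<omega>). cmod (stft g \<Lambda> x \<omega>) powr r * m (x, \<omega>) powr r) \<in> borel_measurable lebesgue"
proof -
  have "(\<lambda>z. cmod (stft g \<Lambda> (fst z) (snd z)) powr r) \<in> borel_measurable lebesgue"
    using stft_measurable[OF assms(1,2)] by (intro measurable_completion) simp
  then show ?thesis using weight_power_measurable[OF assms(3), of r]
    unfolding split_beta' by (simp add: borel_measurable_times)
qed

text \<open>Turns membership into finiteness of the integral of a Borel function, the form in which
  \<open>weighted_convolution_bound\<close> can be applied.\<close>

lemma modulation_space_iff_grid:
  assumes \<Lambda>: "\<Lambda> \<in> tempered_distributions" and g: "g \<in> schwartz"
    and m: "weight m" "moderate m" and r: "1 \<le> r"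
  shows "\<Lambda> \<in> modulation_space g r m \<longleftrightarrow>
    (\<integral>\<^sup>+z. ennreal (cmod (stft g \<Lambda> (fst z) (snd z)) powr r * grid_weight m z powr r) \<partial>lborel) < \<infinity>"
proof -
  define F where "F z = cmod (stft g \<Lambda> (fst z) (snd z))" for z
  have [measurable]: "F \<in> borel_measurable borel" unfolding F_def[abs_def] by (rule stft_measurable[OF \<Lambda> g])
  have mpos: "m z > 0" for z by (rule weight_pos[OF m(1)])
  then have gpos: "grid_weight m z > 0" for z by (simp add: grid_weight_def)
  obtain B where B: "B > 0" "\<And>z. m z \<le> B * grid_weight m z" "\<And>z. grid_weight m z \<le> B * m z"
    using grid_weight_comparable[OF m(2,1)] by blast
  have le: "F z powr r * a powr r \<le> B powr r * (F z powr r * b powr r)"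
    if "0 < a" "a \<le> B * b" "0 < b" for z a b
  proof -
    have "a powr r \<le> (B * b) powr r" using that r by (intro powr_mono2) auto
    also have "\<dots> = B powr r * b powr r" using B(1) that by (simp add: powr_mult)
    finally have "F z powr r * a powr r \<le> F z powr r * (B powr r * b powr r)" by (intro mult_left_mono) auto
    then show ?thesis by (simp add: mult_ac)
  qed
  have meas1: "(\<lambda>z. F z powr r * m z powr r) \<in> borel_measurable lebesgue"
    using stft_weight_measurable[OF \<Lambda> g m(1), of r] by (simp add: F_def split_beta')
  have meas2: "(\<lambda>z. F z powr r * grid_weight m z powr r) \<in> borel_measurable borel" by measurable
  then have meas3: "(\<lambda>z. F z powr r * grid_weight m z powr r) \<in> borel_measurable lebesgue"
    by (intro measurable_completion) simp
  have "\<Lambda> \<in> modulation_space g r m \<longleftrightarrow> integrable lebesgue (\<lambda>z. F z powr r * m z powr r)"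
    using \<Lambda> by (simp add: modulation_space_def F_def split_beta')
  also have "\<dots> \<longleftrightarrow> integrable lebesgue (\<lambda>z. F z powr r * grid_weight m z powr r)"
  proof
    assume "integrable lebesgue (\<lambda>z. F z powr r * m z powr r)"
    then have "integrable lebesgue (\<lambda>z. B powr r * (F z powr r * m z powr r))" by simp
    then show "integrable lebesgue (\<lambda>z. F z powr r * grid_weight m z powr r)"
      by (rule Bochner_Integration.integrable_bound) (use meas3 le[OF gpos B(3) mpos] in \<open>auto intro!: AE_I2\<close>)
  next
    assume "integrable lebesgue (\<lambda>z. F z powr r * grid_weight m z powr r)"
    then have "integrable lebesgue (\<lambda>z. B powr r * (F z powr r * grid_weight m z powr r))" by simp
    then show "integrable lebesgue (\<lambda>z. F z powr r * m z powr r)"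
      by (rule Bochner_Integration.integrable_bound) (use meas1 le[OF mpos B(2) gpos] in \<open>auto intro!: AE_I2\<close>)
  qed
  also have "\<dots> \<longleftrightarrow> integrable lborel (\<lambda>z. F z powr r * grid_weight m z powr r)"
    using meas2 by (intro integrable_completion) simp
  also have "\<dots> \<longleftrightarrow> (\<integral>\<^sup>+z. ennreal (F z powr r * grid_weight m z powr r) \<partial>lborel) < \<infinity>"
    using meas2 by (simp add: integrable_iff_bounded)
  finally show ?thesis by (simp add: F_def)
qed

theorem modulation_space_window:
  assumes g: "g \<in> schwartz" "g \<noteq> (\<lambda>_. 0)" and \<gamma>: "\<gamma> \<in> schwartz"
    and m: "weight m" "moderate m" and r: "1 \<le> r" and \<Lambda>: "\<Lambda> \<in> modulation_space g r m"
  shows "\<Lambda> \<in> modulation_space \<gamma> r m"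
proof -
  have t: "\<Lambda> \<in> tempered_distributions" using \<Lambda> by (simp add: modulation_space_def)
  have mpos: "m z > 0" for z by (rule weight_pos[OF m(1)])
  then have gpos: "grid_weight m z > 0" for z by (simp add: grid_weight_def)
  obtain A q where A: "A > 0" "\<And>z y. m (z + y) \<le> A * m z * inverse (plane_decay y) ^ q"
    using moderate_plane_decay[OF m(2,1)] by blast
  obtain B where B: "B > 0" "\<And>z. m z \<le> B * grid_weight m z" "\<And>z. grid_weight m z \<le> B * m z"
    using grid_weight_comparable[OF m(2,1)] by blast
  \<comment> \<open>The factor \<open>\<Omega> y powr r\<close> grows like
    \<open>plane_decay\<close> to the power -(q r). Taking P at least q r + 1 leaves one full,
    integrable power of \<open>plane_decay\<close>.\<close>
  define P where "P = Suc (nat \<lceil>q * r\<rceil>)"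
  have P: "q * r + 1 \<le> real P" unfolding P_def by linarith
  obtain D where D: "D \<ge> 0" and D': "\<And>\<Lambda> z. \<Lambda> \<in> tempered_distributions \<Longrightarrow>
    ennreal (cmod (stft \<gamma> \<Lambda> (fst z) (snd z)))
      \<le> (\<integral>\<^sup>+y. ennreal ((D * plane_decay y ^ P) * cmod (stft g \<Lambda> (fst (z + y)) (snd (z + y)))) \<partial>lborel)"
    by (rule stft_convolution_bound[OF g \<gamma>, of P], rule that)
  \<comment> \<open>One factor B for each of the two passages between m and its grid version, and A
    for the shift by -y.\<close>
  define c where "c = B * A * B"
  have c: "c > 0" using A B by (simp add: c_def)
  define \<Omega> where "\<Omega> y = c * inverse (plane_decay y) ^ q" for y
  have [measurable]: "plane_decay \<in> borel_measurable borel" using plane_decay_integrable by auto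
  have fin: "(\<integral>\<^sup>+y. ennreal (a y) \<partial>lborel) < \<infinity>" if "\<And>y. a y \<le> b * plane_decay y" "0 \<le> b" for a b
  proof -
    have "(\<integral>\<^sup>+y. ennreal (a y) \<partial>lborel) \<le> (\<integral>\<^sup>+y. ennreal (norm (b * plane_decay y)) \<partial>lborel)"
      by (intro nn_integral_mono ennreal_leI) (use that plane_decay_nonneg in auto)
    also have "\<dots> < \<infinity>" using plane_decay_integrable integrable_iff_bounded[of lborel "\<lambda>y. b * plane_decay y"] by simp
    finally show ?thesis .
  qed
  have decay: "plane_decay y powr e \<le> plane_decay y" if "1 \<le> e" for y e
    using powr_mono'[of 1 e "plane_decay y"] that plane_decay_le_1[of y] plane_decay_pos[of y] by simp
  have "(\<integral>\<^sup>+z. ennreal (cmod (stft \<gamma> \<Lambda> (fst z) (snd z)) powr r * grid_weight m z powr r) \<partial>lborel) < \<infinity>"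
  proof (rule weighted_convolution_bound[where K="\<lambda>y. D * plane_decay y ^ P" and \<Omega>=\<Omega>])
    show "grid_weight m z \<le> \<Omega> y * grid_weight m (z + y)" for z y
    proof -
      \<comment> \<open>Moderateness bounds a shifted value by the original one, while here the
        value at z is to be bounded by the one at z + y; hence the shift by -y.\<close>
      have "grid_weight m z \<le> B * m ((z + y) + - y)" using B(3)[of z] by simp
      also have "\<dots> \<le> B * (A * m (z + y) * inverse (plane_decay (- y)) ^ q)"
        using A(2)[of "z + y" "- y"] B(1) by (intro mult_left_mono) auto
      also have "plane_decay (- y) = plane_decay y" by (simp add: plane_decay_def)
      also have "B * (A * m (z + y) * inverse (plane_decay y) ^ q)
          \<le> B * (A * (B * grid_weight m (z + y)) * inverse (plane_decay y) ^ q)"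
        using A(1) B plane_decay_nonneg by (intro mult_left_mono mult_right_mono) auto
      finally show ?thesis by (simp add: \<Omega>_def c_def mult_ac)
    qed
    show "(\<integral>\<^sup>+y. ennreal (D * plane_decay y ^ P) \<partial>lborel) < \<infinity>"
    proof (rule fin[of _ D])
      fix y
      have "plane_decay y ^ P \<le> plane_decay y ^ 1"
        using plane_decay_le_1 plane_decay_nonneg by (intro power_decreasing) (auto simp: P_def)
      then show "D * plane_decay y ^ P \<le> D * plane_decay y" using D by (simp add: mult_left_mono)
    qed (rule D)
    show "(\<integral>\<^sup>+y. ennreal (D * plane_decay y ^ P * \<Omega> y powr r) \<partial>lborel) < \<infinity>"
    proof (rule fin[of _ "D * c powr r"])
      fix y
      have p: "plane_decay y > 0" by (rule plane_decay_pos)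
      have "\<Omega> y powr r = c powr r * plane_decay y powr (- (q * r))"
        using c p by (simp add: \<Omega>_def powr_mult powr_powr powr_realpow[symmetric] powr_minus[symmetric] inverse_powr)
      then have "D * plane_decay y ^ P * \<Omega> y powr r = D * c powr r * (plane_decay y powr P * plane_decay y powr (- (q * r)))"
        using p by (simp add: powr_realpow)
      also have "plane_decay y powr P * plane_decay y powr (- (q * r)) = plane_decay y powr (P - q * r)"
        by (simp add: powr_add[symmetric])
      also have "D * c powr r * \<dots> \<le> D * c powr r * plane_decay y"
        using P D by (intro mult_left_mono decay) auto
      finally show "D * plane_decay y ^ P * \<Omega> y powr r \<le> D * c powr r * plane_decay y" .
    qed (use D in auto)
    show "(\<integral>\<^sup>+z. ennreal (cmod (stft g \<Lambda> (fst z) (snd z)) powr r * grid_weight m z powr r) \<partial>lborel) < \<infinity>"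
      using \<Lambda> modulation_space_iff_grid[OF t g(1) m r] by simp
    show "\<Omega> \<in> borel_measurable borel" unfolding \<Omega>_def by measurable
    show "0 \<le> \<Omega> y" for y using c plane_decay_nonneg by (simp add: \<Omega>_def)
    show "(\<lambda>y. D * plane_decay y ^ P) \<in> borel_measurable borel" by measurable
    show "0 \<le> D * plane_decay y ^ P" for y using D plane_decay_nonneg by simp
    show "0 \<le> grid_weight m z" for z using gpos less_imp_le by blast
  qed (rule D'[OF t] | simp add: stft_measurable[OF t] g(1) \<gamma> r)+
  then show ?thesis using modulation_space_iff_grid[OF t \<gamma> m r] by simp
qed

section \<open>Chirps acting on modulation spaces\<close>

lemma cmod_stft_chirp:
  assumes \<Lambda>: "\<Lambda> \<in> tempered_distributions"
  shows "cmod (stft w (chirp_dist s \<Lambda>) x \<omega>) = cmod (stft (chirp (- s) w) \<Lambda> x (\<omega> - s * x))"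
proof -
  define a where "a = exp (- (\<i> * of_real (pi * s * x\<^sup>2)))"
  \<comment> \<open>Completing the square: t^2 = (t - x)^2 + 2 x t - x^2. The three terms go to the
    chirped window, to the frequency shift by s x and to the phase a.\<close>
  have "chirp s (\<lambda>t. cnj (modulate \<omega> (translate x w) t))
    = (\<lambda>t. a * cnj (modulate (\<omega> - s * x) (translate x (chirp (- s) w)) t))"
    unfolding a_def
    by (auto simp: chirp_def modulate_def translate_def fun_eq_iff exp_cnj mult.assoc[symmetric] exp_add[symmetric])
      (simp add: algebra_simps power2_eq_square)
  then show ?thesis
    by (simp add: stft_def pairing_def chirp_dist_def tempered_cmult[OF \<Lambda>] norm_mult a_def)
qed

text \<open>The shear transforms the integral for the chirped distribution, with the sheared weight,
  into the one for \<Lambda> with weight m and window \<open>chirp (- s) w\<close>. Only then is the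
  window exchanged, in both directions, so moderateness is used for m alone.\<close>

lemma modulation_space_chirp:
  assumes \<Lambda>: "\<Lambda> \<in> tempered_distributions" and w: "w \<in> schwartz" "w \<noteq> (\<lambda>_. 0)"
    and m: "weight m" "moderate m" and r: "1 \<le> r"
  shows "\<Lambda> \<in> modulation_space w r m \<longleftrightarrow>
    chirp_dist s \<Lambda> \<in> modulation_space w r (\<lambda>(x, \<omega>). m (x, \<omega> - s * x))"
proof -
  define w' where "w' = chirp (- s) w"
  have w': "w' \<in> schwartz" "w' \<noteq> (\<lambda>_. 0)"
    using w by (auto simp: w'_def chirp_schwartz_iff) (auto simp: chirp_def fun_eq_iff)
  define H where "H = (\<lambda>(x, \<omega>). cmod (stft w' \<Lambda> x \<omega>) powr r * m (x, \<omega>) powr r)"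
  have H: "H \<in> borel_measurable lebesgue" unfolding H_def by (rule stft_weight_measurable[OF \<Lambda> w'(1) m(1)])
  have "chirp_dist s \<Lambda> \<in> modulation_space w r (\<lambda>(x, \<omega>). m (x, \<omega> - s * x))
    \<longleftrightarrow> integrable lebesgue (\<lambda>z. H (plane_map 0 0 (- s) 1 z))"
    using tempered_chirp[OF \<Lambda>]
    by (simp add: modulation_space_def cmod_stft_chirp[OF \<Lambda>] H_def plane_map_def w'_def split_beta')
  also have "\<dots> \<longleftrightarrow> integrable lebesgue H"
    by (rule integrable_lebesgue_plane_map[OF _ H]) simp
  also have "\<dots> \<longleftrightarrow> \<Lambda> \<in> modulation_space w' r m"
    using \<Lambda> by (simp add: modulation_space_def H_def)
  also have "\<dots> \<longleftrightarrow> \<Lambda> \<in> modulation_space w r m"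
    using modulation_space_window[OF w' w(1) m r] modulation_space_window[OF w w'(1) m r] by blast
  finally show ?thesis by simp
qed

section \<open>Chirps on S0 and its dual\<close>

lemma unit_weight: "weight (\<lambda>_. 1)" "moderate (\<lambda>_. 1)"
proof -
  show w: "weight (\<lambda>_. 1)" by (simp add: weight_def)
  have "polynomial_growth (\<lambda>_. 1)"
    unfolding polynomial_growth_def by (intro exI[of _ 1] conjI exI[of _ 0]) auto
  then show "moderate (\<lambda>_. 1)"
    unfolding moderate_def using w
    by (intro exI[of _ "\<lambda>_. 1"] conjI exI[of _ 1]) (auto simp: submultiplicative_def)
qed

text \<open>Conjugating f amounts to conjugating the window and reflecting the frequency; the shifts
  translate the plane. After window independence has been used for the conjugate window, an affine
  change of variables remains.\<close>

lemma S0_shift_conj: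
  assumes w: "w \<in> schwartz" "w \<noteq> (\<lambda>_. 0)" and f: "f \<in> S0 w"
  shows "translate_dist (- x) (modulate_dist \<omega> (conj_dist f)) \<in> S0 w"
proof -
  have t: "f \<in> tempered_distributions" using f by (simp add: modulation_space_def)
  define w' where "w' = (\<lambda>t. cnj (w t))"
  have w': "w' \<in> schwartz" unfolding w'_def by (rule schwartz_cnj[OF w(1)])
  have f': "f \<in> S0 w'" by (rule modulation_space_window[OF w w' unit_weight _ f]) simp
  define H where "H = (\<lambda>(x, \<omega>). cmod (stft w' f x \<omega>) powr 1 * 1 powr 1)"
  have H: "H \<in> borel_measurable lebesgue"
    unfolding H_def by (rule stft_weight_measurable[OF t w' unit_weight(1)])
  have shift: "cmod (stft w (translate_dist (- x) (modulate_dist \<omega> (conj_dist f))) y \<eta>)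
    = cmod (stft w' f (x + y) (\<omega> - \<eta>))" for y \<eta>
  proof -
    define a where "a = exp (- (\<i> * of_real (2 * pi * \<eta> * x)))"
    have "(\<lambda>t. cnj (modulate \<omega> (translate x (\<lambda>t. cnj (modulate \<eta> (translate y w) t))) t))
      = (\<lambda>t. a * cnj (modulate (\<omega> - \<eta>) (translate (x + y) w') t))"
      unfolding a_def w'_def
      by (auto simp: modulate_def translate_def fun_eq_iff exp_cnj mult.assoc[symmetric] exp_add[symmetric] diff_diff_eq)
        (simp add: algebra_simps)
    then show ?thesis
      by (simp add: stft_def pairing_def translate_dist_def modulate_dist_def conj_dist_def
          tempered_cmult[OF t] norm_mult a_def)
  qed
  have "integrable lebesgue H" using f' by (simp add: modulation_space_def H_def)
  then have "integrable lebesgue (\<lambda>z. H (plane_map x \<omega> 0 (-1) z))"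
    using integrable_lebesgue_plane_map[OF _ H, of "-1"] by simp
  then show ?thesis
    using tempered_translate[OF tempered_modulate[OF tempered_conj[OF t]]]
    by (simp add: modulation_space_def shift H_def plane_map_def split_beta')
qed

lemma stft_S0_chirp:
  assumes w: "w \<in> schwartz" "w \<noteq> (\<lambda>_. 0)" and f: "f \<in> S0 w" and g: "g \<in> S0_dual w"
  shows "stft_S0 (chirp_S0_dual s g) (chirp_dist s f) x \<omega>
    = exp (- \<i> * of_real (pi * s * x\<^sup>2)) * stft_S0 g f x (\<omega> - s * x)"
proof -
  have t: "f \<in> tempered_distributions" using f by (simp add: modulation_space_def)
  define a where "a = exp (- \<i> * of_real (pi * s * x\<^sup>2))"
  define h where "h = translate_dist (- x) (modulate_dist (\<omega> - s * x) (conj_dist f))"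
  have h: "h \<in> S0 w" unfolding h_def by (rule S0_shift_conj[OF w f])
  have "chirp_dist s (translate_dist (- x) (modulate_dist \<omega> (conj_dist (chirp_dist s f)))) \<phi> = cnj a * h \<phi>" for \<phi>
  proof -
    \<comment> \<open>The conjugation inverts the inner chirp, so the two quadratic exponents leave
      t^2 - (t - x)^2 = 2 x t - x^2: a frequency shift by s x and the constant phase a.\<close>
    have "chirp s (\<lambda>t. cnj (modulate \<omega> (translate x (chirp s \<phi>)) t))
      = (\<lambda>t. a * cnj (modulate (\<omega> - s * x) (translate x \<phi>) t))"
      unfolding a_def
      by (auto simp: chirp_def modulate_def translate_def fun_eq_iff exp_cnj mult.assoc[symmetric] exp_add[symmetric])
        (simp add: algebra_simps power2_eq_square)
    then show ?thesis
      by (simp add: h_def chirp_dist_def translate_dist_def modulate_dist_def conj_dist_def tempered_cmult[OF t])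
  qed
  then have "chirp_dist s (translate_dist (- x) (modulate_dist \<omega> (conj_dist (chirp_dist s f)))) = (\<lambda>\<phi>. cnj a * h \<phi>)"
    by (simp add: fun_eq_iff)
  \<comment> \<open>The functional g is homogeneous on S0 only, so membership of h is essential
    here. The outer conjugation in \<open>pairing_S0\<close> then turns \<open>cnj a\<close> back
    into a.\<close>
  moreover have "g (\<lambda>\<phi>. cnj a * h \<phi>) = cnj a * g h" using g h by (simp add: S0_dual_def)
  ultimately have "stft_S0 (chirp_S0_dual s g) (chirp_dist s f) x \<omega> = a * stft_S0 g f x (\<omega> - s * x)"
    by (simp add: stft_S0_def pairing_S0_def modulate_S0_dual_def translate_S0_dual_def chirp_S0_dual_def
        h_def[symmetric])
  then show ?thesis unfolding a_def .
qed

theorem proposition4p1: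
  fixes s :: real and w :: "real \<Rightarrow> complex"
  assumes "w \<in> schwartz" and "w \<noteq> (\<lambda>_. 0)"
  shows "(\<forall>f \<in> S0 w. \<forall>g \<in> S0_dual w. \<forall>x \<omega> :: real.
            stft_S0 (chirp_S0_dual s g) (chirp_dist s f) x \<omega>
              = exp (- \<i> * of_real (pi * s * x\<^sup>2)) * stft_S0 g f x (\<omega> - s * x))
       \<and> (\<forall>(r::real) (m :: real \<times> real \<Rightarrow> real).
            1 \<le> r \<longrightarrow> weight m \<longrightarrow> moderate m \<longrightarrow> polynomial_growth m \<longrightarrow>
            (\<forall>f \<in> tempered_distributions.
               f \<in> modulation_space w r m \<longleftrightarrow>
               chirp_dist s f \<in> modulation_space w r (\<lambda>(x, \<omega>). m (x, \<omega> - s * x))))"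
  using stft_S0_chirp[OF assms] modulation_space_chirp[OF _ assms] by blast

end
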